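(* For $\vec{x}=(a,b,c,d,e,f,g)^T\in V$, $$S(c)\,A(1-a,e-a,f-a,g-a)\,A(b,1+b-e,1+b-f,1+b-g)\,K_{p_0}(\vec{x})-S(b-a)\,A(a,b,c,d)\,A(1-c,e-c,f-c,g-c)\,L_{\overline{1}}(\vec{x})-B_1(\vec{x})\,K_{p_1}(\vec{x})=0.$$
   Context: $V=\{(a,b,c,d,e,f,g)^T\in\mathbb{C}^7: e+f+g-a-b-c-d=1\}$. ${}_4F_3\left[\begin{smallmatrix}a,b,c,d\\ e,f,g\end{smallmatrix};1\right]=\sum_{n\ge0}\frac{(a)_n(b)_n(c)_n(d)_n}{n!(e)_n(f)_n(g)_n}$, with $(a)_n$ the rising factorial. For $(a,b,c,d,e,f,g)^T\in V$, $$K(a;b,c,d;e,f,g)=\frac{{}_4F_3\left[\begin{smallmatrix}a,b,c,d\\ e,f,g\end{smallmatrix};1\right]}{\sin\pi a\,\Gamma(a)\Gamma(1+a-e)\Gamma(1+a-f)\Gamma(1+a-g)\Gamma(e)\Gamma(f)\Gamma(g)}+\frac{{}_4F_3\left[\begin{smallmatrix}a,1+a-e,1+a-f,1+a-g\\ 1+a-b,1+a-c,1+a-d\end{smallmatrix};1\right]}{\sin\pi a\,\Gamma(a)\Gamma(b)\Gamma(c)\Gamma(d)\Gamma(1+a-b)\Gamma(1+a-c)\Gamma(1+a-d)},$$ $$L(a,b,c,d;e;f,g)=\frac{{}_4F_3\left[\begin{smallmatrix}a,b,c,d\\ e,f,g\end{smallmatrix};1\right]}{\sin\pi e\,\Gamma(1+a-e)\Gamma(1+b-e)\Gamma(1+c-e)\Gamma(1+d-e)\Gamma(e)\Gamma(f)\Gamma(g)}-\frac{{}_4F_3\left[\begin{smallmatrix}1+a-e,1+b-e,1+c-e,1+d-e\\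 2-e,1+f-e,1+g-e\end{smallmatrix};1\right]}{\sin\pi e\,\Gamma(a)\Gamma(b)\Gamma(c)\Gamma(d)\Gamma(2-e)\Gamma(1+f-e)\Gamma(1+g-e)}.$$ Notation: $S(a_1,\dots,a_n)=\sin\pi a_1\cdots\sin\pi a_n$; $A(x,y,z,w)=\frac{1}{\Gamma(x)\Gamma(y)\Gamma(z)\Gamma(w)}$ (with $1/\Gamma=0$ at nonpositive integers). The relation is asserted for those $\vec{x}\in V$ at which the $K$ and $L$ functions occurring are defined (no lower parameter of an occurring series is a nonpositive integer, no sine in an occurring denominator vanishes). Here $K_{p_0}(\vec{x})=K(a;b,c,d;e,f,g)$, $K_{p_1}(\vec{x})=K(b;c,d,a;e,f,g)$, $L_{\overline{1}}(\vec{x})=L(1-a,e-a,f-a,g-a;1+d-a;1+c-a,1+b-a)$, and $B_1(\vec{x})=\pi^{-4}S(b,c)\,[S(b-a,c-a,d)+S(e-a,f-a,g-a)]$. *)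

theory Defs
  imports "HOL-Analysis.Analysis"
begin

definition V :: "(complex ^ 7) set" where
  "V = {vector [a, b, c, d, e, f, g] | a b c d e f g. e + f + g - a - b - c - d = 1}"

(* The series at unit argument. It is only used with (sum of lower) - (sum of upper) = 1,
   where its terms are O(1/n^2), so that it converges absolutely. *)
definition F43 :: "complex \<Rightarrow> complex \<Rightarrow> complex \<Rightarrow> complex \<Rightarrow> complex \<Rightarrow> complex \<Rightarrow> complex \<Rightarrow> complex" where
  "F43 a b c d e f g =
     (\<Sum>n. (pochhammer a n * pochhammer b n * pochhammer c n * pochhammer d n) /
           (fact n * pochhammer e n * pochhammer f n * pochhammer g n))"

definition S :: "complex list \<Rightarrow> complex" where
  "S as = (\<Prod>a\<leftarrow>as. sin (of_real pi * a))"

(* Every factor 1/Gamma is rendered by the entire function rGamma, which is 0 at the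
   nonpositive integers. *)
definition A :: "complex \<Rightarrow> complex \<Rightarrow> complex \<Rightarrow> complex \<Rightarrow> complex" where
  "A x y z w = rGamma x * rGamma y * rGamma z * rGamma w"

(* Separators of the argument groups are lost by currying:
   K a b c d e f g is K(a; b,c,d; e,f,g) and L a b c d e f g is L(a,b,c,d; e; f,g). *)
definition K :: "complex \<Rightarrow> complex \<Rightarrow> complex \<Rightarrow> complex \<Rightarrow> complex \<Rightarrow> complex \<Rightarrow> complex \<Rightarrow> complex" where
  "K a b c d e f g =
     F43 a b c d e f g / sin (of_real pi * a) *
       (rGamma a * rGamma (1 + a - e) * rGamma (1 + a - f) * rGamma (1 + a - g) *
        rGamma e * rGamma f * rGamma g) +
     F43 a (1 + a - e) (1 + a - f) (1 + a - g) (1 + a - b) (1 + a - c) (1 + a - d) /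
       sin (of_real pi * a) *
       (rGamma a * rGamma b * rGamma c * rGamma d *
        rGamma (1 + a - b) * rGamma (1 + a - c) * rGamma (1 + a - d))"

definition L :: "complex \<Rightarrow> complex \<Rightarrow> complex \<Rightarrow> complex \<Rightarrow> complex \<Rightarrow> complex \<Rightarrow> complex \<Rightarrow> complex" where
  "L a b c d e f g =
     F43 a b c d e f g / sin (of_real pi * e) *
       (rGamma (1 + a - e) * rGamma (1 + b - e) * rGamma (1 + c - e) * rGamma (1 + d - e) *
        rGamma e * rGamma f * rGamma g) -
     F43 (1 + a - e) (1 + b - e) (1 + c - e) (1 + d - e) (2 - e) (1 + f - e) (1 + g - e) /
       sin (of_real pi * e) *
       (rGamma a * rGamma b * rGamma c * rGamma d *
        rGamma (2 - e) * rGamma (1 + f - e) * rGamma (1 + g - e))"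

definition K_defined :: "complex \<Rightarrow> complex \<Rightarrow> complex \<Rightarrow> complex \<Rightarrow> complex \<Rightarrow> complex \<Rightarrow> complex \<Rightarrow> bool" where
  "K_defined a b c d e f g \<longleftrightarrow>
     sin (of_real pi * a) \<noteq> 0 \<and>
     {e, f, g, 1 + a - b, 1 + a - c, 1 + a - d} \<inter> \<int>\<^sub>\<le>\<^sub>0 = {}"

definition L_defined :: "complex \<Rightarrow> complex \<Rightarrow> complex \<Rightarrow> complex \<Rightarrow> complex \<Rightarrow> complex \<Rightarrow> complex \<Rightarrow> bool" where
  "L_defined a b c d e f g \<longleftrightarrow>
     sin (of_real pi * e) \<noteq> 0 \<and>
     {e, f, g, 2 - e, 1 + f - e, 1 + g - e} \<inter> \<int>\<^sub>\<le>\<^sub>0 = {}"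

lemma vector_7:
  "(vector [a, b, c, d, e, f, g] :: 'a::zero ^ 7) $ 1 = a"
  "(vector [a, b, c, d, e, f, g] :: 'a::zero ^ 7) $ 2 = b"
  "(vector [a, b, c, d, e, f, g] :: 'a::zero ^ 7) $ 3 = c"
  "(vector [a, b, c, d, e, f, g] :: 'a::zero ^ 7) $ 4 = d"
  "(vector [a, b, c, d, e, f, g] :: 'a::zero ^ 7) $ 5 = e"
  "(vector [a, b, c, d, e, f, g] :: 'a::zero ^ 7) $ 6 = f"
  "(vector [a, b, c, d, e, f, g] :: 'a::zero ^ 7) $ 7 = g"
  unfolding vector_def by simp_all

(* The coordinates (a, b, c, d, e, f, g) of x are x $ 1, ..., x $ 7. *)
definition Kp0 :: "complex ^ 7 \<Rightarrow> complex" where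
  "Kp0 x = K (x $ 1) (x $ 2) (x $ 3) (x $ 4) (x $ 5) (x $ 6) (x $ 7)"

definition Kp0_defined :: "complex ^ 7 \<Rightarrow> bool" where
  "Kp0_defined x \<longleftrightarrow> K_defined (x $ 1) (x $ 2) (x $ 3) (x $ 4) (x $ 5) (x $ 6) (x $ 7)"

definition Kp1 :: "complex ^ 7 \<Rightarrow> complex" where
  "Kp1 x = K (x $ 2) (x $ 3) (x $ 4) (x $ 1) (x $ 5) (x $ 6) (x $ 7)"

definition Kp1_defined :: "complex ^ 7 \<Rightarrow> bool" where
  "Kp1_defined x \<longleftrightarrow> K_defined (x $ 2) (x $ 3) (x $ 4) (x $ 1) (x $ 5) (x $ 6) (x $ 7)"

definition L1bar :: "complex ^ 7 \<Rightarrow> complex" where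
  "L1bar x = (let a = x $ 1; b = x $ 2; c = x $ 3; d = x $ 4; e = x $ 5; f = x $ 6; g = x $ 7 in
     L (1 - a) (e - a) (f - a) (g - a) (1 + d - a) (1 + c - a) (1 + b - a))"

definition L1bar_defined :: "complex ^ 7 \<Rightarrow> bool" where
  "L1bar_defined x \<longleftrightarrow>
    (let a = x $ 1; b = x $ 2; c = x $ 3; d = x $ 4; e = x $ 5; f = x $ 6; g = x $ 7 in
     L_defined (1 - a) (e - a) (f - a) (g - a) (1 + d - a) (1 + c - a) (1 + b - a))"

definition B1 :: "complex ^ 7 \<Rightarrow> complex" where
  "B1 x = (let a = x $ 1; b = x $ 2; c = x $ 3; d = x $ 4; e = x $ 5; f = x $ 6; g = x $ 7 in
     S [b, c] * (S [b - a, c - a, d] + S [e - a, f - a, g - a]) / of_real pi ^ 4)"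

end

theory Submission
  imports Defs "HOL-Complex_Analysis.Complex_Analysis" "HOL-Real_Asymp.Real_Asymp"
begin

text \<open>
  Multiplied by the relevant values of \<open>1/\<Gamma>\<close>, the series become entire functions on \<open>V\<close>, so that the
  relation may be proved at generic points. It is assembled from two facts.

  First, put \<open>u t = rGamma (1 + t) rGamma (e + t) rGamma (f + t) rGamma (g + t) rGamma (1 - a - t)
  rGamma (1 - b - t) rGamma (1 - c - t) rGamma (1 - d - t)\<close>. The bilateral series \<open>\<Sum>k. u (z + k)\<close> is entire in
  \<open>z\<close>, has period 1, and is \<open>o(exp (4 \<pi> \<bar>Im z\<bar>))\<close>; hence it is a combination of \<open>exp (- 2 \<pi> i z)\<close>, \<open>1\<close> and
  \<open>exp (2 \<pi> i z)\<close>. At \<open>z = 0, - a, - b, - c\<close> it becomes unilateral and gives the four series of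
  \<open>K_p0\<close>, \<open>K_p1\<close> and one more, which therefore satisfy a linear relation.

  Secondly, \<open>L(a,b,c,d; e; f,g) = L(f-a,f-b,f-c,f-d; 1+f-g; f,1+f-e)\<close>, which rewrites the \<open>L\<close> function of the
  statement in these series. This is two applications of the swap
  \<open>(a,b,c,d; e; f,g) \<mapsto> (f-d,g-d,c,1+c-e; 1+c-d; 1+a+c-e,1+b+c-e)\<close>. For suitable real parameters, expanding
  \<open>\<Gamma>(c+t)\<Gamma>(d+t)/(\<Gamma>(f+t)\<Gamma>(g+t))\<close> by Gauss's theorem and summing over \<open>t\<close> by the nonterminating
  Saalschuetz theorem turns \<open>L\<close> into a positive double series that is visibly symmetric under the swap.
\<close>

section \<open>Gauss's theorem\<close>

text \<open>The three Fourier modes span a three-dimensional space, so any four values of the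
  bilateral series are dependent, with sines of differences as coefficients. The exponent
  \<open>4 * pi\<close> counts the four pairs \<open>rGamma x * rGamma (1 - x)\<close> in
  \<open>u\<close>; the little o, which excludes the modes of order 2, comes from the balance
  condition of \<open>V\<close>. The series belonging to \<open>z = - c\<close> occurs in neither
  \<open>K\<close> function. The rewritten \<open>L\<close> contains only the series of
  \<open>- b\<close> and \<open>- c\<close>, so it serves to eliminate the latter. Reflection then
  matches the other coefficients, and a sine identity turns the last one into \<open>B1\<close>. The
  price is a factor \<open>sin (pi * (c - b))\<close>, removed by continuity. The swap is an
  involution: it keeps \<open>c\<close> and exchanges \<open>(a, b)\<close> with
  \<open>(f - d, g - d)\<close>. Two applications give something new only because the upper
  parameters are regrouped in between. Positive real parameters are chosen for the double series
  since nonnegative terms may be summed in any order. One interior point of that region is enough: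
  complex lines lead from it to every real point of \<open>V\<close>, and from the real points to
  the complex ones.\<close>

lemma Gamma_real_nonzero: "x > 0 \<Longrightarrow> Gamma (x :: real) \<noteq> 0"
  using Gamma_real_pos[of x] by linarith

text \<open>Serves as a substitute for Stirling: in every quotient below the factors
  \<open>fact (n - 1)\<close> cancel and only a power of \<open>n\<close> remains.\<close>

lemma Gamma_shift_asymp:
  fixes x :: real
  assumes "x > 0"
  shows "(\<lambda>n. Gamma (x + real n) / (fact (n - 1) * real n powr x)) \<longlonglongrightarrow> 1"
proof -
  have np: "x \<notin> \<int>\<^sub>\<le>\<^sub>0" using assms by (auto elim!: nonpos_Ints_cases)
  have G0: "Gamma x \<noteq> 0" using assms Gamma_real_pos by (simp add: less_imp_neq[symmetric])
  have "(\<lambda>n. Gamma x / Gamma_series' x n) \<longlonglongrightarrow> Gamma x / Gamma x"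
    using G0 by (intro tendsto_intros Gamma_series'_LIMSEQ)
  then have "(\<lambda>n. Gamma x / Gamma_series' x n) \<longlonglongrightarrow> 1" using G0 by simp
  then show ?thesis
  proof (rule Lim_transform_eventually, intro eventually_sequentiallyI[of 1])
    fix n :: nat assume n: "n \<ge> 1"
    show "Gamma x / Gamma_series' x n = Gamma (x + real n) / (fact (n - 1) * real n powr x)"
      using n np G0 by (simp add: Gamma_series'_def pochhammer_Gamma powr_def field_simps)
  qed
qed

lemma gauss_term_asymp:
  fixes a b c :: real
  assumes "a > 0" "b > 0" "c > 0"
  shows "(\<lambda>n. Gamma (a + real n) * Gamma (b + real n) / (fact n * Gamma (c + real n))
              / real n powr (a + b - c - 1)) \<longlonglongrightarrow> 1"
proof -
  let ?g = "\<lambda>x n. Gamma (x + real n) / (fact (n - 1) * real n powr x)"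
  have "(\<lambda>n. ?g a n * ?g b n / (?g 1 n * ?g c n)) \<longlonglongrightarrow> 1 * 1 / (1 * 1)"
    using assms by (intro tendsto_intros Gamma_shift_asymp) auto
  then have "(\<lambda>n. ?g a n * ?g b n / (?g 1 n * ?g c n)) \<longlonglongrightarrow> 1" by simp
  then show ?thesis
  proof (rule Lim_transform_eventually, intro eventually_sequentiallyI[of 1])
    fix n :: nat assume n: "n \<ge> 1"
    have G: "Gamma (1 + real n) = fact n" by (simp add: Gamma_fact add.commute)
    have p: "real n powr (a + b - c - 1) * (real n powr 1 * real n powr c) = real n powr a * real n powr b"
      by (simp add: powr_add [symmetric] powr_mult_base)
    show "?g a n * ?g b n / (?g 1 n * ?g c n) = Gamma (a + real n) * Gamma (b + real n) / (fact n * Gamma (c + real n))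
              / real n powr (a + b - c - 1)"
    proof -
      have nz: "Gamma (c + real n) > 0" using assms by (intro Gamma_real_pos) auto
      have "?g a n * ?g b n / (?g 1 n * ?g c n) =
        Gamma (a + real n) * Gamma (b + real n) / (fact n * Gamma (c + real n)) *
         ((real n powr 1 * real n powr c) / (real n powr a * real n powr b))"
        using n nz unfolding G by (simp add: field_simps)
      also have "(real n powr 1 * real n powr c) / (real n powr a * real n powr b) = 1 / real n powr (a + b - c - 1)"
        unfolding p[symmetric] using n by (simp add: field_simps)
      finally show ?thesis by simp
    qed
  qed
qed

lemma summable_of_powr_asymp:
  fixes f :: "nat \<Rightarrow> real"
  assumes "(\<lambda>n. f n / real n powr s) \<longlonglongrightarrow> 1" "s < -1"
  shows "summable f"
proof -
  have "eventually (\<lambda>n. \<bar>f n / real n powr s\<bar> < 2) sequentially"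
    using tendsto_rabs[OF assms(1)] by (rule order_tendstoD) simp
  then have "eventually (\<lambda>n. norm (f n) \<le> 2 * real n powr s) sequentially"
    using eventually_gt_at_top[of 0]
    by eventually_elim (auto simp: field_simps abs_divide)
  then show ?thesis
    by (rule summable_comparison_test_ev) (use assms(2) in \<open>auto intro!: summable_mult simp: summable_real_powr_iff\<close>)
qed

text \<open>The terms of 2F1(a,b;c;1) times \<open>Gamma a * Gamma b / Gamma c\<close>. In this
  scaling the terms are positive and the recurrences in the parameters have polynomial
  coefficients.\<close>

definition gauss_term :: "real \<Rightarrow> real \<Rightarrow> real \<Rightarrow> nat \<Rightarrow> real" where
  "gauss_term a b c k = Gamma (a + real k) * Gamma (b + real k) / (fact k * Gamma (c + real k))"

lemma summable_gauss_term:
  assumes "a > 0" "b > 0" "c > a + b"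
  shows "summable (gauss_term a b c)"
  unfolding gauss_term_def
  by (rule summable_of_powr_asymp[OF gauss_term_asymp]) (use assms in auto)

lemma gauss_term_pos: "a > 0 \<Longrightarrow> b > 0 \<Longrightarrow> c > 0 \<Longrightarrow> gauss_term a b c k > 0"
  unfolding gauss_term_def by (intro divide_pos_pos mult_pos_pos Gamma_real_pos) auto

lemma Gamma_add_one: "x > 0 \<Longrightarrow> Gamma (x + 1) = x * Gamma (x :: real)"
  by (rule Gamma_plus1) (auto elim!: nonpos_Ints_cases)

lemma telescope_suminf:
  fixes f G :: "nat \<Rightarrow> 'a :: {real_normed_vector}"
  assumes "\<And>k. f k = G (Suc k) - G k" "G 0 = 0" "G \<longlonglongrightarrow> l"
  shows "f sums l"
proof -
  have "(\<lambda>k. G (Suc k) - G k) sums (l - G 0)" by (rule telescope_sums[OF assms(3)])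
  moreover have "f = (\<lambda>k. G (Suc k) - G k)" using assms(1) by blast
  ultimately show ?thesis using assms(2) by simp
qed

text \<open>A contiguous relation by telescoping: termwise, the difference of the two sides is
  \<open>G (Suc k) - G k\<close>, where \<open>G\<close> vanishes at 0 and decays like
  \<open>k powr (a + b - c)\<close>.\<close>

lemma gauss_sum_step:
  fixes a b c :: real
  assumes "a > 0" "b > 0" "c > a + b"
  shows "(c - a) * (c - b) * suminf (gauss_term a b (c + 1)) = (c - a - b) * suminf (gauss_term a b c)"
proof -
  define G where "G = (\<lambda>k. real k * gauss_term a b c k)"
  have lim: "G \<longlonglongrightarrow> 0"
  proof -
    have 1: "(\<lambda>n. gauss_term a b c n / real n powr (a + b - c - 1)) \<longlonglongrightarrow> 1"
      using gauss_term_asymp[of a b c] assms by (simp add: gauss_term_def)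
    have 2: "(\<lambda>n. real n powr (a + b - c)) \<longlonglongrightarrow> 0"
      by (rule tendsto_neg_powr) (use assms in \<open>auto intro: filterlim_real_sequentially\<close>)
    have "(\<lambda>n. gauss_term a b c n / real n powr (a + b - c - 1) * real n powr (a + b - c)) \<longlonglongrightarrow> 1 * 0"
      by (intro tendsto_mult 1 2)
    then have "(\<lambda>n. gauss_term a b c n / real n powr (a + b - c - 1) * real n powr (a + b - c)) \<longlonglongrightarrow> 0" by simp
    then show ?thesis
    proof (rule Lim_transform_eventually, intro eventually_sequentiallyI[of 1])
      fix n :: nat assume n: "n \<ge> 1"
      have "real n powr (a + b - c) = real n powr (a + b - c - 1) * real n"
        using powr_mult_base[of "real n" "a + b - c - 1"] by (simp add: mult.commute add_diff_eq)
      then show "gauss_term a b c n / real n powr (a + b - c - 1) * real n powr (a + b - c) = G n"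
        using n by (simp add: G_def)
    qed
  qed
  have step: "(c - a) * (c - b) * gauss_term a b (c + 1) k - (c - a - b) * gauss_term a b c k = G (Suc k) - G k" for k
  proof -
    have ak: "Gamma (a + real (Suc k)) = (a + k) * Gamma (a + k)"
      using Gamma_add_one[of "a + k"] assms by (simp add: algebra_simps)
    have bk: "Gamma (b + real (Suc k)) = (b + k) * Gamma (b + k)"
      using Gamma_add_one[of "b + k"] assms by (simp add: algebra_simps)
    have ck: "Gamma (c + real (Suc k)) = (c + k) * Gamma (c + k)" "Gamma (c + 1 + real k) = (c + k) * Gamma (c + k)"
      using Gamma_add_one[of "c + k"] assms by (simp_all add: algebra_simps)
    have nz: "Gamma (c + k) \<noteq> 0" "c + real k \<noteq> 0"
      using assms Gamma_real_nonzero[of "c + k"] by simp_all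
    \<comment> \<open>The term for \<open>c + 1\<close>; the other two quantities are polynomial
      multiples of it, so the telescoping identity becomes one between polynomials.\<close>
    define X where "X = Gamma (a + k) * Gamma (b + k) / (fact k * ((c + k) * Gamma (c + k)))"
    have e1: "gauss_term a b (c + 1) k = X" unfolding gauss_term_def ck X_def ..
    have e2: "gauss_term a b c k = (c + k) * X" unfolding gauss_term_def X_def using nz by simp
    have e3: "real (Suc k) * gauss_term a b c (Suc k) = (a + k) * (b + k) * X"
      unfolding gauss_term_def X_def ak bk ck fact_Suc using nz
      by (simp add: divide_simps del: of_nat_Suc)
    show ?thesis unfolding G_def e1 e2 e3 by (simp add: algebra_simps)
  qed
  have "(\<lambda>k. (c - a) * (c - b) * gauss_term a b (c + 1) k - (c - a - b) * gauss_term a b c k) sums 0"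
    by (rule telescope_suminf[OF step _ lim]) (simp add: G_def)
  moreover have "(\<lambda>k. (c - a) * (c - b) * gauss_term a b (c + 1) k - (c - a - b) * gauss_term a b c k) sums
     ((c - a) * (c - b) * suminf (gauss_term a b (c + 1)) - (c - a - b) * suminf (gauss_term a b c))"
    by (intro sums_diff sums_mult summable_sums summable_gauss_term) (use assms in auto)
  ultimately show ?thesis by (auto dest: sums_unique2)
qed

lemma Gamma_pair_asymp:
  fixes u v x y :: real
  assumes "u > 0" "v > 0" "x > 0" "y > 0" "u + v = x + y"
  shows "(\<lambda>n. Gamma (u + real n) * Gamma (v + real n) / (Gamma (x + real n) * Gamma (y + real n))) \<longlonglongrightarrow> 1"
proof -
  let ?g = "\<lambda>x n. Gamma (x + real n) / (fact (n - 1) * real n powr x)"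
  have "(\<lambda>n. ?g u n * ?g v n / (?g x n * ?g y n)) \<longlonglongrightarrow> 1 * 1 / (1 * 1)"
    using assms by (intro tendsto_intros Gamma_shift_asymp) auto
  then have "(\<lambda>n. ?g u n * ?g v n / (?g x n * ?g y n)) \<longlonglongrightarrow> 1" by simp
  then show ?thesis
  proof (rule Lim_transform_eventually, intro eventually_sequentiallyI[of 1])
    fix n :: nat assume n: "n \<ge> 1"
    have p: "real n powr u * real n powr v = real n powr x * real n powr y"
      by (simp add: powr_add [symmetric] assms)
    have "?g u n * ?g v n / (?g x n * ?g y n) = Gamma (u + real n) * Gamma (v + real n) / (Gamma (x + real n) * Gamma (y + real n))
        * ((real n powr x * real n powr y) / (real n powr u * real n powr v))"
      using n by (simp add: field_simps)
    also have "(real n powr x * real n powr y) / (real n powr u * real n powr v) = 1"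
      using n by (simp add: p)
    finally show "?g u n * ?g v n / (?g x n * ?g y n) = Gamma (u + real n) * Gamma (v + real n) / (Gamma (x + real n) * Gamma (y + real n))"
      by simp
  qed
qed

text \<open>The contiguous relation says that \<open>h\<close>, the quotient of the sum and its
  expected dependence on \<open>c\<close>, is unchanged under \<open>c \<rightarrow> c + 1\<close>.
  Hence \<open>h c\<close> equals the limit of \<open>h (c + n)\<close>, where only the first term
  of the series survives.\<close>

theorem gauss_sum:
  fixes a b c :: real
  assumes "a > 0" "b > 0" "c > a + b"
  shows "gauss_term a b c sums (Gamma a * Gamma b * Gamma (c - a - b) / (Gamma (c - a) * Gamma (c - b)))"
proof -
  define S where "S = (\<lambda>c. suminf (gauss_term a b c))"
  define h where "h = (\<lambda>c. S c * (Gamma (c - a) * Gamma (c - b) / Gamma (c - a - b)))"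
  have hstep: "h (x + 1) = h x" if "x > a + b" for x
  proof -
    have G: "Gamma (x + 1 - a) = (x - a) * Gamma (x - a)" "Gamma (x + 1 - b) = (x - b) * Gamma (x - b)"
        "Gamma (x + 1 - a - b) = (x - a - b) * Gamma (x - a - b)"
      using Gamma_add_one[of "x - a"] Gamma_add_one[of "x - b"] Gamma_add_one[of "x - a - b"] that assms
      by (auto simp: algebra_simps)
    have nz: "Gamma (x - a - b) \<noteq> 0" using Gamma_real_nonzero[of "x - a - b"] that by simp
    have "h (x + 1) = ((x - a) * (x - b) * S (x + 1)) / (x - a - b) * (Gamma (x - a) * Gamma (x - b) / Gamma (x - a - b))"
      unfolding h_def G using nz that by (simp add: field_simps)
    also have "(x - a) * (x - b) * S (x + 1) = (x - a - b) * S x"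
      unfolding S_def by (rule gauss_sum_step) (use assms that in auto)
    finally show ?thesis using that by (simp add: h_def)
  qed
  have hN: "h (c + real n) = h c" for n
  proof (induction n)
    case (Suc n)
    have "h (c + real (Suc n)) = h ((c + real n) + 1)" by (simp add: algebra_simps)
    also have "\<dots> = h (c + real n)" by (rule hstep) (use assms in auto)
    finally show ?case using Suc by simp
  qed simp
  have limS: "(\<lambda>n. S (c + real n) * Gamma (c + real n)) \<longlonglongrightarrow> Gamma a * Gamma b"
  proof -
    \<comment> \<open>Tannery's theorem: for \<open>k > 0\<close> the rising factorial of
      \<open>c + n\<close> in the denominator grows without bound, and the terms with
      \<open>n = 0\<close> dominate.\<close>
    define t where "t = (\<lambda>k (n::nat). gauss_term a b (c + real n) k * Gamma (c + real n))"
    have t_eq: "t k n = Gamma (a + real k) * Gamma (b + real k) / fact k / pochhammer (c + real n) k" for k n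
    proof -
      have "pochhammer (c + real n) k = Gamma (c + real n + real k) / Gamma (c + real n)"
        by (rule pochhammer_Gamma) (use assms in \<open>auto elim!: nonpos_Ints_cases\<close>)
      moreover have "Gamma (c + real n) > 0" "Gamma (c + real n + real k) > 0" using assms by (auto intro!: Gamma_real_pos)
      ultimately have "Gamma (c + real n + real k) = pochhammer (c + real n) k * Gamma (c + real n)"
        by (simp add: field_simps)
      then show ?thesis using \<open>Gamma (c + real n) > 0\<close> by (simp add: t_def gauss_term_def)
    qed
    have lim0: "(\<lambda>n. t k n) \<longlonglongrightarrow> (if k = 0 then Gamma a * Gamma b else 0)" for k
    proof (cases k)
      case 0 then show ?thesis by (simp add: t_eq)
    next
      case (Suc j)
      have "filterlim (\<lambda>n. pochhammer (c + real n) k) at_top sequentially"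
      proof (rule filterlim_at_top_mono)
        show "filterlim (\<lambda>n. (c + real n) * pochhammer c j) at_top sequentially"
        proof (rule filterlim_at_top_mult_tendsto_pos[OF tendsto_const])
          show "0 < pochhammer c j" using assms by (intro pochhammer_pos) auto
          show "filterlim (\<lambda>n. c + real n) at_top sequentially"
            by (rule filterlim_tendsto_add_at_top[OF tendsto_const filterlim_real_sequentially])
        qed
        show "\<forall>\<^sub>F n in sequentially. (c + real n) * pochhammer c j \<le> pochhammer (c + real n) k"
        proof (intro always_eventually allI)
          fix n :: nat
          have "pochhammer c j \<le> pochhammer (c + real n + 1) j"
            unfolding pochhammer_prod using assms by (intro prod_mono) auto
          then show "(c + real n) * pochhammer c j \<le> pochhammer (c + real n) k"
            unfolding Suc pochhammer_rec using assms by (intro mult_left_mono) auto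
        qed
      qed
      then have "(\<lambda>n. Gamma (a + real k) * Gamma (b + real k) / fact k / pochhammer (c + real n) k) \<longlonglongrightarrow> 0"
        by (rule real_tendsto_divide_at_top[OF tendsto_const])
      then show ?thesis using Suc by (simp add: t_eq)
    qed
    have bnd: "norm (t k n) \<le> t k 0" for k n
    proof -
      have pos: "0 < pochhammer (c + real n) k" "0 < pochhammer c k" using assms by (auto intro!: pochhammer_pos)
      have "pochhammer c k \<le> pochhammer (c + real n) k"
        unfolding pochhammer_prod using assms by (intro prod_mono) auto
      moreover have "Gamma (a + real k) * Gamma (b + real k) / fact k \<ge> 0"
        using assms by (intro divide_nonneg_nonneg mult_nonneg_nonneg less_imp_le[OF Gamma_real_pos]) auto
      ultimately have "t k n \<le> t k 0" unfolding t_eq using pos by (intro divide_left_mono) auto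
      moreover have "0 \<le> t k n" unfolding t_eq
        by (rule divide_nonneg_pos[OF \<open>Gamma (a + real k) * Gamma (b + real k) / fact k \<ge> 0\<close> pos(1)])
      ultimately show ?thesis by simp
    qed
    have "(\<lambda>n. \<Sum>k. t k n) \<longlonglongrightarrow> (\<Sum>k. if k = 0 then Gamma a * Gamma b else 0)"
    proof (rule tannerys_theorem[THEN conjunct2, THEN conjunct2])
      show "(\<lambda>n. t k n) \<longlonglongrightarrow> (if k = 0 then Gamma a * Gamma b else 0)" for k by (rule lim0)
      show "\<forall>\<^sub>F (k, n) in at_top \<times>\<^sub>F sequentially. norm (t k n) \<le> t k 0"
        using bnd by (intro always_eventually) auto
      show "summable (\<lambda>k. t k 0)" unfolding t_def by (intro summable_mult2 summable_gauss_term) (use assms in auto)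
    qed simp
    moreover have "(\<Sum>k. t k n) = S (c + real n) * Gamma (c + real n)" for n
      unfolding t_def S_def
      by (subst suminf_mult2) (use assms in \<open>auto intro!: summable_gauss_term\<close>)
    moreover have "(\<Sum>k::nat. if k = 0 then Gamma a * Gamma b else 0) = Gamma a * Gamma b"
      by (rule sums_unique[symmetric], rule sums_single)
    ultimately show ?thesis by simp
  qed
  \<comment> \<open>The Gamma quotient tends to 1 because its arguments are balanced:
    \<open>(c - a) + (c - b) = (c - a - b) + c\<close>.\<close>
  have "(\<lambda>n. (S (c + real n) * Gamma (c + real n)) *
     (Gamma (c - a + real n) * Gamma (c - b + real n) / (Gamma (c - a - b + real n) * Gamma (c + real n)))) \<longlonglongrightarrow> Gamma a * Gamma b * 1"
    by (intro tendsto_mult limS Gamma_pair_asymp) (use assms in auto)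
  moreover have "(S (c + real n) * Gamma (c + real n)) *
     (Gamma (c - a + real n) * Gamma (c - b + real n) / (Gamma (c - a - b + real n) * Gamma (c + real n))) = h c" for n
  proof -
    have "Gamma (c + real n) > 0" using assms by (auto intro!: Gamma_real_pos)
    then have "(S (c + real n) * Gamma (c + real n)) *
     (Gamma (c - a + real n) * Gamma (c - b + real n) / (Gamma (c - a - b + real n) * Gamma (c + real n))) = h (c + real n)"
      unfolding h_def by (simp add: algebra_simps)
    then show ?thesis using hN by simp
  qed
  ultimately have "h c = Gamma a * Gamma b" by (simp add: LIMSEQ_const_iff)
  moreover have "Gamma (c - a) \<noteq> 0" "Gamma (c - b) \<noteq> 0" "Gamma (c - a - b) \<noteq> 0"
    using assms by (auto intro!: Gamma_real_nonzero)
  ultimately have "S c = Gamma a * Gamma b * Gamma (c - a - b) / (Gamma (c - a) * Gamma (c - b))"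
    unfolding h_def by (simp add: divide_simps)
  moreover have "gauss_term a b c sums S c"
    unfolding S_def by (intro summable_sums summable_gauss_term) (use assms in auto)
  ultimately show ?thesis by simp
qed

section \<open>The nonterminating Saalschuetz theorem\<close>

text \<open>The terms of 3F2(a,b,c;e,c+q;1), scaled by Gamma values. Writing the second lower
  parameter as \<open>c + q\<close> lets \<open>c\<close> be shifted without changing the decay of
  the terms. The balanced (Saalschuetzian) case is \<open>q = 1 + a + b - e\<close>; later
  \<open>q\<close> is raised by integers.\<close>

definition saalschuetz_term :: "real \<Rightarrow> real \<Rightarrow> real \<Rightarrow> real \<Rightarrow> real \<Rightarrow> nat \<Rightarrow> real" where
  "saalschuetz_term a b e q c k =
     Gamma (a + real k) * Gamma (b + real k) * Gamma (c + real k) /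
       (fact k * Gamma (e + real k) * Gamma (c + q + real k))"

lemma saalschuetz_term_asymp:
  fixes a b c e q :: real
  assumes "a > 0" "b > 0" "c > 0" "e > 0" "q > 0"
  shows "(\<lambda>n. saalschuetz_term a b e q c n / real n powr (a + b - e - q - 1)) \<longlonglongrightarrow> 1"
proof -
  let ?s = "a + b - e - q - 1"
  let ?G = "\<lambda>n. (Gamma (a + real n) * Gamma (b + real n) / (fact n * Gamma (e + real n))
              / real n powr (a + b - e - 1))"
  let ?g = "\<lambda>x n. Gamma (x + real n) / (fact (n - 1) * real n powr x)"
  have "(\<lambda>n. ?G n * (?g c n / ?g (c + q) n)) \<longlonglongrightarrow> 1 * (1 / 1)"
    using assms by (intro tendsto_intros Gamma_shift_asymp gauss_term_asymp) auto
  then have "(\<lambda>n. ?G n * (?g c n / ?g (c + q) n)) \<longlonglongrightarrow> 1" by simp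
  then show ?thesis
  proof (rule Lim_transform_eventually, intro eventually_sequentiallyI[of 1])
    fix n :: nat assume n: "n \<ge> 1"
    have nz: "Gamma (e + real n) \<noteq> 0" "Gamma (c + q + real n) \<noteq> 0"
      using assms by (auto intro!: Gamma_real_nonzero)
    have "real n powr ?s * real n powr (c + q) = real n powr (a + b - e - 1) * real n powr c"
      unfolding powr_add [symmetric] by (simp add: algebra_simps)
    then have p: "real n powr ?s = real n powr (a + b - e - 1) * real n powr c / real n powr (c + q)"
      using n by (simp add: field_simps)
    show "?G n * (?g c n / ?g (c + q) n) = saalschuetz_term a b e q c n / real n powr ?s"
      unfolding p saalschuetz_term_def using n nz by (simp add: field_simps)
  qed
qed

lemma summable_saalschuetz_term:
  assumes "a > 0" "b > 0" "c > 0" "e > 0" "q > 0" "a + b < e + q"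
  shows "summable (saalschuetz_term a b e q c)"
  by (rule summable_of_powr_asymp[OF saalschuetz_term_asymp]) (use assms in auto)

text \<open>Telescoping again, but now the boundary term does not vanish: the terms behave like
  \<open>k powr (- 2)\<close> and \<open>G\<close> multiplies them by a quadratic polynomial, whence
  the 1. This inhomogeneity is why a closed form needs a second series.\<close>

lemma saalschuetz_step:
  fixes a b c e q :: real
  assumes pos: "a > 0" "b > 0" "c > 0" "e > 0" "q > 0" and q: "q = 1 + a + b - e"
  shows "(c + q - a) * (c + q - b) * suminf (saalschuetz_term a b e q (c + 1))
         - c * (1 + c - e) * suminf (saalschuetz_term a b e q c) = 1"
proof -
  let ?T = "saalschuetz_term a b e q"
  define G where "G = (\<lambda>k. real k * (real k + e - 1) * ?T c k)"
  have lim: "G \<longlonglongrightarrow> 1"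
  proof -
    have "(\<lambda>n. ?T c n / real n powr (a + b - e - q - 1)) \<longlonglongrightarrow> 1"
      by (rule saalschuetz_term_asymp) (use pos in auto)
    moreover have "a + b - e - q - 1 = - 2" using q by simp
    ultimately have 1: "(\<lambda>n. ?T c n / real n powr (- 2)) \<longlonglongrightarrow> 1" by simp
    have 2: "(\<lambda>n. 1 + (e - 1) / real n) \<longlonglongrightarrow> 1 + 0"
      by (rule tendsto_add[OF tendsto_const real_tendsto_divide_at_top[OF tendsto_const filterlim_real_sequentially]])
    have "(\<lambda>n. ?T c n / real n powr (- 2) * (1 + (e - 1) / real n)) \<longlonglongrightarrow> 1 * (1 + 0)"
      by (rule tendsto_mult[OF 1 2])
    then have "(\<lambda>n. ?T c n / real n powr (- 2) * (1 + (e - 1) / real n)) \<longlonglongrightarrow> 1" by simp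
    then show ?thesis
    proof (rule Lim_transform_eventually, intro eventually_sequentiallyI[of 1])
      fix n :: nat assume n: "n \<ge> 1"
      then have p: "real n powr (-2) = 1 / (real n * real n)"
        by (simp add: powr_minus powr_numeral power2_eq_square field_simps)
      then show "?T c n / real n powr (- 2) * (1 + (e - 1) / real n) = G n"
        unfolding p G_def using n by (simp add: field_simps)
    qed
  qed
  have step: "(c + q - a) * (c + q - b) * ?T (c + 1) k - c * (1 + c - e) * ?T c k = G (Suc k) - G k" for k
  proof -
    have ak: "Gamma (x + real (Suc k)) = (x + k) * Gamma (x + k)"
        "Gamma (x + 1 + real k) = (x + k) * Gamma (x + k)" if "x > 0" for x
      using Gamma_add_one[of "x + k"] that by (simp_all add: algebra_simps)
    have nz: "Gamma (c + q + k) \<noteq> 0" "Gamma (e + k) \<noteq> 0" "c + q + real k \<noteq> 0" "e + real k \<noteq> 0"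
      using pos by (auto intro!: Gamma_real_nonzero)
    define X where "X = Gamma (a + k) * Gamma (b + k) * Gamma (c + k) /
         (fact k * Gamma (e + k) * ((c + q + k) * Gamma (c + q + k)))"
    have cq: "c + 1 + q + real k = (c + q) + 1 + real k" by simp
    have e1: "?T (c + 1) k = (c + k) * X"
      unfolding saalschuetz_term_def cq X_def using pos by (simp add: ak)
    have e2: "?T c k = (c + q + k) * X" unfolding saalschuetz_term_def X_def using nz by simp
    have e3: "real (Suc k) * (real (Suc k) + e - 1) * ?T c (Suc k) = (a + k) * (b + k) * (c + k) * X"
    proof -
      have "?T c (Suc k) = ((a + k) * (b + k) * (c + k) * X) / (real (Suc k) * (e + k))"
        unfolding saalschuetz_term_def X_def fact_Suc using pos nz
        by (simp add: ak divide_simps del: of_nat_Suc)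
      moreover have "real (Suc k) * (real (Suc k) + e - 1) = real (Suc k) * (e + k)" by simp
      moreover have "real (Suc k) * (e + k) \<noteq> 0" using nz by simp
      ultimately show ?thesis by (metis times_divide_eq_right nonzero_mult_div_cancel_left)
    qed
    have e: "e = 1 + a + b - q" using q by simp
    show ?thesis unfolding G_def e3 e1 e2 unfolding e by (simp add: algebra_simps)
  qed
  have sm: "summable (?T c)" "summable (?T (c + 1))"
    using pos q by (auto intro!: summable_saalschuetz_term)
  have "(\<lambda>k. (c + q - a) * (c + q - b) * ?T (c + 1) k - c * (1 + c - e) * ?T c k) sums 1"
    by (rule telescope_suminf[OF step _ lim]) (simp add: G_def)
  moreover have "(\<lambda>k. (c + q - a) * (c + q - b) * ?T (c + 1) k - c * (1 + c - e) * ?T c k) sums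
     ((c + q - a) * (c + q - b) * suminf (?T (c + 1)) - c * (1 + c - e) * suminf (?T c))"
    by (intro sums_diff sums_mult summable_sums sm)
  ultimately show ?thesis by (auto dest: sums_unique2)
qed

text \<open>For large \<open>c\<close> the 3F2 degenerates to a 2F1: after normalisation the factors
  containing \<open>c\<close> form the quotient \<open>r\<close> of two rising factorials, which
  lies between 0 and 1 and tends to 1, so the Gauss terms dominate.\<close>

lemma saalschuetz_limit:
  fixes a b c e q :: real
  assumes pos: "a > 0" "b > 0" "c > 0" "e > 0" "q > 0" and q: "e > a + b"
  shows "(\<lambda>n. suminf (saalschuetz_term a b e q (c + real n)) * (Gamma (c + q + real n) / Gamma (c + real n)))
           \<longlonglongrightarrow> suminf (gauss_term a b e)"
proof -
  define t where "t = (\<lambda>k (n::nat). saalschuetz_term a b e q (c + real n) k * (Gamma (c + q + real n) / Gamma (c + real n)))"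
  define r where "r = (\<lambda>k (n::nat). Gamma (c + real k + real n) * Gamma (c + q + real n) / (Gamma (c + real n) * Gamma (c + q + real k + real n)))"
  have t_eq: "t k n = gauss_term a b e k * r k n" for k n
    by (simp add: t_def r_def saalschuetz_term_def gauss_term_def algebra_simps)
  have lim0: "(\<lambda>n. t k n) \<longlonglongrightarrow> gauss_term a b e k" for k
  proof -
    have "(\<lambda>n. gauss_term a b e k * r k n) \<longlonglongrightarrow> gauss_term a b e k * 1"
      unfolding r_def by (intro tendsto_mult tendsto_const Gamma_pair_asymp) (use pos in auto)
    then show ?thesis by (simp add: t_eq)
  qed
  have r01: "0 \<le> r k n \<and> r k n \<le> 1" for k n
  proof -
    have p: "pochhammer x k = Gamma (x + real k) / Gamma x" if "x > 0" for x :: real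
      by (rule pochhammer_Gamma) (use that in \<open>auto elim!: nonpos_Ints_cases\<close>)
    have G: "Gamma (c + real n) > 0" "Gamma (c + q + real n) > 0" "Gamma (c + q + real k + real n) > 0"
      using pos by (auto intro!: Gamma_real_pos)
    have "r k n = pochhammer (c + real n) k / pochhammer (c + q + real n) k"
      using pos G by (simp add: p r_def field_simps)
    moreover have "pochhammer (c + real n) k \<le> pochhammer (c + q + real n) k"
      unfolding pochhammer_prod using pos by (intro prod_mono) auto
    moreover have "pochhammer (c + real n) k > 0" "pochhammer (c + q + real n) k > 0"
      using pos by (auto intro!: pochhammer_pos)
    ultimately show ?thesis by simp
  qed
  have bnd: "norm (t k n) \<le> gauss_term a b e k" for k n
  proof -
    have g: "gauss_term a b e k > 0" using pos by (intro gauss_term_pos)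
    have "norm (t k n) = gauss_term a b e k * r k n"
      using r01[of k n] g by (simp add: t_eq abs_mult)
    also have "\<dots> \<le> gauss_term a b e k * 1" using r01[of k n] g by (intro mult_left_mono) auto
    finally show ?thesis by simp
  qed
  have "(\<lambda>n. \<Sum>k. t k n) \<longlonglongrightarrow> suminf (gauss_term a b e)"
  proof (rule tannerys_theorem[THEN conjunct2, THEN conjunct2])
    show "(\<lambda>n. t k n) \<longlonglongrightarrow> gauss_term a b e k" for k by (rule lim0)
    show "\<forall>\<^sub>F (k, n) in at_top \<times>\<^sub>F sequentially. norm (t k n) \<le> gauss_term a b e k"
      using bnd by (intro always_eventually) auto
    show "summable (gauss_term a b e)" by (intro summable_gauss_term) (use pos q in auto)
  qed simp
  moreover have "(\<Sum>k. t k n) = suminf (saalschuetz_term a b e q (c + real n)) * (Gamma (c + q + real n) / Gamma (c + real n))" for n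
    unfolding t_def
    by (subst suminf_mult2) (use pos q in \<open>auto intro!: summable_saalschuetz_term\<close>)
  ultimately show ?thesis by simp
qed

lemma Gamma_reflection_real_inverse:
  fixes x :: real
  assumes "1 - x > 0"
  shows "1 / Gamma x = sin (pi * x) / pi * Gamma (1 - x)"
proof -
  have "complex_of_real (rGamma x * rGamma (1 - x)) = complex_of_real (sin (pi * x) / pi)"
    using rGamma_reflection_complex[of "of_real x"]
    by (simp flip: rGamma_complex_of_real sin_of_real)
  then have "rGamma x * rGamma (1 - x) = sin (pi * x) / pi" by (simp only: of_real_eq_iff)
  moreover have "Gamma (1 - x) \<noteq> 0" using assms by (rule Gamma_real_nonzero)
  moreover have "1 / Gamma x = (rGamma x * rGamma (1 - x)) * Gamma (1 - x)"
    using \<open>Gamma (1 - x) \<noteq> 0\<close> by (simp add: rGamma_inverse_Gamma divide_inverse)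
  ultimately show ?thesis by simp
qed

text \<open>The value at \<open>c = \<infinity>\<close> of the two-series combination in
  \<open>saalschuetz_pair\<close>. Reflection gives both Gauss sums the same Gamma factors, and the
  difference of the remaining sine products factorises.\<close>

lemma gauss_pair:
  fixes a b e q :: real
  assumes "a > 0" "b > 0" "1 + a - e > 0" "1 + b - e > 0" "q < 1" "q > 0" and q: "q = 1 + a + b - e"
  shows "suminf (gauss_term a b e) - suminf (gauss_term (1 + a - e) (1 + b - e) (2 - e)) =
    sin (pi * e) / pi * (Gamma a * Gamma b * Gamma (1 + a - e) * Gamma (1 + b - e)) / Gamma q"
proof -
  let ?P = "Gamma a * Gamma b * Gamma (1 + a - e) * Gamma (1 + b - e)"
  have "suminf (gauss_term a b e) = Gamma a * Gamma b * Gamma (e - a - b) * (1 / Gamma (e - a)) * (1 / Gamma (e - b))"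
    using gauss_sum[of a b e] assms by (simp add: sums_iff)
  also have "\<dots> = Gamma (e - a - b) * ?P / (pi * pi) * (sin (pi * (e - a)) * sin (pi * (e - b)))"
    using assms by (subst (1 2) Gamma_reflection_real_inverse) (auto simp: algebra_simps)
  finally have 1: "suminf (gauss_term a b e) = \<dots>" .
  have "suminf (gauss_term (1 + a - e) (1 + b - e) (2 - e)) =
      Gamma (1 + a - e) * Gamma (1 + b - e) * Gamma (e - a - b) * (1 / Gamma (1 - a)) * (1 / Gamma (1 - b))"
  proof -
    have "2 - e - (1 + a - e) = 1 - a" "2 - e - (1 + b - e) = 1 - b"
       "1 - a - (1 + b - e) = e - a - b" by simp_all
    note eqs = this
    have "gauss_term (1 + a - e) (1 + b - e) (2 - e) sums
        (Gamma (1 + a - e) * Gamma (1 + b - e) * Gamma (e - a - b) / (Gamma (1 - a) * Gamma (1 - b)))"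
      using gauss_sum[of "1 + a - e" "1 + b - e" "2 - e"] assms unfolding eqs by simp
    then show ?thesis by (simp add: sums_iff)
  qed
  also have "\<dots> = Gamma (e - a - b) * ?P / (pi * pi) * (sin (pi * a) * sin (pi * b))"
    using assms by (subst (1 2) Gamma_reflection_real_inverse) (auto simp: algebra_simps sin_diff)
  finally have 2: "suminf (gauss_term (1 + a - e) (1 + b - e) (2 - e)) = \<dots>" .
  have trig: "sin (pi * (e - a)) * sin (pi * (e - b)) - sin (pi * a) * sin (pi * b) = sin (pi * e) * sin (pi * (e - a - b))"
  proof -
    have *: "sin (x - y) * sin (x - z) - sin y * sin z = sin x * sin (x - y - z)" for x y z :: real
      using sin_cos_squared_add[of x] sin_cos_squared_add[of y] sin_cos_squared_add[of z]
      unfolding sin_diff cos_diff by algebra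
    show ?thesis using *[of "pi * e" "pi * a" "pi * b"] by (simp add: algebra_simps)
  qed
  have "1 - (e - a - b) > 0" using assms by simp
  then have G: "1 / Gamma (e - a - b) = sin (pi * (e - a - b)) / pi * Gamma q"
    by (subst Gamma_reflection_real_inverse) (simp_all add: q algebra_simps)
  have nz: "Gamma q \<noteq> 0" "Gamma (e - a - b) \<noteq> 0" using assms by (auto intro!: Gamma_real_nonzero)
  have G': "Gamma (e - a - b) * sin (pi * (e - a - b)) = pi / Gamma q"
    using G nz by (simp add: field_simps)
  have "suminf (gauss_term a b e) - suminf (gauss_term (1 + a - e) (1 + b - e) (2 - e)) =
     Gamma (e - a - b) * ?P / (pi * pi) * (sin (pi * (e - a)) * sin (pi * (e - b)) - sin (pi * a) * sin (pi * b))"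
    unfolding 1 2 by (simp only: right_diff_distrib)
  also have "\<dots> = ?P / (pi * pi) * sin (pi * e) * (Gamma (e - a - b) * sin (pi * (e - a - b)))"
    unfolding trig by (simp add: algebra_simps)
  also have "\<dots> = sin (pi * e) / pi * ?P / Gamma q" unfolding G' by (simp add: field_simps)
  finally show ?thesis .
qed

text \<open>Both series satisfy the same inhomogeneous recurrence in \<open>c\<close>, with the same
  right side 1, so their difference \<open>P\<close> satisfies the homogeneous one. As for Gauss,
  \<open>h\<close> is then invariant under \<open>c \<rightarrow> c + 1\<close> and is evaluated in
  the limit, by \<open>gauss_pair\<close>.\<close>

theorem saalschuetz_pair:
  fixes a b c e q :: real
  assumes pos: "a > 0" "b > 0" "c > 0" "e > 0" "1 + a - e > 0" "1 + b - e > 0" "1 + c - e > 0" "2 - e > 0"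
    and q1: "q > 0" "q < 1" and q: "q = 1 + a + b - e"
  shows "suminf (saalschuetz_term a b e q c) - suminf (saalschuetz_term (1 + a - e) (1 + b - e) (2 - e) q (1 + c - e)) =
    sin (pi * e) / pi * (Gamma a * Gamma b * Gamma (1 + a - e) * Gamma (1 + b - e)) / Gamma q *
     (Gamma c * Gamma (1 + c - e) / (Gamma (c + q - a) * Gamma (c + q - b)))"
proof -
  define P where "P = (\<lambda>c. suminf (saalschuetz_term a b e q c) - suminf (saalschuetz_term (1 + a - e) (1 + b - e) (2 - e) q (1 + c - e)))"
  define h where "h = (\<lambda>c. P c * (Gamma (c + q - a) * Gamma (c + q - b) / (Gamma c * Gamma (1 + c - e))))"
  define l where "l = sin (pi * e) / pi * (Gamma a * Gamma b * Gamma (1 + a - e) * Gamma (1 + b - e)) / Gamma q"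
  have Pstep: "(c + q - a) * (c + q - b) * P (c + 1) = c * (1 + c - e) * P c" if "c > 0" "1 + c - e > 0" for c
  proof -
    have 1: "(c + q - a) * (c + q - b) * suminf (saalschuetz_term a b e q (c + 1))
         - c * (1 + c - e) * suminf (saalschuetz_term a b e q c) = 1"
      by (rule saalschuetz_step) (use pos q1 q that in auto)
    have 2: "((1 + c - e) + q - (1 + a - e)) * ((1 + c - e) + q - (1 + b - e)) *
             suminf (saalschuetz_term (1 + a - e) (1 + b - e) (2 - e) q ((1 + c - e) + 1))
         - (1 + c - e) * (1 + (1 + c - e) - (2 - e)) * suminf (saalschuetz_term (1 + a - e) (1 + b - e) (2 - e) q (1 + c - e)) = 1"
      by (rule saalschuetz_step) (use pos q1 q that in auto)
    have e: "(1 + c - e) + q - (1 + a - e) = c + q - a" "(1 + c - e) + q - (1 + b - e) = c + q - b"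
      "1 + (1 + c - e) - (2 - e) = c" "(1 + c - e) + 1 = 1 + (c + 1) - e" by simp_all
    show ?thesis using 1 2 unfolding e P_def by (simp add: algebra_simps)
  qed
  have qa: "q - a = 1 + b - e" "q - b = 1 + a - e" using q by simp_all
  have cq: "c + q - a > 0" "c + q - b > 0" if "c > 0" for c
    using that pos qa by linarith+
  have hstep: "h (x + 1) = h x" if "x > 0" "1 + x - e > 0" for x
  proof -
    have G: "Gamma (x + 1 + q - a) = (x + q - a) * Gamma (x + q - a)" "Gamma (x + 1 + q - b) = (x + q - b) * Gamma (x + q - b)"
        "Gamma (x + 1) = x * Gamma x" "Gamma (1 + (x + 1) - e) = (1 + x - e) * Gamma (1 + x - e)"
      using Gamma_add_one[of "x + q - a"] Gamma_add_one[of "x + q - b"] Gamma_add_one[of "x"] Gamma_add_one[of "1 + x - e"] that cq[of x]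
      by (simp_all add: algebra_simps)
    have nz: "Gamma x \<noteq> 0" "Gamma (1 + x - e) \<noteq> 0" using that by (auto intro!: Gamma_real_nonzero)
    have "h (x + 1) = ((x + q - a) * (x + q - b) * P (x + 1)) / (x * (1 + x - e)) *
        (Gamma (x + q - a) * Gamma (x + q - b) / (Gamma x * Gamma (1 + x - e)))"
      unfolding h_def G using nz that by (simp add: divide_simps)
    also have "\<dots> = h x" using Pstep[OF that] that by (simp add: h_def)
    finally show ?thesis .
  qed
  have hN: "h (c + real n) = h c" for n
  proof (induction n)
    case (Suc n)
    have "h (c + real (Suc n)) = h ((c + real n) + 1)" by (simp add: algebra_simps)
    also have "\<dots> = h (c + real n)" by (rule hstep) (use pos in auto)
    finally show ?case using Suc by simp
  qed simp
  have limP: "(\<lambda>n. P (c + real n) * (Gamma (c + q + real n) / Gamma (c + real n))) \<longlonglongrightarrow> l"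
  proof -
    have 1: "(\<lambda>n. suminf (saalschuetz_term a b e q (c + real n)) * (Gamma (c + q + real n) / Gamma (c + real n)))
           \<longlonglongrightarrow> suminf (gauss_term a b e)"
      by (rule saalschuetz_limit) (use pos q1 q in auto)
    have 2: "(\<lambda>n. suminf (saalschuetz_term (1 + a - e) (1 + b - e) (2 - e) q (1 + c - e + real n)) * (Gamma (1 + c - e + q + real n) / Gamma (1 + c - e + real n)))
           \<longlonglongrightarrow> suminf (gauss_term (1 + a - e) (1 + b - e) (2 - e))"
      by (rule saalschuetz_limit) (use pos q1 q in auto)
    \<comment> \<open>The second series was normalised by its own parameter
      \<open>1 + c - e\<close>; this factor converts to the normalisation of the first.\<close>
    have 3: "(\<lambda>n. Gamma (c + q + real n) * Gamma (1 + c - e + real n) / (Gamma (c + real n) * Gamma (1 + c - e + q + real n))) \<longlonglongrightarrow> 1"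
      by (rule Gamma_pair_asymp) (use pos q1 in auto)
    have 4: "(\<lambda>n. suminf (saalschuetz_term a b e q (c + real n)) * (Gamma (c + q + real n) / Gamma (c + real n)) -
        (suminf (saalschuetz_term (1 + a - e) (1 + b - e) (2 - e) q (1 + c - e + real n)) * (Gamma (1 + c - e + q + real n) / Gamma (1 + c - e + real n)))
         * (Gamma (c + q + real n) * Gamma (1 + c - e + real n) / (Gamma (c + real n) * Gamma (1 + c - e + q + real n))))
       \<longlonglongrightarrow> suminf (gauss_term a b e) - suminf (gauss_term (1 + a - e) (1 + b - e) (2 - e)) * 1"
      by (intro tendsto_diff tendsto_mult 1 2 3)
    have 5: "suminf (gauss_term a b e) - suminf (gauss_term (1 + a - e) (1 + b - e) (2 - e)) * 1 = l"
      using gauss_pair[of a b e q] pos q1 q by (simp add: l_def)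
    have 6: "suminf (saalschuetz_term a b e q (c + real n)) * (Gamma (c + q + real n) / Gamma (c + real n)) -
        (suminf (saalschuetz_term (1 + a - e) (1 + b - e) (2 - e) q (1 + c - e + real n)) * (Gamma (1 + c - e + q + real n) / Gamma (1 + c - e + real n)))
         * (Gamma (c + q + real n) * Gamma (1 + c - e + real n) / (Gamma (c + real n) * Gamma (1 + c - e + q + real n)))
        = P (c + real n) * (Gamma (c + q + real n) / Gamma (c + real n))" for n
    proof -
      have "Gamma (1 + c - e + real n) \<noteq> 0" "Gamma (1 + c - e + q + real n) \<noteq> 0"
        using pos q1 by (auto intro!: Gamma_real_nonzero)
      moreover have "1 + (c + real n) - e = 1 + c - e + real n" by simp
      then have "P (c + real n) = suminf (saalschuetz_term a b e q (c + real n))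
          - suminf (saalschuetz_term (1 + a - e) (1 + b - e) (2 - e) q (1 + c - e + real n))"
        unfolding P_def by (simp only:)
      ultimately show ?thesis by (simp add: left_diff_distrib diff_divide_distrib)
    qed
    show ?thesis using 4 unfolding 5 6 .
  qed
  have "(\<lambda>n. (P (c + real n) * (Gamma (c + q + real n) / Gamma (c + real n))) *
     (Gamma (c + q - a + real n) * Gamma (c + q - b + real n) / (Gamma (c + q + real n) * Gamma (1 + c - e + real n)))) \<longlonglongrightarrow> l * 1"
    by (intro tendsto_mult limP Gamma_pair_asymp) (use pos q1 q cq[of c] in auto)
  moreover have "(P (c + real n) * (Gamma (c + q + real n) / Gamma (c + real n))) *
     (Gamma (c + q - a + real n) * Gamma (c + q - b + real n) / (Gamma (c + q + real n) * Gamma (1 + c - e + real n))) = h c" for n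
  proof -
    have "Gamma (c + q + real n) \<noteq> 0" using pos q1 by (auto intro!: Gamma_real_nonzero)
    then have "(P (c + real n) * (Gamma (c + q + real n) / Gamma (c + real n))) *
     (Gamma (c + q - a + real n) * Gamma (c + q - b + real n) / (Gamma (c + q + real n) * Gamma (1 + c - e + real n))) = h (c + real n)"
      unfolding h_def by (simp add: algebra_simps)
    then show ?thesis using hN by simp
  qed
  ultimately have "h c = l" by (simp add: LIMSEQ_const_iff)
  have nz0: "Gamma c \<noteq> 0" "Gamma (1 + c - e) \<noteq> 0" "Gamma (c + q - a) \<noteq> 0" "Gamma (c + q - b) \<noteq> 0"
    using pos cq[of c] by (auto intro!: Gamma_real_nonzero)
  from \<open>h c = l\<close> have "P c = l * (Gamma c * Gamma (1 + c - e) / (Gamma (c + q - a) * Gamma (c + q - b)))"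
    unfolding h_def using nz0 by (simp add: divide_simps)
  then show ?thesis by (simp add: P_def l_def)
qed

section \<open>The swap for real parameters\<close>

text \<open>Tonelli: for nonnegative terms both iterated sums agree with the unordered sum over
  pairs.\<close>

lemma sums_swap_nonneg:
  fixes F :: "nat \<Rightarrow> nat \<Rightarrow> real"
  assumes nonneg: "\<And>k n. F k n \<ge> 0" and rows: "\<And>k. F k sums r k" and R: "r sums R"
    and cols: "\<And>n. (\<lambda>k. F k n) sums c n"
  shows "c sums R"
proof -
  have pos: "r k \<ge> 0" "c k \<ge> 0" for k
    using sums_le[OF _ sums_zero rows[of k]] sums_le[OF _ sums_zero cols[of k]] nonneg by auto
  have rows': "(F k has_sum r k) UNIV" for k
    using rows nonneg by (intro sums_nonneg_imp_has_sum) auto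
  have cols': "((\<lambda>k. F k n) has_sum c n) UNIV" for n
    using cols nonneg by (intro sums_nonneg_imp_has_sum) auto
  have R': "(r has_sum R) UNIV" using R pos by (intro sums_nonneg_imp_has_sum) auto
  have sm: "(\<lambda>(k, n). F k n) summable_on (SIGMA k:UNIV. UNIV)"
    by (rule summable_on_SigmaI[where g = r]) (use rows' has_sum_imp_summable[OF R'] nonneg in auto)
  have 1: "((\<lambda>(k, n). F k n) has_sum R) (UNIV \<times> UNIV)"
    by (rule has_sum_SigmaI[OF _ R' sm]) (use rows' in auto)
  have 2: "((\<lambda>(n, k). F k n) has_sum R) (UNIV \<times> UNIV)"
    using 1 by (subst (asm) has_sum_swap) simp
  have "(c has_sum R) UNIV"
    by (rule has_sum_SigmaD[OF 2]) (use cols' in auto)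
  then show ?thesis by (rule has_sum_imp_sums)
qed

text \<open>In \<open>m\<close>, up to a constant, the terms of 3F2(a,b,q+n;q,c+q+n;1). The second
  factor is symmetric in \<open>m\<close> and \<open>n\<close>; this symmetry becomes the
  swap.\<close>

definition ladder_term :: "real \<Rightarrow> real \<Rightarrow> real \<Rightarrow> real \<Rightarrow> nat \<Rightarrow> nat \<Rightarrow> real" where
  "ladder_term a b q c n m =
     Gamma (a + real m) * Gamma (b + real m) / fact m *
       (Gamma c * Gamma (q + real m + real n) /
          (Gamma (q + real m) * Gamma (q + real n) * Gamma (c + q + real m + real n)))"

lemma ladder_term_pos:
  assumes "a > 0" "b > 0" "c > 0" "q > 0"
  shows "ladder_term a b q c n m > 0"
  unfolding ladder_term_def
  by (intro mult_pos_pos divide_pos_pos Gamma_real_pos) (use assms in auto)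

lemma summable_ladder_term:
  assumes "a > 0" "b > 0" "c > 0" "q > 0" "c + q > a + b"
  shows "summable (ladder_term a b q c n)"
proof (rule summable_comparison_test')
  show "summable (\<lambda>m. Gamma c / Gamma (q + real n) * gauss_term a b (c + q) m)"
    by (intro summable_mult summable_gauss_term) (use assms in auto)
  fix m :: nat
  have p: "Gamma (x + real n) = pochhammer x n * Gamma x" if "x > 0" for x :: real
  proof -
    have "x \<notin> \<int>\<^sub>\<le>\<^sub>0" using that by (auto elim!: nonpos_Ints_cases)
    then show ?thesis using pochhammer_Gamma[of x n] Gamma_real_nonzero[OF that] by simp
  qed
  have le: "pochhammer (q + real m) n \<le> pochhammer (c + q + real m) n"
    unfolding pochhammer_prod using assms by (intro prod_mono) auto
  have pp: "pochhammer (q + real m) n > 0" "pochhammer (c + q + real m) n > 0"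
    using assms by (auto intro!: pochhammer_pos)
  have nz: "Gamma (q + real m) > 0" "Gamma (c + q + real m) > 0" using assms by (auto intro!: Gamma_real_pos)
  have g: "Gamma c / Gamma (q + real n) * gauss_term a b (c + q) m \<ge> 0"
    using assms by (intro mult_nonneg_nonneg divide_nonneg_nonneg less_imp_le[OF gauss_term_pos] less_imp_le[OF Gamma_real_pos]) auto
  have "ladder_term a b q c n m = Gamma c / Gamma (q + real n) * gauss_term a b (c + q) m *
     (pochhammer (q + real m) n / pochhammer (c + q + real m) n)"
  proof -
    have s: "Gamma (q + real m + real n) = pochhammer (q + real m) n * Gamma (q + real m)"
      "Gamma (c + q + real m + real n) = pochhammer (c + q + real m) n * Gamma (c + q + real m)"
      using assms by (auto intro!: p)
    show ?thesis unfolding ladder_term_def gauss_term_def s using nz by (simp add: mult_ac)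
  qed
  also have "\<dots> \<le> Gamma c / Gamma (q + real n) * gauss_term a b (c + q) m * 1"
    using le pp g by (intro mult_left_mono) auto
  finally show "norm (ladder_term a b q c n m) \<le> Gamma c / Gamma (q + real n) * gauss_term a b (c + q) m"
    using ladder_term_pos[of a b c q n m] assms by simp
qed

text \<open>Holds termwise, from \<open>q + m + n = (c + q + m + n) - c\<close>. It has the same
  shape as \<open>saalschuetz_ladder_step\<close> with \<open>Q = q + n\<close>, so the two sides of
  \<open>saalschuetz_pair_ladder\<close> obey one recurrence.\<close>

lemma ladder_step:
  assumes "a > 0" "b > 0" "c > 0" "q > 0" "c + q > a + b"
  shows "(q + real n) * suminf (ladder_term a b q c (Suc n)) =
     suminf (ladder_term a b q c n) - suminf (ladder_term a b q (c + 1) n)"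
proof -
  have "(q + real n) * ladder_term a b q c (Suc n) m = ladder_term a b q c n m - ladder_term a b q (c + 1) n m" for m
  proof -
    have G: "Gamma (x + real (Suc n)) = (x + n) * Gamma (x + n)" if "x > 0" for x
      using Gamma_add_one[of "x + n"] that by (simp add: algebra_simps)
    have c: "Gamma (c + 1) = c * Gamma c" "Gamma (c + 1 + q + real m + real n) = (c + q + m + n) * Gamma (c + q + m + n)"
      using Gamma_add_one[of c] Gamma_add_one[of "c + q + m + n"] assms by (auto simp: algebra_simps)
    have nz: "Gamma (c + q + m + n) \<noteq> 0" "c + q + m + n \<noteq> 0" "Gamma (q + n) \<noteq> 0" "q + n \<noteq> 0" "Gamma (q + m) \<noteq> 0"
      using assms by (auto intro!: Gamma_real_nonzero)
    define X where "X = Gamma (a + real m) * Gamma (b + real m) / fact m * (Gamma c * Gamma (q + real m + real n) /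
          (Gamma (q + real m) * Gamma (q + real n) * ((c + q + m + n) * Gamma (c + q + real m + real n))))"
    have "(q + real n) * ladder_term a b q c (Suc n) m = (q + m + n) * X"
    proof -
      have s: "Gamma (q + real m + real (Suc n)) = (q + m + n) * Gamma (q + m + n)"
        "Gamma (q + real (Suc n)) = (q + n) * Gamma (q + n)"
        "Gamma (c + q + real m + real (Suc n)) = (c + q + m + n) * Gamma (c + q + m + n)"
        using assms by (auto simp: G simp del: of_nat_Suc)
      show ?thesis unfolding ladder_term_def X_def s using nz by (simp add: divide_simps)
    qed
    moreover have "ladder_term a b q c n m = (c + q + m + n) * X"
      unfolding ladder_term_def X_def using nz by simp
    moreover have "ladder_term a b q (c + 1) n m = c * X"
      unfolding ladder_term_def X_def c by simp
    ultimately show ?thesis by (simp add: algebra_simps)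
  qed
  then have "(\<lambda>m. (q + real n) * ladder_term a b q c (Suc n) m) = (\<lambda>m. ladder_term a b q c n m - ladder_term a b q (c + 1) n m)"
    by blast
  then show ?thesis
    using suminf_diff[of "ladder_term a b q c n" "ladder_term a b q (c + 1) n"]
      suminf_mult[of "ladder_term a b q c (Suc n)" "q + real n"] assms by (simp add: summable_ladder_term)
qed

text \<open>Holds termwise, from \<open>Q = (c + Q + k) - (c + k)\<close>.\<close>

lemma saalschuetz_ladder_step:
  assumes "a > 0" "b > 0" "c > 0" "e > 0" "Q > 0" "e + Q > a + b"
  shows "Q * suminf (saalschuetz_term a b e (Q + 1) c) =
     suminf (saalschuetz_term a b e Q c) - suminf (saalschuetz_term a b e Q (c + 1))"
proof -
  have "Q * saalschuetz_term a b e (Q + 1) c k = saalschuetz_term a b e Q c k - saalschuetz_term a b e Q (c + 1) k" for k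
  proof -
    have c: "Gamma (c + 1 + k) = (c + k) * Gamma (c + k)" "Gamma (c + 1 + Q + k) = (c + Q + k) * Gamma (c + Q + k)"
      "Gamma (c + (Q + 1) + k) = (c + Q + k) * Gamma (c + Q + k)"
      using Gamma_add_one[of "c + k"] Gamma_add_one[of "c + Q + k"] assms by (auto simp: algebra_simps)
    have nz: "c + Q + k \<noteq> 0" using assms by auto
    define X where "X = Gamma (a + real k) * Gamma (b + real k) * Gamma (c + real k) /
       (fact k * Gamma (e + real k) * ((c + Q + k) * Gamma (c + Q + real k)))"
    have "saalschuetz_term a b e (Q + 1) c k = X" unfolding saalschuetz_term_def X_def c ..
    moreover have "saalschuetz_term a b e Q c k = (c + Q + k) * X" unfolding saalschuetz_term_def X_def using nz by simp
    moreover have "saalschuetz_term a b e Q (c + 1) k = (c + k) * X" unfolding saalschuetz_term_def X_def c using nz by simp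
    ultimately show ?thesis by (simp add: algebra_simps)
  qed
  then have "(\<lambda>k. Q * saalschuetz_term a b e (Q + 1) c k) = (\<lambda>k. saalschuetz_term a b e Q c k - saalschuetz_term a b e Q (c + 1) k)"
    by blast
  then show ?thesis
    using suminf_diff[of "saalschuetz_term a b e Q c" "saalschuetz_term a b e Q (c + 1)"]
      suminf_mult[of "saalschuetz_term a b e (Q + 1) c" "Q"] assms by (simp add: summable_saalschuetz_term)
qed

text \<open>Away from the balanced case the pair has no product formula, but it is still a single
  positive series. Induction on \<open>n\<close> by the two ladder steps; \<open>c\<close> is
  arbitrary because the step from \<open>n\<close> uses both \<open>c\<close> and
  \<open>c + 1\<close>.\<close>

lemma saalschuetz_pair_ladder:
  fixes a b c e q :: real
  assumes pos: "a > 0" "b > 0" "c > 0" "e > 0" "1 + a - e > 0" "1 + b - e > 0" "1 + c - e > 0" "2 - e > 0"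
    and q1: "q > 0" "q < 1" and q: "q = 1 + a + b - e"
  shows "suminf (saalschuetz_term a b e (q + real n) c) - suminf (saalschuetz_term (1 + a - e) (1 + b - e) (2 - e) (q + real n) (1 + c - e)) =
    sin (pi * e) / pi * (Gamma (1 + a - e) * Gamma (1 + b - e)) * suminf (ladder_term a b q c n)"
  using pos(3,7)
proof (induction n arbitrary: c)
  case (0 c)
  have nz: "Gamma q \<noteq> 0" using q1 by (intro Gamma_real_nonzero)
  \<comment> \<open>For \<open>n = 0\<close> the factors \<open>Gamma (q + m)\<close> cancel and the
    ladder series is a Gauss series, whose value is the product in
    \<open>saalschuetz_pair\<close>.\<close>
  have "ladder_term a b q c 0 = (\<lambda>m. Gamma c / Gamma q * gauss_term a b (c + q) m)"
  proof
    fix m :: nat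
    have "Gamma (q + real m) \<noteq> 0" using q1 by (intro Gamma_real_nonzero) auto
    then show "ladder_term a b q c 0 m = Gamma c / Gamma q * gauss_term a b (c + q) m"
      by (simp add: ladder_term_def gauss_term_def mult_ac)
  qed
  moreover have "gauss_term a b (c + q) sums (Gamma a * Gamma b * Gamma (1 + c - e) / (Gamma (c + q - a) * Gamma (c + q - b)))"
  proof -
    have "c + q - a - b = 1 + c - e" using q by simp
    moreover have "gauss_term a b (c + q) sums
        (Gamma a * Gamma b * Gamma (c + q - a - b) / (Gamma (c + q - a) * Gamma (c + q - b)))"
      by (rule gauss_sum) (use pos 0 q in auto)
    ultimately show ?thesis by (simp only:)
  qed
  ultimately have "ladder_term a b q c 0 sums (Gamma c / Gamma q * (Gamma a * Gamma b * Gamma (1 + c - e) / (Gamma (c + q - a) * Gamma (c + q - b))))"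
    by (simp only: sums_mult)
  then have "suminf (ladder_term a b q c 0) = Gamma c / Gamma q * (Gamma a * Gamma b * Gamma (1 + c - e) / (Gamma (c + q - a) * Gamma (c + q - b)))"
    by (rule sums_unique[symmetric])
  then show ?case using saalschuetz_pair[of a b c e q] pos 0 q1 q by (simp add: mult_ac)
next
  case (Suc n c)
  let ?Q = "q + real n"
  have Q: "q + real (Suc n) = ?Q + 1" by simp
  have 1: "?Q * suminf (saalschuetz_term a b e (?Q + 1) c) =
     suminf (saalschuetz_term a b e ?Q c) - suminf (saalschuetz_term a b e ?Q (c + 1))"
    by (rule saalschuetz_ladder_step) (use pos Suc.prems q q1 in auto)
  have 2: "?Q * suminf (saalschuetz_term (1 + a - e) (1 + b - e) (2 - e) (?Q + 1) (1 + c - e)) =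
     suminf (saalschuetz_term (1 + a - e) (1 + b - e) (2 - e) ?Q (1 + c - e)) - suminf (saalschuetz_term (1 + a - e) (1 + b - e) (2 - e) ?Q (1 + c - e + 1))"
    by (rule saalschuetz_ladder_step) (use pos Suc.prems q q1 in auto)
  have 3: "?Q * suminf (ladder_term a b q c (Suc n)) =
     suminf (ladder_term a b q c n) - suminf (ladder_term a b q (c + 1) n)"
    by (rule ladder_step) (use pos Suc.prems q q1 in auto)
  have c1: "1 + (c + 1) - e = 1 + c - e + 1" by simp
  have I1: "suminf (saalschuetz_term a b e ?Q c) - suminf (saalschuetz_term (1 + a - e) (1 + b - e) (2 - e) ?Q (1 + c - e)) =
    sin (pi * e) / pi * (Gamma (1 + a - e) * Gamma (1 + b - e)) * suminf (ladder_term a b q c n)"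
    by (rule Suc.IH) (use Suc.prems in auto)
  have I2: "suminf (saalschuetz_term a b e ?Q (c + 1)) - suminf (saalschuetz_term (1 + a - e) (1 + b - e) (2 - e) ?Q (1 + (c + 1) - e)) =
    sin (pi * e) / pi * (Gamma (1 + a - e) * Gamma (1 + b - e)) * suminf (ladder_term a b q (c + 1) n)"
    by (rule Suc.IH) (use Suc.prems in auto)
  have "?Q * (suminf (saalschuetz_term a b e (?Q + 1) c) - suminf (saalschuetz_term (1 + a - e) (1 + b - e) (2 - e) (?Q + 1) (1 + c - e)))
     = sin (pi * e) / pi * (Gamma (1 + a - e) * Gamma (1 + b - e)) * (?Q * suminf (ladder_term a b q c (Suc n)))"
    unfolding right_diff_distrib 1 2 3 using I1 I2 unfolding c1 by (simp add: right_diff_distrib)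
  then have "?Q * (suminf (saalschuetz_term a b e (?Q + 1) c) - suminf (saalschuetz_term (1 + a - e) (1 + b - e) (2 - e) (?Q + 1) (1 + c - e)))
     = ?Q * (sin (pi * e) / pi * (Gamma (1 + a - e) * Gamma (1 + b - e)) * suminf (ladder_term a b q c (Suc n)))"
    by (simp only: mult_ac)
  moreover have "?Q \<noteq> 0" using q1 by simp
  ultimately show ?case unfolding Q by (simp only: mult_cancel_left simp_thms)
qed

section \<open>The double series behind 4F3, and the swap\<close>

definition F43_term :: "real \<Rightarrow> real \<Rightarrow> real \<Rightarrow> real \<Rightarrow> real \<Rightarrow> real \<Rightarrow> real \<Rightarrow> nat \<Rightarrow> real" where
  "F43_term a b c d e f g k = Gamma (a + real k) * Gamma (b + real k) * Gamma (c + real k) * Gamma (d + real k) /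
      (fact k * Gamma (e + real k) * Gamma (f + real k) * Gamma (g + real k))"

text \<open>Gauss's theorem with upper parameters \<open>f - d\<close>, \<open>g - d\<close> and
  lower parameter \<open>c + q + k\<close> writes
  \<open>Gamma (d + k) / (Gamma (f + k) * Gamma (g + k))\<close> as a series over \<open>n\<close>.
  Summing over \<open>k\<close> first leaves 3F2 series with \<open>q + n\<close>, balanced at
  \<open>n = 0\<close>. The two formulas for \<open>q\<close> agree by the balance condition of
  \<open>V\<close>.\<close>

lemma F43_term_expand:
  fixes a b c d e f g q :: real
  assumes pos: "a > 0" "b > 0" "c > 0" "d > 0" "e > 0" "q > 0" "f - d > 0" "g - d > 0"
    and q: "q = 1 + a + b - e" "q = f + g - c - d"
  shows "summable (F43_term a b c d e f g)"
    and "(\<lambda>n. Gamma (f - d + real n) * Gamma (g - d + real n) / fact n * suminf (saalschuetz_term a b e (q + real n) c)) sums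
      (Gamma (f - d) * Gamma (g - d) * suminf (F43_term a b c d e f g))"
proof -
  let ?ka = "\<lambda>n. Gamma (f - d + real n) * Gamma (g - d + real n) / fact n"
  let ?F = "\<lambda>k n. ?ka n * saalschuetz_term a b e (q + real n) c k"
  have fg: "f > 0" "g > 0" using pos by linarith+
  show smF: "summable (F43_term a b c d e f g)"
  proof -
    \<comment> \<open>The terms are products of two Gauss terms and one Gamma quotient; the balance
      condition makes the exponents add up to -2.\<close>
    have "(\<lambda>n. gauss_term a b e n / real n powr (a + b - e - 1) * (gauss_term c d f n / real n powr (c + d - f - 1)) *
         (Gamma (1 + real n) / (fact (n - 1) * real n powr 1) / (Gamma (g + real n) / (fact (n - 1) * real n powr g))))
         \<longlonglongrightarrow> 1 * 1 * (1 / 1)"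
      unfolding gauss_term_def using pos fg
      by (intro tendsto_mult tendsto_divide gauss_term_asymp Gamma_shift_asymp) auto
    then have "(\<lambda>n. gauss_term a b e n / real n powr (a + b - e - 1) * (gauss_term c d f n / real n powr (c + d - f - 1)) *
         (Gamma (1 + real n) / (fact (n - 1) * real n powr 1) / (Gamma (g + real n) / (fact (n - 1) * real n powr g))))
         \<longlonglongrightarrow> 1" by simp
    then have "(\<lambda>n. F43_term a b c d e f g n / real n powr (-2)) \<longlonglongrightarrow> 1"
    proof (rule Lim_transform_eventually, intro eventually_sequentiallyI[of 1])
      fix n :: nat assume n: "n \<ge> 1"
      have G: "Gamma (1 + real n) = fact n" by (simp add: Gamma_fact add.commute)
      have "real n powr (a + b - e - 1) * real n powr (c + d - f - 1) * real n powr 1 = real n powr (- 2) * real n powr g"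
        unfolding powr_add [symmetric] using q by (intro arg_cong2[of _ _ _ _ "(powr)"]) auto
      then have p: "real n powr (-2) = real n powr (a + b - e - 1) * real n powr (c + d - f - 1) * real n powr 1 / real n powr g"
        using n by (simp add: field_simps)
      have nz: "Gamma (e + n) \<noteq> 0" "Gamma (f + n) \<noteq> 0" "Gamma (g + n) \<noteq> 0" using pos fg by (auto intro!: Gamma_real_nonzero)
      show "gauss_term a b e n / real n powr (a + b - e - 1) * (gauss_term c d f n / real n powr (c + d - f - 1)) *
         (Gamma (1 + real n) / (fact (n - 1) * real n powr 1) / (Gamma (g + real n) / (fact (n - 1) * real n powr g)))
         = F43_term a b c d e f g n / real n powr (-2)"
        unfolding p gauss_term_def F43_term_def G using n nz by (simp add: field_simps)
    qed
    then show ?thesis by (rule summable_of_powr_asymp) simp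
  qed
  show "(\<lambda>n. ?ka n * suminf (saalschuetz_term a b e (q + real n) c)) sums
      (Gamma (f - d) * Gamma (g - d) * suminf (F43_term a b c d e f g))"
  proof (rule sums_swap_nonneg[where F = ?F])
    show "0 \<le> ?F k n" for k n
      unfolding saalschuetz_term_def using pos
      by (intro mult_nonneg_nonneg divide_nonneg_nonneg less_imp_le[OF Gamma_real_pos]) auto
    show "(\<lambda>k. ?F k n) sums (?ka n * suminf (saalschuetz_term a b e (q + real n) c))" for n
      by (intro sums_mult summable_sums summable_saalschuetz_term) (use pos q in auto)
    show "(\<lambda>k. Gamma (f - d) * Gamma (g - d) * F43_term a b c d e f g k) sums (Gamma (f - d) * Gamma (g - d) * suminf (F43_term a b c d e f g))"
      by (intro sums_mult summable_sums smF)
    show "?F k sums (Gamma (f - d) * Gamma (g - d) * F43_term a b c d e f g k)" for k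
    proof -
      let ?C = "c + q + real k"
      let ?x = "Gamma (a + real k) * Gamma (b + real k) * Gamma (c + real k) / (fact k * Gamma (e + real k))"
      have "gauss_term (f - d) (g - d) ?C sums
         (Gamma (f - d) * Gamma (g - d) * Gamma (?C - (f - d) - (g - d)) / (Gamma (?C - (f - d)) * Gamma (?C - (g - d))))"
        by (rule gauss_sum) (use pos q in auto)
      moreover have "?C - (f - d) = g + k" "?C - (g - d) = f + k" using q by auto
      moreover have "g + k - (g - d) = d + k" by simp
      ultimately have "gauss_term (f - d) (g - d) ?C sums
         (Gamma (f - d) * Gamma (g - d) * Gamma (d + k) / (Gamma (g + k) * Gamma (f + k)))" by simp
      then have "(\<lambda>n. ?x * gauss_term (f - d) (g - d) ?C n) sums
         (?x * (Gamma (f - d) * Gamma (g - d) * Gamma (d + k) / (Gamma (g + k) * Gamma (f + k))))"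
        by (rule sums_mult)
      moreover have "?x * gauss_term (f - d) (g - d) ?C n = ?F k n" for n
      proof -
        have "c + (q + real n) + real k = ?C + real n" by simp
        then show ?thesis unfolding gauss_term_def saalschuetz_term_def by (simp only:) (simp add: field_simps)
      qed
      moreover have "?x * (Gamma (f - d) * Gamma (g - d) * Gamma (d + k) / (Gamma (g + k) * Gamma (f + k))) = Gamma (f - d) * Gamma (g - d) * F43_term a b c d e f g k"
        unfolding F43_term_def by (simp add: field_simps)
      ultimately show ?thesis by simp
    qed
  qed
qed

text \<open>The kernel shared by both ladder series is symmetric in its two indices, and the weights
  of \<open>(a, b)\<close> and \<open>(u, v)\<close> have the same form, so interchanging the sums
  interchanges these pairs.\<close>

lemma ladder_symmetric:
  fixes a b c q u v :: real
  assumes pos: "a > 0" "b > 0" "c > 0" "q > 0" "u > 0" "v > 0" "c + q > a + b" "c + q > u + v"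
    and L: "(\<lambda>n. Gamma (u + real n) * Gamma (v + real n) / fact n * suminf (ladder_term a b q c n)) sums l"
  shows "(\<lambda>m. Gamma (a + real m) * Gamma (b + real m) / fact m * suminf (ladder_term u v q c m)) sums l"
proof (rule sums_swap_nonneg[OF _ _ L])
  let ?F = "\<lambda>n m. Gamma (u + real n) * Gamma (v + real n) / fact n * ladder_term a b q c n m"
  show "?F n sums (Gamma (u + real n) * Gamma (v + real n) / fact n * suminf (ladder_term a b q c n))" for n
    by (intro sums_mult summable_sums summable_ladder_term) (use pos in auto)
  show "?F n m \<ge> 0" for n m
    using pos by (intro mult_nonneg_nonneg divide_nonneg_nonneg less_imp_le[OF Gamma_real_pos] less_imp_le[OF ladder_term_pos]) auto
  have "?F n m = Gamma (a + real m) * Gamma (b + real m) / fact m * ladder_term u v q c m n" for n m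
    unfolding ladder_term_def by (simp add: ac_simps)
  then show "(\<lambda>n. ?F n m) sums (Gamma (a + real m) * Gamma (b + real m) / fact m * suminf (ladder_term u v q c m))" for m
    using pos by (simp only:) (intro sums_mult summable_sums summable_ladder_term, auto)
qed

text \<open>At positive parameters this is \<open>L\<close> multiplied by
  \<open>sin (pi * e)\<close> and by the Gamma values of all eight upper parameters of its two
  series.\<close>

definition F43_pair :: "real \<Rightarrow> real \<Rightarrow> real \<Rightarrow> real \<Rightarrow> real \<Rightarrow> real \<Rightarrow> real \<Rightarrow> real" where
  "F43_pair a b c d e f g = suminf (F43_term a b c d e f g) -
     suminf (F43_term (1 + a - e) (1 + b - e) (1 + c - e) (1 + d - e) (2 - e) (1 + f - e) (1 + g - e))"

text \<open>Both series of the pair have the same \<open>f - d\<close>, \<open>g - d\<close> and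
  \<open>q\<close>. Their expansions therefore carry the same weights and may be subtracted under
  the sum over \<open>n\<close>.\<close>

lemma F43_pair_ladder:
  fixes a b c d e f g q :: real
  assumes pos: "a > 0" "b > 0" "c > 0" "d > 0" "e > 0" "2 - e > 0" "q > 0" "q < 1" "f - d > 0" "g - d > 0"
    "1 + a - e > 0" "1 + b - e > 0" "1 + c - e > 0" "1 + d - e > 0"
    and q: "q = 1 + a + b - e" "q = f + g - c - d"
  shows "(\<lambda>n. sin (pi * e) / pi * (Gamma (1 + a - e) * Gamma (1 + b - e)) *
            (Gamma (f - d + real n) * Gamma (g - d + real n) / fact n * suminf (ladder_term a b q c n))) sums
      (Gamma (f - d) * Gamma (g - d) * F43_pair a b c d e f g)"
proof -
  have 1: "(\<lambda>n. Gamma (f - d + real n) * Gamma (g - d + real n) / fact n * suminf (saalschuetz_term a b e (q + real n) c)) sums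
      (Gamma (f - d) * Gamma (g - d) * suminf (F43_term a b c d e f g))"
    by (rule F43_term_expand) (use pos q in auto)
  have fd: "(1 + f - e) - (1 + d - e) = f - d" "(1 + g - e) - (1 + d - e) = g - d" by simp_all
  have "(\<lambda>n. Gamma ((1 + f - e) - (1 + d - e) + real n) * Gamma ((1 + g - e) - (1 + d - e) + real n) / fact n *
       suminf (saalschuetz_term (1 + a - e) (1 + b - e) (2 - e) (q + real n) (1 + c - e))) sums
      (Gamma ((1 + f - e) - (1 + d - e)) * Gamma ((1 + g - e) - (1 + d - e)) *
        suminf (F43_term (1 + a - e) (1 + b - e) (1 + c - e) (1 + d - e) (2 - e) (1 + f - e) (1 + g - e)))"
    by (rule F43_term_expand) (use pos q in auto)
  then have 2: "(\<lambda>n. Gamma (f - d + real n) * Gamma (g - d + real n) / fact n *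
       suminf (saalschuetz_term (1 + a - e) (1 + b - e) (2 - e) (q + real n) (1 + c - e))) sums
      (Gamma (f - d) * Gamma (g - d) *
        suminf (F43_term (1 + a - e) (1 + b - e) (1 + c - e) (1 + d - e) (2 - e) (1 + f - e) (1 + g - e)))"
    unfolding fd .
  have 3: "Gamma (f - d + real n) * Gamma (g - d + real n) / fact n * suminf (saalschuetz_term a b e (q + real n) c) -
      Gamma (f - d + real n) * Gamma (g - d + real n) / fact n *
       suminf (saalschuetz_term (1 + a - e) (1 + b - e) (2 - e) (q + real n) (1 + c - e)) =
      sin (pi * e) / pi * (Gamma (1 + a - e) * Gamma (1 + b - e)) *
            (Gamma (f - d + real n) * Gamma (g - d + real n) / fact n * suminf (ladder_term a b q c n))" for n
  proof -
    have "suminf (saalschuetz_term a b e (q + real n) c) - suminf (saalschuetz_term (1 + a - e) (1 + b - e) (2 - e) (q + real n) (1 + c - e)) =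
      sin (pi * e) / pi * (Gamma (1 + a - e) * Gamma (1 + b - e)) * suminf (ladder_term a b q c n)"
      by (rule saalschuetz_pair_ladder) (use pos q in auto)
    then show ?thesis unfolding right_diff_distrib [symmetric] by (simp only: mult_ac)
  qed
  show ?thesis using sums_diff[OF 1 2] unfolding 3 F43_pair_def right_diff_distrib .
qed

text \<open>The swap leaves \<open>c\<close> and \<open>q = 1 + a + b - e\<close> unchanged and
  exchanges \<open>(a, b)\<close> with \<open>(f - d, g - d)\<close>, so both pairs are explicit
  multiples of one symmetric double series.\<close>

lemma F43_pair_swap:
  fixes a b c d e f g :: real
  assumes pos: "a > 0" "b > 0" "c > 0" "d > 0" "e > 0" "2 - e > 0" "1 + a + b - e > 0" "1 + a + b - e < 1"
    "f - d > 0" "g - d > 0" "f - c > 0" "g - c > 0" "1 + a - e > 0" "1 + b - e > 0" "1 + c - e > 0" "1 + d - e > 0"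
    "1 + c - d > 0" "1 - c + d > 0"
    and S: "e + f + g - a - b - c - d = 1" and se: "sin (pi * e) \<noteq> 0"
  shows "sin (pi * (1 + c - d)) * Gamma (f - c) * Gamma (g - c) * (Gamma (f - d) * Gamma (g - d) * F43_pair a b c d e f g) =
     sin (pi * e) * Gamma (1 + a - e) * Gamma (1 + b - e) *
     (Gamma a * Gamma b * F43_pair (f - d) (g - d) c (1 + c - e) (1 + c - d) (1 + a + c - e) (1 + b + c - e))"
proof -
  define q where "q = 1 + a + b - e"
  have q: "q = 1 + a + b - e" "q = f + g - c - d" using S by (simp_all add: q_def)
  let ?T = "\<lambda>n. Gamma (f - d + real n) * Gamma (g - d + real n) / fact n * suminf (ladder_term a b q c n)"
  let ?T' = "\<lambda>n. Gamma (a + real n) * Gamma (b + real n) / fact n * suminf (ladder_term (f - d) (g - d) q c n)"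
  define \<kappa> where "\<kappa> = sin (pi * e) / pi * (Gamma (1 + a - e) * Gamma (1 + b - e))"
  have \<kappa>0: "\<kappa> \<noteq> 0" using pos se by (auto simp: \<kappa>_def intro!: Gamma_real_nonzero)
  have 1: "(\<lambda>n. \<kappa> * ?T n) sums (Gamma (f - d) * Gamma (g - d) * F43_pair a b c d e f g)"
    unfolding \<kappa>_def by (rule F43_pair_ladder) (use pos q in auto)
  \<comment> \<open>The value of the double series without its prefactor; both sides of the claim
    are expressed by it.\<close>
  define l where "l = Gamma (f - d) * Gamma (g - d) * F43_pair a b c d e f g / \<kappa>"
  have l: "?T sums l" using sums_divide[OF 1, of \<kappa>] \<kappa>0 by (simp add: l_def)
  have l': "?T' sums l" by (rule ladder_symmetric[OF _ _ _ _ _ _ _ _ l]) (use pos q in auto)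
  have e: "1 + a + c - e - (1 + c - e) = a" "1 + b + c - e - (1 + c - e) = b" "1 + (f - d) - (1 + c - d) = f - c"
    "1 + (g - d) - (1 + c - d) = g - c" by simp_all
  have "(\<lambda>n. sin (pi * (1 + c - d)) / pi * (Gamma (1 + (f - d) - (1 + c - d)) * Gamma (1 + (g - d) - (1 + c - d))) *
            (Gamma (1 + a + c - e - (1 + c - e) + real n) * Gamma (1 + b + c - e - (1 + c - e) + real n) / fact n *
              suminf (ladder_term (f - d) (g - d) q c n))) sums
      (Gamma (1 + a + c - e - (1 + c - e)) * Gamma (1 + b + c - e - (1 + c - e)) *
        F43_pair (f - d) (g - d) c (1 + c - e) (1 + c - d) (1 + a + c - e) (1 + b + c - e))"
    by (rule F43_pair_ladder) (use pos q in auto)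
  then have "(\<lambda>n. sin (pi * (1 + c - d)) / pi * (Gamma (f - c) * Gamma (g - c)) * ?T' n) sums
      (Gamma a * Gamma b * F43_pair (f - d) (g - d) c (1 + c - e) (1 + c - d) (1 + a + c - e) (1 + b + c - e))"
    unfolding e .
  moreover have "(\<lambda>n. sin (pi * (1 + c - d)) / pi * (Gamma (f - c) * Gamma (g - c)) * ?T' n) sums
      (sin (pi * (1 + c - d)) / pi * (Gamma (f - c) * Gamma (g - c)) * l)"
    by (rule sums_mult[OF l'])
  ultimately have 2: "Gamma a * Gamma b * F43_pair (f - d) (g - d) c (1 + c - e) (1 + c - d) (1 + a + c - e) (1 + b + c - e) =
       sin (pi * (1 + c - d)) / pi * (Gamma (f - c) * Gamma (g - c)) * l"
    by (rule sums_unique2)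
  have 3: "Gamma (f - d) * Gamma (g - d) * F43_pair a b c d e f g = \<kappa> * l" using \<kappa>0 by (simp add: l_def)
  show ?thesis unfolding 2 3 \<kappa>_def by (simp add: field_simps)
qed

text \<open>Regroups the upper parameters between the two swaps; otherwise the second swap would
  undo the first.\<close>

lemma F43_pair_commute: "F43_pair c d a b e f g = F43_pair a b c d e f g"
proof -
  have "F43_term c d a b e f g = F43_term a b c d e f g" for a b c d e f g
    by (rule ext) (simp add: F43_term_def mult_ac)
  then show ?thesis by (simp add: F43_pair_def)
qed

text \<open>Two swaps in a row apply at these parameters. The point used below is
  \<open>a = b = c = 1/2, d = 11/20, e = 6/5, f = 19/20, g = 9/10\<close>.\<close>

definition swap_region :: "real \<Rightarrow> real \<Rightarrow> real \<Rightarrow> real \<Rightarrow> real \<Rightarrow> real \<Rightarrow> real \<Rightarrow> bool" where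
  "swap_region a b c d e f g \<longleftrightarrow> (\<forall>x\<in>{a, b, c, d}. 0 < x \<and> 0 < 1 + x - e \<and> x < f \<and> x < g) \<and>
     1 < e \<and> e < 2 \<and> 0 < 1 + a + b - e \<and> a + b < e \<and> 0 < 1 + c + d - e \<and> c + d < e \<and>
     c < d \<and> d < 1 + c \<and> f < 1 + g \<and> g < 1 + f \<and> e + f + g - a - b - c - d = 1"

lemma sin_pi_pos: "0 < x \<Longrightarrow> x < 1 \<Longrightarrow> 0 < sin (pi * x)"
  by (rule sin_gt_zero) auto

text \<open>The first swap leads from the given pair to \<open>P1\<close>, and the second, applied
  after exchanging \<open>(f - d, g - d)\<close> with \<open>(c, 1 + c - e)\<close>, leads from
  \<open>P1\<close> to \<open>P2\<close>.\<close>

lemma F43_pair_antipode: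
  assumes R: "swap_region a b c d e f g"
  shows "sin (pi * (1 + f - g)) * Gamma (g - b) * Gamma (g - a) * Gamma (f - b) * Gamma (f - a) *
       Gamma (f - c) * Gamma (g - c) * Gamma (f - d) * Gamma (g - d) * F43_pair a b c d e f g =
     sin (pi * e) * Gamma a * Gamma b * Gamma c * Gamma d * Gamma (1 + a - e) * Gamma (1 + b - e) *
       Gamma (1 + c - e) * Gamma (1 + d - e) * F43_pair (f - b) (f - a) (f - d) (f - c) (1 + f - g) f (1 + f - e)"
proof -
  note R' = R[unfolded swap_region_def]
  have ineq: "a > 0" "b > 0" "c > 0" "d > 0" "e > 1" "e < 2" "1 + a + b - e > 0" "1 + a + b - e < 1"
    "1 + c + d - e > 0" "1 + c + d - e < 1" "c < d" "d < 1 + c" "f < 1 + g" "g < 1 + f"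
    "f - a > 0" "f - b > 0" "f - c > 0" "f - d > 0" "g - a > 0" "g - b > 0" "g - c > 0" "g - d > 0"
    "1 + a - e > 0" "1 + b - e > 0" "1 + c - e > 0" "1 + d - e > 0"
    using R' by auto
  have S: "e + f + g - a - b - c - d = 1" using R' by blast
  define P1 where "P1 = F43_pair (f - d) (g - d) c (1 + c - e) (1 + c - d) (1 + a + c - e) (1 + b + c - e)"
  define P2 where "P2 = F43_pair (f - b) (f - a) (f - d) (f - c) (1 + f - g) f (1 + f - e)"
  have se: "sin (pi * e) \<noteq> 0"
  proof -
    have "sin (pi * e) = - sin (pi * (e - 1))" by (simp add: right_diff_distrib)
    then show ?thesis using sin_pi_pos[of "e - 1"] ineq by simp
  qed
  \<comment> \<open>This sine belongs to the intermediate pair and has to be cancelled; hence the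
    conditions \<open>c < d < 1 + c\<close> in \<open>swap_region\<close>.\<close>
  have se1: "sin (pi * (1 + c - d)) \<noteq> 0" using sin_pi_pos[of "1 + c - d"] ineq by auto
  have 1: "sin (pi * (1 + c - d)) * Gamma (f - c) * Gamma (g - c) * (Gamma (f - d) * Gamma (g - d) * F43_pair a b c d e f g) =
     sin (pi * e) * Gamma (1 + a - e) * Gamma (1 + b - e) * (Gamma a * Gamma b * P1)"
    unfolding P1_def
    by (rule F43_pair_swap[OF ineq(1-4) _ _ ineq(7,8,18,22,17,21,23-26) _ _ S se]) (use ineq(5,6,11,12) in simp_all)
  have 2: "sin (pi * (1 + (f - d) - (g - d))) * Gamma ((1 + a + c - e) - (f - d)) * Gamma ((1 + b + c - e) - (f - d)) *
     (Gamma ((1 + a + c - e) - (g - d)) * Gamma ((1 + b + c - e) - (g - d)) *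
       F43_pair c (1 + c - e) (f - d) (g - d) (1 + c - d) (1 + a + c - e) (1 + b + c - e)) =
     sin (pi * (1 + c - d)) * Gamma (1 + c - (1 + c - d)) * Gamma (1 + (1 + c - e) - (1 + c - d)) *
     (Gamma c * Gamma (1 + c - e) * F43_pair ((1 + a + c - e) - (g - d)) ((1 + b + c - e) - (g - d)) (f - d)
       (1 + (f - d) - (1 + c - d)) (1 + (f - d) - (g - d)) (1 + c + (f - d) - (1 + c - d)) (1 + (1 + c - e) + (f - d) - (1 + c - d)))"
  proof (rule F43_pair_swap[OF ineq(3,25,18,22)])
    show "1 + c - d > 0" "2 - (1 + c - d) > 0" using ineq(11,12) by simp_all
    show "1 + c + (1 + c - e) - (1 + c - d) > 0" "1 + c + (1 + c - e) - (1 + c - d) < 1" using ineq(9,10) by simp_all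
    show "(1 + a + c - e) - (g - d) > 0" "(1 + b + c - e) - (g - d) > 0" using ineq(15,16) S by linarith+
    show "(1 + a + c - e) - (f - d) > 0" "(1 + b + c - e) - (f - d) > 0" using ineq(19,20) S by linarith+
    show "1 + c - (1 + c - d) > 0" "1 + (1 + c - e) - (1 + c - d) > 0" using ineq(4,26) by simp_all
    show "1 + (f - d) - (1 + c - d) > 0" "1 + (g - d) - (1 + c - d) > 0" using ineq(17,21) by simp_all
    show "1 + (f - d) - (g - d) > 0" "1 - (f - d) + (g - d) > 0" using ineq(13,14) by simp_all
    show "1 + c - d + (1 + a + c - e) + (1 + b + c - e) - c - (1 + c - e) - (f - d) - (g - d) = 1" using S by linarith
  qed (rule se1)
  have eqs: "1 + (f - d) - (g - d) = 1 + f - g" "(1 + a + c - e) - (f - d) = g - b" "(1 + b + c - e) - (f - d) = g - a"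
    "(1 + a + c - e) - (g - d) = f - b" "(1 + b + c - e) - (g - d) = f - a" "1 + c - (1 + c - d) = d"
    "1 + (1 + c - e) - (1 + c - d) = 1 + d - e" "1 + (f - d) - (1 + c - d) = f - c"
    "1 + c + (f - d) - (1 + c - d) = f" "1 + (1 + c - e) + (f - d) - (1 + c - d) = 1 + f - e"
    using S by (simp_all add: algebra_simps)
  have 2: "sin (pi * (1 + f - g)) * Gamma (g - b) * Gamma (g - a) * (Gamma (f - b) * Gamma (f - a) * P1) =
     sin (pi * (1 + c - d)) * Gamma d * Gamma (1 + d - e) * (Gamma c * Gamma (1 + c - e) * P2)"
    using 2 unfolding eqs P2_def P1_def F43_pair_commute[of c "1 + c - e"] .
  have comb: "X2 * Y1 = W * Y2" if "s * Y1 = W * P" "X2 * P = s * Y2" "s \<noteq> 0" for s W P X2 Y1 Y2 :: real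
  proof -
    have "s * (X2 * Y1) = X2 * (s * Y1)" by simp
    also have "\<dots> = W * (X2 * P)" using that(1) by simp
    also have "\<dots> = s * (W * Y2)" using that(2) by simp
    finally show ?thesis using that(3) by simp
  qed
  have "(sin (pi * (1 + f - g)) * Gamma (g - b) * Gamma (g - a) * Gamma (f - b) * Gamma (f - a)) *
      (Gamma (f - c) * Gamma (g - c) * Gamma (f - d) * Gamma (g - d) * F43_pair a b c d e f g) =
      (sin (pi * e) * Gamma (1 + a - e) * Gamma (1 + b - e) * Gamma a * Gamma b) *
      (Gamma d * Gamma (1 + d - e) * Gamma c * Gamma (1 + c - e) * P2)"
    by (rule comb[OF _ _ se1]) (use 1 2 in \<open>simp_all only: mult_ac\<close>)
  then show ?thesis unfolding P2_def by (simp only: mult_ac)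
qed

section \<open>Entire hypergeometric series\<close>

text \<open>The 6 is the largest number of monomials in an elementary symmetric polynomial of four
  variables, and \<open>B \<ge> 1\<close> allows every power of \<open>B\<close> to be rounded up to
  the fourth.\<close>

lemma norm_quartic_coeff_le:
  fixes a b c d :: complex and B :: real
  assumes "norm a \<le> B" "norm b \<le> B" "norm c \<le> B" "norm d \<le> B" "B \<ge> 1"
  shows "norm (a * b + a * c + a * d + b * c + b * d + c * d) \<le> 6 * B ^ 4"
    and "norm (a * b * c + a * b * d + a * c * d + b * c * d) \<le> 6 * B ^ 4"
    and "norm (a * b * c * d) \<le> 6 * B ^ 4"
    and "norm (a + b + c + d) \<le> 6 * B ^ 4"
proof -
  have p: "B \<le> B ^ 4" "B ^ 2 \<le> B ^ 4" "B ^ 3 \<le> B ^ 4" "0 \<le> B ^ 4"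
    using assms(5) by (auto intro!: power_increasing self_le_power)
  have m2: "norm (x * y) \<le> B ^ 4" if "norm x \<le> B" "norm y \<le> B" for x y :: complex
  proof -
    have "norm (x * y) \<le> B * B" unfolding norm_mult using that assms(5) by (intro mult_mono) auto
    then show ?thesis using p(2) by (simp add: power2_eq_square)
  qed
  have m3: "norm (x * y * z) \<le> B ^ 4" if "norm x \<le> B" "norm y \<le> B" "norm z \<le> B" for x y z :: complex
  proof -
    have "norm (x * y * z) \<le> B * B * B" unfolding norm_mult using that assms(5) by (intro mult_mono) auto
    then show ?thesis using p(3) by (simp add: power3_eq_cube)
  qed
  show "norm (a * b * c * d) \<le> 6 * B ^ 4"
  proof -
    have "norm (a * b * c * d) \<le> B * B * B * B" unfolding norm_mult using assms by (intro mult_mono) auto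
    then show ?thesis using p(4) by (simp add: power4_eq_xxxx)
  qed
  show "norm (a * b + a * c + a * d + b * c + b * d + c * d) \<le> 6 * B ^ 4"
    using m2[OF assms(1,2)] m2[OF assms(1,3)] m2[OF assms(1,4)] m2[OF assms(2,3)] m2[OF assms(2,4)] m2[OF assms(3,4)]
      norm_triangle_ineq[of "a * b + a * c + a * d + b * c + b * d" "c * d"]
      norm_triangle_ineq[of "a * b + a * c + a * d + b * c" "b * d"]
      norm_triangle_ineq[of "a * b + a * c + a * d" "b * c"]
      norm_triangle_ineq[of "a * b + a * c" "a * d"]
      norm_triangle_ineq[of "a * b" "a * c"]
    by linarith
  show "norm (a * b * c + a * b * d + a * c * d + b * c * d) \<le> 6 * B ^ 4"
    using m3[OF assms(1,2,3)] m3[OF assms(1,2,4)] m3[OF assms(1,3,4)] m3[OF assms(2,3,4)] p(4)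
      norm_triangle_ineq[of "a * b * c + a * b * d + a * c * d" "b * c * d"]
      norm_triangle_ineq[of "a * b * c + a * b * d" "a * c * d"]
      norm_triangle_ineq[of "a * b * c" "a * b * d"]
    by linarith
  show "norm (a + b + c + d) \<le> 6 * B ^ 4"
    using assms p(1,4) norm_triangle_ineq[of "a + b + c" d] norm_triangle_ineq[of "a + b" c] norm_triangle_ineq[of a b]
    by linarith
qed

text \<open>The condition on the sums removes the two leading coefficients, so that the quotient of the
  two products behaves like \<open>(w + 2) / w\<close> up to a factor \<open>1 + O(w\<^sup>-\<^sup>2)\<close>.\<close>

lemma quartic_difference_bound:
  fixes a b c d p q r s w :: complex and B :: real
  assumes B: "norm a \<le> B" "norm b \<le> B" "norm c \<le> B" "norm d \<le> B"
    "norm p \<le> B" "norm q \<le> B" "norm r \<le> B" "norm s \<le> B" "B \<ge> 1"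
    and sum: "p + q + r + s - a - b - c - d = 2" and w: "norm w \<ge> 1"
  shows "norm ((a + w) * (b + w) * (c + w) * (d + w) * (w + 2) - (p + w) * (q + w) * (r + w) * (s + w) * w)
         \<le> 100 * B ^ 4 * norm w ^ 3"
proof -
  define A2 where "A2 = a * b + a * c + a * d + b * c + b * d + c * d"
  define A3 where "A3 = a * b * c + a * b * d + a * c * d + b * c * d"
  define A4 where "A4 = a * b * c * d"
  define A1 where "A1 = a + b + c + d"
  define P2 where "P2 = p * q + p * r + p * s + q * r + q * s + r * s"
  define P3 where "P3 = p * q * r + p * q * s + p * r * s + q * r * s"
  define P4 where "P4 = p * q * r * s"
  let ?M = "6 * B ^ 4"
  have M: "norm A1 \<le> ?M" "norm A2 \<le> ?M" "norm A3 \<le> ?M" "norm A4 \<le> ?M" "norm P2 \<le> ?M" "norm P3 \<le> ?M" "norm P4 \<le> ?M"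
    unfolding A1_def A2_def A3_def A4_def P2_def P3_def P4_def by (intro norm_quartic_coeff_le B)+
  have quartic: "(x1 + w) * (x2 + w) * (x3 + w) * (x4 + w) = w ^ 4 + (x1 + x2 + x3 + x4) * w ^ 3
      + (x1 * x2 + x1 * x3 + x1 * x4 + x2 * x3 + x2 * x4 + x3 * x4) * w ^ 2
      + (x1 * x2 * x3 + x1 * x2 * x4 + x1 * x3 * x4 + x2 * x3 * x4) * w + x1 * x2 * x3 * x4"
    for x1 x2 x3 x4 :: complex
    by (simp add: algebra_simps power_numeral_reduce)
  have P1: "p + q + r + s = A1 + 2" using sum by (simp add: A1_def algebra_simps)
  have eq: "(a + w) * (b + w) * (c + w) * (d + w) * (w + 2) - (p + w) * (q + w) * (r + w) * (s + w) * w =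
      (A2 + 2 * A1 - P2) * w ^ 3 + (A3 + 2 * A2 - P3) * w ^ 2 + (A4 + 2 * A3 - P4) * w + 2 * A4"
    unfolding quartic P1 unfolding A1_def [symmetric] A2_def [symmetric] A3_def [symmetric] A4_def [symmetric]
      P2_def [symmetric] P3_def [symmetric] P4_def [symmetric]
    by (simp add: algebra_simps power_numeral_reduce)
  have c1: "norm (x + 2 * y - z) \<le> 4 * ?M" if "norm x \<le> ?M" "norm y \<le> ?M" "norm z \<le> ?M" for x y z :: complex
  proof -
    have "norm (x + 2 * y - z) \<le> norm x + norm (2 * y) + norm z"
      using norm_triangle_ineq4[of "x + 2 * y" z] norm_triangle_ineq[of x "2 * y"] by linarith
    then show ?thesis using that by (simp add: norm_mult)
  qed
  have wp: "norm w ^ 2 \<le> norm w ^ 3" "norm w \<le> norm w ^ 3" "1 \<le> norm w ^ 3"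
    using w by (auto intro!: power_increasing self_le_power one_le_power)
  have t: "norm (x * w ^ k) \<le> 4 * ?M * norm w ^ 3" if "norm x \<le> 4 * ?M" "norm w ^ k \<le> norm w ^ 3" for x k
    unfolding norm_mult norm_power using that by (intro mult_mono) auto
  have "norm ((A2 + 2 * A1 - P2) * w ^ 3) \<le> 4 * ?M * norm w ^ 3" by (intro t c1 M) simp
  moreover have "norm ((A3 + 2 * A2 - P3) * w ^ 2) \<le> 4 * ?M * norm w ^ 3" by (intro t c1 M wp)
  moreover have "norm ((A4 + 2 * A3 - P4) * w ^ 1) \<le> 4 * ?M * norm w ^ 3"
    by (intro t c1 M) (use wp in simp)
  moreover have "norm (2 * A4 * w ^ 0) \<le> 4 * ?M * norm w ^ 3"
  proof (rule t)
    show "norm (2 * A4) \<le> 4 * ?M"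
      using M(4) norm_ge_zero[of A4] unfolding norm_mult norm_numeral by linarith
  qed (use wp in simp)
  ultimately have "norm ((A2 + 2 * A1 - P2) * w ^ 3 + (A3 + 2 * A2 - P3) * w ^ 2 + (A4 + 2 * A3 - P4) * w + 2 * A4)
     \<le> 16 * ?M * norm w ^ 3"
    using norm_triangle_ineq[of "(A2 + 2 * A1 - P2) * w ^ 3 + (A3 + 2 * A2 - P3) * w ^ 2 + (A4 + 2 * A3 - P4) * w" "2 * A4"]
      norm_triangle_ineq[of "(A2 + 2 * A1 - P2) * w ^ 3 + (A3 + 2 * A2 - P3) * w ^ 2" "(A4 + 2 * A3 - P4) * w"]
      norm_triangle_ineq[of "(A2 + 2 * A1 - P2) * w ^ 3" "(A3 + 2 * A2 - P3) * w ^ 2"]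
    by simp
  \<comment> \<open>Four coefficients, each at most \<open>4 * 6 * B ^ 4\<close>, give 96, rounded
    up to 100.\<close>
  also have "\<dots> \<le> 100 * B ^ 4 * norm w ^ 3"
    using B(9) by (simp add: mult_right_mono)
  finally show ?thesis unfolding eq .
qed

lemma norm_add_ge_half:
  fixes p w :: complex
  assumes "norm p \<le> B" "norm w \<ge> 2 * B"
  shows "norm (p + w) \<ge> norm w / 2"
  using norm_triangle_ineq2[of w "- p"] assms by (simp add: add.commute)

lemma quartic_norm_ge:
  fixes p q r s w :: complex
  assumes "norm p \<le> B" "norm q \<le> B" "norm r \<le> B" "norm s \<le> B" "norm w \<ge> 2 * B"
  shows "norm ((p + w) * (q + w) * (r + w) * (s + w)) \<ge> norm w ^ 4 / 16"
proof -
  have "norm w / 2 * (norm w / 2) * (norm w / 2) * (norm w / 2) \<le> norm ((p + w) * (q + w) * (r + w) * (s + w))"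
    unfolding norm_mult using assms by (intro mult_mono norm_add_ge_half) auto
  then show ?thesis by (simp add: power4_eq_xxxx)
qed

text \<open>Here 1600 is 100 times 16, the 16 coming from \<open>quartic_norm_ge\<close>; the 3200
  has a further factor 2 from \<open>norm (w + 2) \<ge> norm w / 2\<close>. The threshold
  \<open>2 * B + 4\<close> guarantees these lower bounds. The first estimate controls term ratios of
  series, the second the quotients of Gamma products.\<close>

lemma quartic_quotient_bound:
  fixes a b c d p q r s w :: complex and B :: real
  assumes B: "norm a \<le> B" "norm b \<le> B" "norm c \<le> B" "norm d \<le> B"
    "norm p \<le> B" "norm q \<le> B" "norm r \<le> B" "norm s \<le> B" "B \<ge> 1"
    and sum: "p + q + r + s - a - b - c - d = 2" and w: "norm w \<ge> 2 * B + 4"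
  shows "norm ((a + w) * (b + w) * (c + w) * (d + w) / ((p + w) * (q + w) * (r + w) * (s + w)))
         \<le> norm (w / (w + 2)) * (1 + 1600 * B ^ 4 / norm w ^ 2)"
    and "norm ((p + w) * (q + w) * (r + w) * (s + w) / ((a + w) * (b + w) * (c + w) * (d + w)))
         \<le> norm ((w + 2) / w) * (1 + 3200 * B ^ 4 / norm w ^ 2)"
proof -
  let ?A = "(a + w) * (b + w) * (c + w) * (d + w)" and ?P = "(p + w) * (q + w) * (r + w) * (s + w)"
  define N where "N = ?A * (w + 2) - ?P * w"
  have w1: "norm w \<ge> 1" "norm w > 0" using w B(9) by linarith+
  have N: "norm N \<le> 100 * B ^ 4 * norm w ^ 3"
    unfolding N_def by (rule quartic_difference_bound[OF B sum w1(1)])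
  have P: "norm ?P \<ge> norm w ^ 4 / 16" by (rule quartic_norm_ge[where B = B]) (use B w in auto)
  have A: "norm ?A \<ge> norm w ^ 4 / 16" by (rule quartic_norm_ge[where B = B]) (use B w in auto)
  have w2: "norm (w + 2) \<ge> norm w / 2"
    using norm_triangle_ineq2[of w "- 2"] w B(9) by simp
  have pos: "norm w ^ 4 / 16 > 0" using w1 by simp
  have nz: "?P \<noteq> 0" "?A \<noteq> 0" "w \<noteq> 0" "w + 2 \<noteq> 0"
    using P A pos w1 w2 by (fastforce simp del: mult_eq_0_iff)+
  have "?A / ?P = w / (w + 2) * (1 + N / (?P * w))"
  proof -
    have "1 + N / (?P * w) = ?A * (w + 2) / (?P * w)" unfolding N_def using nz by (simp add: diff_divide_distrib)
    then show ?thesis using nz by simp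
  qed
  then have "norm (?A / ?P) = norm (w / (w + 2)) * norm (1 + N / (?P * w))"
    unfolding norm_mult [symmetric] by (rule arg_cong)
  also have "norm (1 + N / (?P * w)) \<le> 1 + 1600 * B ^ 4 / norm w ^ 2"
  proof -
    have "norm (N / (?P * w)) \<le> (100 * B ^ 4 * norm w ^ 3) / (norm w ^ 4 / 16 * norm w)"
      unfolding norm_divide norm_mult[of ?P w] using N P pos w1 by (intro frac_le mult_right_mono mult_pos_pos) auto
    also have "\<dots> = 1600 * B ^ 4 / norm w ^ 2" using w1 by (simp add: field_simps power_numeral_reduce)
    finally show ?thesis using norm_triangle_ineq[of 1 "N / (?P * w)"] by simp
  qed
  finally show "norm (?A / ?P) \<le> norm (w / (w + 2)) * (1 + 1600 * B ^ 4 / norm w ^ 2)"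
    by (simp add: mult_left_mono)
  have "?P / ?A = (w + 2) / w * (1 - N / (?A * (w + 2)))"
  proof -
    have "1 - N / (?A * (w + 2)) = ?P * w / (?A * (w + 2))" unfolding N_def using nz by (simp add: diff_divide_distrib)
    then show ?thesis using nz by simp
  qed
  then have "norm (?P / ?A) = norm ((w + 2) / w) * norm (1 - N / (?A * (w + 2)))"
    unfolding norm_mult [symmetric] by (rule arg_cong)
  also have "norm (1 - N / (?A * (w + 2))) \<le> 1 + 3200 * B ^ 4 / norm w ^ 2"
  proof -
    have "norm (N / (?A * (w + 2))) \<le> (100 * B ^ 4 * norm w ^ 3) / (norm w ^ 4 / 16 * (norm w / 2))"
      unfolding norm_divide norm_mult[of ?A "w + 2"] using N A pos w1 w2 by (intro frac_le mult_mono mult_pos_pos) auto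
    also have "\<dots> = 3200 * B ^ 4 / norm w ^ 2" using w1 by (simp add: field_simps power_numeral_reduce)
    finally show ?thesis using norm_triangle_ineq4[of 1 "N / (?A * (w + 2))"] by simp
  qed
  finally show "norm (?P / ?A) \<le> norm ((w + 2) / w) * (1 + 3200 * B ^ 4 / norm w ^ 2)"
    by (simp add: mult_left_mono)
qed

text \<open>The model sequence \<open>1 / (k * (k + 1))\<close> has ratio exactly
  \<open>k / (k + 2)\<close>. The perturbing factors multiply to at most the exponential of the sum
  of \<open>C / j ^ 2\<close>.\<close>

lemma ratio_growth:
  fixes u :: "nat \<Rightarrow> complex" and C :: real and K :: nat
  assumes K: "K \<ge> 1" and C: "C \<ge> 0"
    and step: "\<And>k. k \<ge> K \<Longrightarrow> norm (u (Suc k)) \<le> real k / (real k + 2) * (1 + C / real k ^ 2) * norm (u k)"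
    and k: "k \<ge> K"
  shows "norm (u k) \<le> norm (u K) * (real K * (real K + 1)) * exp (C * (\<Sum>j=K..<k. 1 / real j ^ 2)) / (real k * (real k + 1))"
  using k
proof (induction k rule: dec_induct)
  case base
  then show ?case using K by simp
next
  case (step k)
  have k1: "real k \<ge> 1" using step K by simp
  let ?X = "norm (u K) * (real K * (real K + 1))" and ?e = "exp (C * (\<Sum>j=K..<k. 1 / real j ^ 2))"
  have "norm (u (Suc k)) \<le> real k / (real k + 2) * (1 + C / real k ^ 2) * norm (u k)"
    by (rule assms(3)) (use step in simp)
  also have "\<dots> \<le> real k / (real k + 2) * (1 + C / real k ^ 2) * (?X * ?e / (real k * (real k + 1)))"
    using step.IH C by (intro mult_left_mono) auto
  also have "\<dots> \<le> real k / (real k + 2) * exp (C / real k ^ 2) * (?X * ?e / (real k * (real k + 1)))"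
    by (intro mult_right_mono mult_left_mono exp_ge_add_one_self) auto
  also have "\<dots> = ?X * (?e * exp (C / real k ^ 2)) / ((real k + 2) * (real k + 1))"
  proof -
    have "x / (x + 2) * E * (X * e / (x * (x + 1))) = X * (e * E) / ((x + 2) * (x + 1))" if "x \<ge> 1" for x E X e :: real
      using that by (simp add: divide_simps)
    then show ?thesis using k1 by blast
  qed
  also have "?e * exp (C / real k ^ 2) = exp (C * (\<Sum>j=K..<Suc k. 1 / real j ^ 2))"
    using step by (simp add: sum.atLeastLessThan_Suc distrib_left exp_add)
  finally show ?case by (simp add: algebra_simps)
qed

lemma sum_inverse_squares_le: "(\<Sum>j=m..<k. 1 / real j ^ 2) \<le> (\<Sum>j. 1 / real j ^ 2)"
  using inverse_power_summable[of 2, where 'a = real]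
  by (intro sum_le_suminf) (auto simp: divide_inverse)

text \<open>On a disc the parameters are bounded, so from one index on all terms are dominated by a
  multiple of \<open>1 / (k * (k + 1))\<close>, and the Weierstrass test applies. The recurrence is
  stated without division since its factors may vanish for small \<open>k\<close>.\<close>

lemma
  fixes u :: "nat \<Rightarrow> complex \<Rightarrow> complex" and a b c d p q r s :: "complex \<Rightarrow> complex"
  assumes hu: "\<And>k. u k holomorphic_on UNIV"
    and cont: "continuous_on UNIV a" "continuous_on UNIV b" "continuous_on UNIV c" "continuous_on UNIV d"
      "continuous_on UNIV p" "continuous_on UNIV q" "continuous_on UNIV r" "continuous_on UNIV s"
    and sum: "\<And>z. p z + q z + r z + s z - a z - b z - c z - d z = 2"
    and rec: "\<And>k z. u (Suc k) z * ((p z + of_nat k) * (q z + of_nat k) * (r z + of_nat k) * (s z + of_nat k)) =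
        u k z * ((a z + of_nat k) * (b z + of_nat k) * (c z + of_nat k) * (d z + of_nat k))"
  shows holomorphic_hypergeometric_series: "(\<lambda>z. \<Sum>k. u k z) holomorphic_on UNIV"
    and summable_hypergeometric_series: "summable (\<lambda>k. u k z)"
proof -
  define Z where "Z = (\<Sum>j. 1 / real j ^ 2)"
  have main: "\<exists>K M. \<forall>k\<ge>K. \<forall>z\<in>cball 0 R. norm (u k z) \<le> M / (real k * (real k + 1))" for R :: real
  proof -
    have bd: "\<exists>B>0. \<forall>z\<in>cball 0 R. norm (f z) \<le> B" if "continuous_on UNIV f" for f :: "complex \<Rightarrow> complex"
    proof -
      have "compact (f ` cball 0 R)"
        by (rule compact_continuous_image) (use that continuous_on_subset in auto)
      then have "bounded (f ` cball 0 R)" by (rule compact_imp_bounded)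
      then show ?thesis by (auto simp: bounded_pos)
    qed
    obtain B1 where B1: "B1 > 0" "\<forall>z\<in>cball 0 R. norm (a z) \<le> B1" using bd[OF cont(1)] by blast
    obtain B2 where B2: "B2 > 0" "\<forall>z\<in>cball 0 R. norm (b z) \<le> B2" using bd[OF cont(2)] by blast
    obtain B3 where B3: "B3 > 0" "\<forall>z\<in>cball 0 R. norm (c z) \<le> B3" using bd[OF cont(3)] by blast
    obtain B4 where B4: "B4 > 0" "\<forall>z\<in>cball 0 R. norm (d z) \<le> B4" using bd[OF cont(4)] by blast
    obtain B5 where B5: "B5 > 0" "\<forall>z\<in>cball 0 R. norm (p z) \<le> B5" using bd[OF cont(5)] by blast
    obtain B6 where B6: "B6 > 0" "\<forall>z\<in>cball 0 R. norm (q z) \<le> B6" using bd[OF cont(6)] by blast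
    obtain B7 where B7: "B7 > 0" "\<forall>z\<in>cball 0 R. norm (r z) \<le> B7" using bd[OF cont(7)] by blast
    obtain B8 where B8: "B8 > 0" "\<forall>z\<in>cball 0 R. norm (s z) \<le> B8" using bd[OF cont(8)] by blast
    define B where "B = 1 + B1 + B2 + B3 + B4 + B5 + B6 + B7 + B8"
    have BB: "B1 \<le> B" "B2 \<le> B" "B3 \<le> B" "B4 \<le> B" "B5 \<le> B" "B6 \<le> B" "B7 \<le> B" "B8 \<le> B" "1 \<le> B"
      unfolding B_def using B1(1) B2(1) B3(1) B4(1) B5(1) B6(1) B7(1) B8(1) by linarith+
    have bB: "norm (a z) \<le> B" "norm (b z) \<le> B" "norm (c z) \<le> B" "norm (d z) \<le> B"
       "norm (p z) \<le> B" "norm (q z) \<le> B" "norm (r z) \<le> B" "norm (s z) \<le> B" if "z \<in> cball 0 R" for z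
      using bspec[OF B1(2) that] bspec[OF B2(2) that] bspec[OF B3(2) that] bspec[OF B4(2) that] bspec[OF B5(2) that] bspec[OF B6(2) that] bspec[OF B7(2) that] bspec[OF B8(2) that]
        BB by linarith+
    \<comment> \<open>From this index on the quartic bounds hold on the whole disc; in particular
      the lower factors are nonzero and the recurrence may be divided.\<close>
    obtain K :: nat where K: "real K \<ge> 2 * B + 4" using real_arch_simple by blast
    define C where "C = 1600 * B ^ 4"
    have C: "C \<ge> 0" using BB(9) by (simp add: C_def)
    have "continuous_on UNIV (u K)" by (rule holomorphic_on_imp_continuous_on[OF hu])
    then obtain M0 where M0: "\<And>z. z \<in> cball 0 R \<Longrightarrow> norm (u K z) \<le> M0" using bd by blast
    have "norm (u k z) \<le> M0 * (real K * (real K + 1)) * exp (C * Z) / (real k * (real k + 1))"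
      if z: "z \<in> cball 0 R" and k: "k \<ge> K" for k z
    proof -
      have K1: "K \<ge> 1" using K BB(9) by (cases K) auto
      have "norm (u k z) \<le> norm (u K z) * (real K * (real K + 1)) * exp (C * (\<Sum>j=K..<k. 1 / real j ^ 2)) / (real k * (real k + 1))"
      proof (rule ratio_growth[OF K1 C _ k])
        fix k :: nat assume k: "k \<ge> K"
        then have nk: "norm (of_nat k :: complex) \<ge> 2 * B + 4" using K by simp
        let ?A = "(a z + of_nat k) * (b z + of_nat k) * (c z + of_nat k) * (d z + of_nat k)"
        let ?P = "(p z + of_nat k) * (q z + of_nat k) * (r z + of_nat k) * (s z + of_nat k)"
        have "norm ?P \<ge> norm (of_nat k :: complex) ^ 4 / 16"
          by (rule quartic_norm_ge[where B = B]) (use bB z nk BB in auto)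
        moreover have "norm (of_nat k :: complex) ^ 4 / 16 > 0" using nk BB(9) by auto
        ultimately have "?P \<noteq> 0" by (metis norm_zero not_less)
        then have "u (Suc k) z = ?A / ?P * u k z" using rec[of k z] by (simp add: field_simps)
        then have "norm (u (Suc k) z) = norm (?A / ?P) * norm (u k z)" by (simp only: norm_mult)
        also have "\<dots> \<le> (norm (of_nat k / (of_nat k + 2 :: complex)) * (1 + 1600 * B ^ 4 / norm (of_nat k :: complex) ^ 2)) * norm (u k z)"
          by (intro mult_right_mono quartic_quotient_bound) (use bB z nk BB sum in auto)
        also have "norm (of_nat k / (of_nat k + 2 :: complex)) = real k / (real k + 2)"
          by (metis norm_divide norm_of_nat of_nat_add of_nat_numeral)
        finally show "norm (u (Suc k) z) \<le> real k / (real k + 2) * (1 + C / real k ^ 2) * norm (u k z)"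
          by (simp add: C_def)
      qed
      also have "\<dots> \<le> M0 * (real K * (real K + 1)) * exp (C * Z) / (real k * (real k + 1))"
        using M0[OF z] sum_inverse_squares_le[of K k] C
        by (intro divide_right_mono mult_mono order_trans[OF norm_ge_zero M0[OF z]]) (auto simp: Z_def intro!: mult_left_mono mult_nonneg_nonneg order_trans[OF norm_ge_zero M0[OF z]])
      finally show ?thesis .
    qed
    then show ?thesis by blast
  qed
  have smM: "summable (\<lambda>k. M / (real k * (real k + 1)))" for M
  proof (rule summable_comparison_test_ev)
    show "summable (\<lambda>k. \<bar>M\<bar> * inverse (real k ^ 2))"
      by (intro summable_mult inverse_power_summable) simp
    show "\<forall>\<^sub>F k in sequentially. norm (M / (real k * (real k + 1))) \<le> \<bar>M\<bar> * inverse (real k ^ 2)"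
    proof (rule eventually_sequentiallyI[of 1])
      fix k :: nat assume "k \<ge> 1"
      then have "\<bar>M\<bar> / (real k * (real k + 1)) \<le> \<bar>M\<bar> / (real k * real k)"
        by (intro divide_left_mono) auto
      then show "norm (M / (real k * (real k + 1))) \<le> \<bar>M\<bar> * inverse (real k ^ 2)"
        by (simp add: abs_divide abs_mult power2_eq_square divide_inverse)
    qed
  qed
  have ev: "\<exists>M. \<forall>\<^sub>F k in sequentially. \<forall>z\<in>cball 0 R. norm (u k z) \<le> M / (real k * (real k + 1))" for R
    using main[of R] unfolding eventually_sequentially by blast
  show "summable (\<lambda>k. u k z)"
  proof -
    obtain M where "\<forall>\<^sub>F k in sequentially. \<forall>y\<in>cball 0 (norm z). norm (u k y) \<le> M / (real k * (real k + 1))"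
      using ev by blast
    then have "\<forall>\<^sub>F k in sequentially. norm (u k z) \<le> M / (real k * (real k + 1))"
      by (rule eventually_mono) auto
    then show ?thesis by (rule summable_comparison_test_ev[OF _ smM])
  qed
  show "(\<lambda>z. \<Sum>k. u k z) holomorphic_on UNIV"
  proof (rule holomorphic_uniform_sequence)
    show "open (UNIV :: complex set)" by simp
    show "(\<lambda>z. \<Sum>k<n. u k z) holomorphic_on UNIV" for n by (intro holomorphic_intros hu)
    fix x :: complex
    obtain M where "\<forall>\<^sub>F k in sequentially. \<forall>y\<in>cball 0 (norm x + 1). norm (u k y) \<le> M / (real k * (real k + 1))"
      using ev by blast
    then have "uniform_limit (cball 0 (norm x + 1)) (\<lambda>n z. \<Sum>k<n. u k z) (\<lambda>z. \<Sum>k. u k z) sequentially"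
      by (rule Weierstrass_m_test_ev[OF _ smM])
    then have "uniform_limit (cball x 1) (\<lambda>n z. \<Sum>k<n. u k z) (\<lambda>z. \<Sum>k. u k z) sequentially"
      by (rule uniform_limit_on_subset) (simp add: cball_subset_cball_iff)
    then show "\<exists>d>0. cball x d \<subseteq> UNIV \<and> uniform_limit (cball x d) (\<lambda>n z. \<Sum>k<n. u k z) (\<lambda>z. \<Sum>k. u k z) sequentially"
      by (intro exI[of _ 1]) auto
  qed
qed

text \<open>The 4F3 series divided by the Gamma values of its lower parameters. With
  \<open>rGamma\<close> inside the sum it makes sense also at nonpositive integers.\<close>

definition F43_reg :: "complex \<Rightarrow> complex \<Rightarrow> complex \<Rightarrow> complex \<Rightarrow> complex \<Rightarrow> complex \<Rightarrow> complex \<Rightarrow> complex" where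
  "F43_reg a b c d e f g = (\<Sum>k. pochhammer a k * pochhammer b k * pochhammer c k * pochhammer d k / fact k *
      (rGamma (e + of_nat k) * rGamma (f + of_nat k) * rGamma (g + of_nat k)))"

text \<open>The parameters are functions of one variable, so that continuation can proceed along
  complex lines in \<open>V\<close>, without functions of several variables. The factorial acts as a
  fourth lower parameter 1, which turns the balance 1 into 2.\<close>

lemma F43_reg_holomorphic:
  assumes hol: "a holomorphic_on UNIV" "b holomorphic_on UNIV" "c holomorphic_on UNIV" "d holomorphic_on UNIV"
      "e holomorphic_on UNIV" "f holomorphic_on UNIV" "g holomorphic_on UNIV"
    and sum: "\<And>z. e z + f z + g z - a z - b z - c z - d z = 1"
  shows "(\<lambda>z. F43_reg (a z) (b z) (c z) (d z) (e z) (f z) (g z)) holomorphic_on UNIV"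
    and "summable (\<lambda>k. pochhammer (a z) k * pochhammer (b z) k * pochhammer (c z) k * pochhammer (d z) k / fact k *
      (rGamma (e z + of_nat k) * rGamma (f z + of_nat k) * rGamma (g z + of_nat k)))"
proof -
  let ?u = "\<lambda>k z. pochhammer (a z) k * pochhammer (b z) k * pochhammer (c z) k * pochhammer (d z) k / fact k *
      (rGamma (e z + of_nat k) * rGamma (f z + of_nat k) * rGamma (g z + of_nat k))"
  have hu: "?u k holomorphic_on UNIV" for k
    unfolding pochhammer_prod by (intro holomorphic_intros hol) auto
  have rec: "?u (Suc k) z * ((1 + of_nat k) * (e z + of_nat k) * (f z + of_nat k) * (g z + of_nat k)) =
        ?u k z * ((a z + of_nat k) * (b z + of_nat k) * (c z + of_nat k) * (d z + of_nat k))" for k z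
  proof -
    have 1: "rGamma (x + of_nat k) = (x + of_nat k) * rGamma (x + of_nat (Suc k))" for x :: complex
      using rGamma_plus1[of "x + of_nat k"] by (simp add: add_ac)
    have nz: "(1 + of_nat k :: complex) \<noteq> 0" using of_nat_neq_0[of k] by (simp add: add.commute)
    have 2: "fact (Suc k) = (1 + of_nat k :: complex) * fact k" by simp
    show ?thesis unfolding 1 2 pochhammer_Suc using nz by (simp add: divide_simps)
  qed
  have sum': "1 + e z + f z + g z - a z - b z - c z - d z = 2" for z
    using sum[of z] by (simp add: algebra_simps)
  note * = holomorphic_hypergeometric_series[where p = "\<lambda>_. 1" and u = ?u, OF hu]
    summable_hypergeometric_series[where p = "\<lambda>_. 1" and u = ?u, OF hu]
  note cont = continuous_on_const holomorphic_on_imp_continuous_on[OF hol(1)] holomorphic_on_imp_continuous_on[OF hol(2)]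
    holomorphic_on_imp_continuous_on[OF hol(3)] holomorphic_on_imp_continuous_on[OF hol(4)]
    holomorphic_on_imp_continuous_on[OF hol(5)] holomorphic_on_imp_continuous_on[OF hol(6)] holomorphic_on_imp_continuous_on[OF hol(7)]
  show "(\<lambda>z. F43_reg (a z) (b z) (c z) (d z) (e z) (f z) (g z)) holomorphic_on UNIV"
    unfolding F43_reg_def by (rule *(1)[OF cont(2,3,4,5,1,6,7,8) sum' rec])
  show "summable (\<lambda>k. ?u k z)"
    by (rule *(2)[OF cont(2,3,4,5,1,6,7,8) sum' rec])
qed

section \<open>The regularised \<open>L\<close> and its values at positive parameters\<close>

definition L_reg :: "complex \<Rightarrow> complex \<Rightarrow> complex \<Rightarrow> complex \<Rightarrow> complex \<Rightarrow> complex \<Rightarrow> complex \<Rightarrow> complex" where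
  "L_reg a b c d e f g =
     F43_reg a b c d e f g * (rGamma (1 + a - e) * rGamma (1 + b - e) * rGamma (1 + c - e) * rGamma (1 + d - e)) -
     F43_reg (1 + a - e) (1 + b - e) (1 + c - e) (1 + d - e) (2 - e) (1 + f - e) (1 + g - e) *
       (rGamma a * rGamma b * rGamma c * rGamma d)"

lemma L_reg_holomorphic:
  assumes hol: "a holomorphic_on UNIV" "b holomorphic_on UNIV" "c holomorphic_on UNIV" "d holomorphic_on UNIV"
      "e holomorphic_on UNIV" "f holomorphic_on UNIV" "g holomorphic_on UNIV"
    and sum: "\<And>z. e z + f z + g z - a z - b z - c z - d z = 1"
  shows "(\<lambda>z. L_reg (a z) (b z) (c z) (d z) (e z) (f z) (g z)) holomorphic_on UNIV"
proof -
  have sum': "(2 - e z) + (1 + f z - e z) + (1 + g z - e z) - (1 + a z - e z) - (1 + b z - e z) - (1 + c z - e z) - (1 + d z - e z) = 1" for z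
    using sum[of z] by (simp add: algebra_simps)
  show ?thesis unfolding L_reg_def
    by (intro holomorphic_intros F43_reg_holomorphic(1) hol sum sum')
qed

lemma F43_reg_of_real:
  fixes a b c d e f g :: real
  assumes "a > 0" "b > 0" "c > 0" "d > 0" and sm: "summable (F43_term a b c d e f g)"
  shows "F43_reg a b c d e f g = of_real (suminf (F43_term a b c d e f g) / (Gamma a * Gamma b * Gamma c * Gamma d))"
proof -
  have p: "pochhammer (complex_of_real x) k = of_real (Gamma (x + real k) / Gamma x)" if "x > 0" for x k
  proof -
    have "x \<notin> \<int>\<^sub>\<le>\<^sub>0" using that by (auto elim!: nonpos_Ints_cases)
    then show ?thesis by (simp add: pochhammer_of_real pochhammer_Gamma)
  qed
  have r: "rGamma (complex_of_real x + of_nat k) = of_real (1 / Gamma (x + real k))" for x k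
    by (metis of_real_add of_real_of_nat_eq rGamma_complex_of_real rGamma_inverse_Gamma inverse_eq_divide)
  have "F43_reg a b c d e f g = (\<Sum>k. complex_of_real (F43_term a b c d e f g k / (Gamma a * Gamma b * Gamma c * Gamma d)))"
    unfolding F43_reg_def F43_term_def r using assms by (intro suminf_cong) (simp add: p mult_ac)
  also have "\<dots> = of_real (\<Sum>k. F43_term a b c d e f g k / (Gamma a * Gamma b * Gamma c * Gamma d))"
    by (rule suminf_of_real[symmetric]) (intro summable_divide sm)
  also have "(\<Sum>k. F43_term a b c d e f g k / (Gamma a * Gamma b * Gamma c * Gamma d)) =
      suminf (F43_term a b c d e f g) / (Gamma a * Gamma b * Gamma c * Gamma d)"
    by (rule suminf_divide[OF sm])
  finally show ?thesis .
qed

lemma L_reg_of_real: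
  fixes a b c d e f g :: real
  assumes pos: "a > 0" "b > 0" "c > 0" "d > 0" "1 + a - e > 0" "1 + b - e > 0" "1 + c - e > 0" "1 + d - e > 0"
    and sm: "summable (F43_term a b c d e f g)"
      "summable (F43_term (1 + a - e) (1 + b - e) (1 + c - e) (1 + d - e) (2 - e) (1 + f - e) (1 + g - e))"
  shows "L_reg a b c d e f g = of_real (F43_pair a b c d e f g / (Gamma a * Gamma b * Gamma c * Gamma d *
     Gamma (1 + a - e) * Gamma (1 + b - e) * Gamma (1 + c - e) * Gamma (1 + d - e)))"
proof -
  have c: "1 + complex_of_real x - of_real e = of_real (1 + x - e)" "2 - complex_of_real e = of_real (2 - e)" for x by simp_all
  have r: "rGamma (complex_of_real x) = of_real (1 / Gamma x)" for x
    by (metis rGamma_complex_of_real rGamma_inverse_Gamma inverse_eq_divide)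
  show ?thesis
    unfolding L_reg_def c r F43_reg_of_real[OF pos(1-4) sm(1)] F43_reg_of_real[OF pos(5-8) sm(2)] of_real_mult [symmetric] of_real_diff [symmetric] F43_pair_def
    by (intro arg_cong[of _ _ complex_of_real]) (simp add: diff_divide_distrib mult_ac)
qed

lemma summable_F43_term:
  fixes a b c d e f g :: real
  assumes "a > 0" "b > 0" "c > 0" "d > 0" "e > 0" "1 + a + b - e > 0" "f - d > 0" "g - d > 0"
    and "e + f + g - a - b - c - d = 1"
  shows "summable (F43_term a b c d e f g)"
  by (rule F43_term_expand(1)[where q = "1 + a + b - e"]) (use assms in auto)

text \<open>The sixteen Gamma factors in \<open>F43_pair_antipode\<close> are exactly those that
  separate \<open>F43_pair\<close> from \<open>L_reg\<close> on the two sides; only the two sines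
  are left.\<close>

lemma L_reg_antipode_region:
  fixes a b c d e f g :: real
  assumes R: "swap_region a b c d e f g"
  shows "sin (of_real pi * (1 + of_real f - of_real g)) * L_reg a b c d e f g =
    sin (of_real pi * of_real e) * L_reg (of_real f - of_real b) (of_real f - of_real a) (of_real f - of_real d) (of_real f - of_real c)
        (1 + of_real f - of_real g) f (1 + of_real f - of_real e)"
proof -
  note R' = R[unfolded swap_region_def]
  have ineq: "a > 0" "b > 0" "c > 0" "d > 0" "e > 1" "e < 2" "1 + a + b - e > 0" "1 + a + b - e < 1"
    "1 + c + d - e > 0" "1 + c + d - e < 1" "c < d" "d < 1 + c" "f < 1 + g" "g < 1 + f"
    "f - a > 0" "f - b > 0" "f - c > 0" "f - d > 0" "g - a > 0" "g - b > 0" "g - c > 0" "g - d > 0"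
    "1 + a - e > 0" "1 + b - e > 0" "1 + c - e > 0" "1 + d - e > 0"
    using R' by auto
  have S: "e + f + g - a - b - c - d = 1" using R' by blast
  have sm1: "summable (F43_term a b c d e f g)"
    by (rule summable_F43_term; insert ineq(1-5,7,18,22) S; linarith)
  have sm2: "summable (F43_term (1 + a - e) (1 + b - e) (1 + c - e) (1 + d - e) (2 - e) (1 + f - e) (1 + g - e))"
    by (rule summable_F43_term; insert ineq(6,7,18,22,23-26) S; linarith)
  have sm3: "summable (F43_term (f - b) (f - a) (f - d) (f - c) (1 + f - g) f (1 + f - e))"
    by (rule summable_F43_term; insert ineq(3,9,14-18,25) S; linarith)
  have sm4: "summable (F43_term (1 + (f - b) - (1 + f - g)) (1 + (f - a) - (1 + f - g)) (1 + (f - d) - (1 + f - g)) (1 + (f - c) - (1 + f - g))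
      (2 - (1 + f - g)) (1 + f - (1 + f - g)) (1 + (1 + f - e) - (1 + f - g)))"
    by (rule summable_F43_term; insert ineq(3,9,13,19-22,25) S; linarith)
  have L1: "L_reg a b c d e f g = of_real (F43_pair a b c d e f g / (Gamma a * Gamma b * Gamma c * Gamma d *
     Gamma (1 + a - e) * Gamma (1 + b - e) * Gamma (1 + c - e) * Gamma (1 + d - e)))"
    by (rule L_reg_of_real[OF ineq(1-4,23-26) sm1 sm2])
  have L2: "L_reg (of_real (f - b)) (of_real (f - a)) (of_real (f - d)) (of_real (f - c)) (of_real (1 + f - g)) f (of_real (1 + f - e)) =
    of_real (F43_pair (f - b) (f - a) (f - d) (f - c) (1 + f - g) f (1 + f - e) / (Gamma (f - b) * Gamma (f - a) * Gamma (f - d) * Gamma (f - c) *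
     Gamma (1 + (f - b) - (1 + f - g)) * Gamma (1 + (f - a) - (1 + f - g)) * Gamma (1 + (f - d) - (1 + f - g)) * Gamma (1 + (f - c) - (1 + f - g))))"
    by (rule L_reg_of_real[OF ineq(16,15,18,17) _ _ _ _ sm3 sm4]) (use ineq(19-22) in simp_all)
  have g: "1 + (f - x) - (1 + f - g) = g - x" for x by simp
  have "Gamma x \<noteq> 0" if "x \<in> {a, b, c, d, 1 + a - e, 1 + b - e, 1 + c - e, 1 + d - e, f - a, f - b, f - c, f - d, g - a, g - b, g - c, g - d}" for x
    using that ineq by (intro Gamma_real_nonzero) auto
  then have "sin (pi * (1 + f - g)) * (F43_pair a b c d e f g / (Gamma a * Gamma b * Gamma c * Gamma d *
     Gamma (1 + a - e) * Gamma (1 + b - e) * Gamma (1 + c - e) * Gamma (1 + d - e))) =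
    sin (pi * e) * (F43_pair (f - b) (f - a) (f - d) (f - c) (1 + f - g) f (1 + f - e) / (Gamma (f - b) * Gamma (f - a) * Gamma (f - d) * Gamma (f - c) *
     Gamma (g - b) * Gamma (g - a) * Gamma (g - d) * Gamma (g - c)))"
    using F43_pair_antipode[OF R] by (simp add: frac_eq_eq) (simp only: mult_ac)
  then have "complex_of_real (sin (pi * (1 + f - g)) * (F43_pair a b c d e f g / (Gamma a * Gamma b * Gamma c * Gamma d *
     Gamma (1 + a - e) * Gamma (1 + b - e) * Gamma (1 + c - e) * Gamma (1 + d - e)))) =
    of_real (sin (pi * e) * (F43_pair (f - b) (f - a) (f - d) (f - c) (1 + f - g) f (1 + f - e) / (Gamma (f - b) * Gamma (f - a) * Gamma (f - d) * Gamma (f - c) *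
     Gamma (g - b) * Gamma (g - a) * Gamma (g - d) * Gamma (g - c))))"
    by (rule arg_cong)
  then have "sin (complex_of_real (pi * (1 + f - g))) * L_reg a b c d e f g = sin (complex_of_real (pi * e)) *
      L_reg (of_real (f - b)) (of_real (f - a)) (of_real (f - d)) (of_real (f - c)) (of_real (1 + f - g)) f (of_real (1 + f - e))"
    unfolding L1 L2 g sin_of_real by (simp only: of_real_mult)
  then show ?thesis by simp
qed

section \<open>Continuation of the identity for \<open>L\<close> to all of \<open>V\<close>\<close>

lemma holomorphic_zero_if_zero_on_reals:
  fixes f :: "complex \<Rightarrow> complex"
  assumes "f holomorphic_on UNIV" "\<delta> > 0" and zero: "\<And>x::real. 0 < x \<Longrightarrow> x < \<delta> \<Longrightarrow> f (of_real x) = 0"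
  shows "f w = 0"
proof (rule analytic_continuation[OF assms(1), of "of_real ` {0<..<\<delta>}" 0])
  show "(0::complex) islimpt of_real ` {0<..<\<delta>}"
    unfolding islimpt_approachable
  proof (intro allI impI)
    fix r :: real assume "r > 0"
    then show "\<exists>x'\<in>complex_of_real ` {0<..<\<delta>}. x' \<noteq> 0 \<and> dist x' 0 < r"
      using assms(2) by (intro bexI[OF _ imageI[of "min r \<delta> / 2"]]) (auto simp: min_def)
  qed
qed (use zero in auto)

definition antipode_defect :: "complex \<Rightarrow> complex \<Rightarrow> complex \<Rightarrow> complex \<Rightarrow> complex \<Rightarrow> complex \<Rightarrow> complex \<Rightarrow> complex" where
  "antipode_defect a b c d e f g = sin (of_real pi * (1 + f - g)) * L_reg a b c d e f g -
    sin (of_real pi * e) * L_reg (f - b) (f - a) (f - d) (f - c) (1 + f - g) f (1 + f - e)"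

lemma antipode_defect_holomorphic:
  assumes hol: "a holomorphic_on UNIV" "b holomorphic_on UNIV" "c holomorphic_on UNIV" "d holomorphic_on UNIV"
      "e holomorphic_on UNIV" "f holomorphic_on UNIV" "g holomorphic_on UNIV"
    and sum: "\<And>z. e z + f z + g z - a z - b z - c z - d z = 1"
  shows "(\<lambda>z. antipode_defect (a z) (b z) (c z) (d z) (e z) (f z) (g z)) holomorphic_on UNIV"
proof -
  have sum': "(1 + f z - g z) + f z + (1 + f z - e z) - (f z - b z) - (f z - a z) - (f z - d z) - (f z - c z) = 1" for z
    using sum[of z] by (simp add: algebra_simps)
  show ?thesis unfolding antipode_defect_def
    by (intro holomorphic_intros L_reg_holomorphic hol sum sum')
qed

text \<open>The complex line from the centre of the region (\<open>w = 0\<close>) to the given point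
  (\<open>w = 1\<close>) stays in \<open>V\<close>, and its points with small real \<open>w\<close>
  lie in \<open>swap_region\<close>, where the defect vanishes.\<close>

lemma antipode_defect_real:
  fixes a b c d e f g :: real
  assumes S: "e + f + g - a - b - c - d = 1"
  shows "antipode_defect a b c d e f g = 0"
proof -
  \<comment> \<open>Bounds all coordinate displacements, so that \<open>x < 1 / (100 * N)\<close>
    moves each coordinate by less than \<open>1 / 100\<close>.\<close>
  define N where "N = 1 + \<bar>a - 1/2\<bar> + \<bar>b - 1/2\<bar> + \<bar>c - 1/2\<bar> + \<bar>d - 11/20\<bar> + \<bar>e - 6/5\<bar> + \<bar>f - 19/20\<bar> + \<bar>g - 9/10\<bar>"
  have N: "N \<ge> 1" "\<bar>a - 1/2\<bar> \<le> N" "\<bar>b - 1/2\<bar> \<le> N" "\<bar>c - 1/2\<bar> \<le> N" "\<bar>d - 11/20\<bar> \<le> N" "\<bar>e - 6/5\<bar> \<le> N"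
    "\<bar>f - 19/20\<bar> \<le> N" "\<bar>g - 9/10\<bar> \<le> N"
    unfolding N_def by simp_all
  let ?h = "\<lambda>y z w. complex_of_real y + w * of_real (z - y)"
  let ?F = "\<lambda>w. antipode_defect (?h (1/2) a w) (?h (1/2) b w) (?h (1/2) c w) (?h (11/20) d w) (?h (6/5) e w) (?h (19/20) f w) (?h (9/10) g w)"
  have S': "complex_of_real e + of_real f + of_real g = of_real a + of_real b + of_real c + of_real d + 1"
    using S by (metis (no_types) add_diff_eq diff_add_cancel diff_diff_add of_real_1 of_real_add add.commute)
  have sum: "?h (6/5) e w + ?h (19/20) f w + ?h (9/10) g w - ?h (1/2) a w - ?h (1/2) b w - ?h (1/2) c w - ?h (11/20) d w = 1" for w
  proof -
    have "?h (6/5) e w + ?h (19/20) f w + ?h (9/10) g w - ?h (1/2) a w - ?h (1/2) b w - ?h (1/2) c w - ?h (11/20) d w =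
      1 + w * ((complex_of_real e + of_real f + of_real g) - (of_real a + of_real b + of_real c + of_real d + 1))"
      by (simp add: algebra_simps)
    then show ?thesis unfolding S' by simp
  qed
  have hol: "?F holomorphic_on UNIV"
    by (intro antipode_defect_holomorphic holomorphic_intros sum)
  have "?F 1 = 0"
  proof (rule holomorphic_zero_if_zero_on_reals[OF hol])
    show "1 / (100 * N) > 0" using N(1) by simp
    fix x :: real assume x: "0 < x" "x < 1 / (100 * N)"
    have small: "\<bar>x * t\<bar> < 1 / 100" if "\<bar>t\<bar> \<le> N" for t
    proof -
      have "\<bar>x * t\<bar> \<le> x * N" using that x by (simp add: abs_mult mult_left_mono)
      also have "x * N < 1 / 100" using x N(1) by (simp add: field_simps)
      finally show ?thesis .
    qed
    let ?r = "\<lambda>y z. y + x * (z - y)"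
    have h: "?h y z (of_real x) = of_real (?r y z)" for y z by simp
    have "swap_region (?r (1/2) a) (?r (1/2) b) (?r (1/2) c) (?r (11/20) d) (?r (6/5) e) (?r (19/20) f) (?r (9/10) g)"
    proof -
      have b: "\<bar>x * (a - 1/2)\<bar> < 1/100" "\<bar>x * (b - 1/2)\<bar> < 1/100" "\<bar>x * (c - 1/2)\<bar> < 1/100" "\<bar>x * (d - 11/20)\<bar> < 1/100"
        "\<bar>x * (e - 6/5)\<bar> < 1/100" "\<bar>x * (f - 19/20)\<bar> < 1/100" "\<bar>x * (g - 9/10)\<bar> < 1/100"
        by (rule small[OF N(2)] small[OF N(3)] small[OF N(4)] small[OF N(5)] small[OF N(6)] small[OF N(7)] small[OF N(8)])+
      have s: "x * (e - 6/5) + x * (f - 19/20) + x * (g - 9/10) - x * (a - 1/2) - x * (b - 1/2) - x * (c - 1/2) - x * (d - 11/20) = 0"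
      proof -
        have "x * (e - 6/5) + x * (f - 19/20) + x * (g - 9/10) - x * (a - 1/2) - x * (b - 1/2) - x * (c - 1/2) - x * (d - 11/20) =
          x * ((e + f + g - a - b - c - d) - 1)" by (simp add: algebra_simps)
        then show ?thesis unfolding S by simp
      qed
      \<comment> \<open>The region contains all points of \<open>V\<close> within
        \<open>1 / 100\<close> of the centre in every coordinate.\<close>
      have "swap_region (1/2 + a') (1/2 + b') (1/2 + c') (11/20 + d') (6/5 + e') (19/20 + f') (9/10 + g')"
        if "\<bar>a'\<bar> < 1/100" "\<bar>b'\<bar> < 1/100" "\<bar>c'\<bar> < 1/100" "\<bar>d'\<bar> < 1/100"
          "\<bar>e'\<bar> < 1/100" "\<bar>f'\<bar> < 1/100" "\<bar>g'\<bar> < 1/100"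
          and "e' + f' + g' - a' - b' - c' - d' = 0" for a' b' c' d' e' f' g' :: real
        using that unfolding swap_region_def abs_less_iff
        by (simp only: ball_simps simp_thms) (intro conjI; linarith)
      from this[OF b s] show ?thesis .
    qed
    from L_reg_antipode_region[OF this] show "?F (of_real x) = 0"
      unfolding antipode_defect_def h by simp
  qed
  then show ?thesis by simp
qed

text \<open>On the line \<open>Re + w * Im\<close> real \<open>w\<close> give real parameters, where
  the identity is known, and \<open>w = \<i>\<close> gives the original point.\<close>

theorem L_reg_antipode:
  assumes S: "e + f + g - a - b - c - d = 1"
  shows "sin (of_real pi * (1 + f - g)) * L_reg a b c d e f g =
    sin (of_real pi * e) * L_reg (f - b) (f - a) (f - d) (f - c) (1 + f - g) f (1 + f - e)"
proof -
  let ?h = "\<lambda>x w. complex_of_real (Re x) + w * of_real (Im x)"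
  let ?F = "\<lambda>w. antipode_defect (?h a w) (?h b w) (?h c w) (?h d w) (?h e w) (?h f w) (?h g w)"
  have R: "Re e + Re f + Re g - Re a - Re b - Re c - Re d = 1" and I: "Im e + Im f + Im g - Im a - Im b - Im c - Im d = 0"
    using arg_cong[OF S, of Re] arg_cong[OF S, of Im] by simp_all
  have sum: "?h e w + ?h f w + ?h g w - ?h a w - ?h b w - ?h c w - ?h d w = 1" for w
  proof -
    have "?h e w + ?h f w + ?h g w - ?h a w - ?h b w - ?h c w - ?h d w =
       of_real (Re e + Re f + Re g - Re a - Re b - Re c - Re d) + w * of_real (Im e + Im f + Im g - Im a - Im b - Im c - Im d)"
      by (simp add: algebra_simps)
    then show ?thesis unfolding R I by simp
  qed
  have hol: "?F holomorphic_on UNIV"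
    by (intro antipode_defect_holomorphic holomorphic_intros sum)
  have "?F \<i> = 0"
  proof (rule holomorphic_zero_if_zero_on_reals[OF hol])
    fix x :: real
    let ?r = "\<lambda>z. Re z + x * Im z"
    have h: "?h z (of_real x) = of_real (?r z)" for z by simp
    have "?r e + ?r f + ?r g - ?r a - ?r b - ?r c - ?r d =
       (Re e + Re f + Re g - Re a - Re b - Re c - Re d) + x * (Im e + Im f + Im g - Im a - Im b - Im c - Im d)"
      by (simp add: algebra_simps)
    then have "?r e + ?r f + ?r g - ?r a - ?r b - ?r c - ?r d = 1" unfolding R I by simp
    from antipode_defect_real[OF this] show "?F (of_real x) = 0" unfolding h .
  qed (rule zero_less_one)
  moreover have "?h z \<i> = z" for z by (simp add: complex_eq [symmetric])
  ultimately show ?thesis by (simp add: antipode_defect_def)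
qed

section \<open>The bilateral series\<close>

text \<open>The function \<open>u\<close> of the overview is the case \<open>p = 1\<close>. With a
  free \<open>p\<close> the family is closed under reflection and under shifts of the argument,
  which reduces all evaluation points to 0.\<close>

definition bilateral_term :: "complex \<Rightarrow> complex \<Rightarrow> complex \<Rightarrow> complex \<Rightarrow> complex \<Rightarrow> complex \<Rightarrow> complex \<Rightarrow> complex \<Rightarrow> complex \<Rightarrow> complex" where
  "bilateral_term p q r s a b c d t = rGamma (p + t) * rGamma (q + t) * rGamma (r + t) * rGamma (s + t) *
     rGamma (1 - a - t) * rGamma (1 - b - t) * rGamma (1 - c - t) * rGamma (1 - d - t)"

lemma bilateral_term_reflect:
  "bilateral_term p q r s a b c d t = bilateral_term (1 - a) (1 - b) (1 - c) (1 - d) (1 - p) (1 - q) (1 - r) (1 - s) (- t)"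
  by (simp add: bilateral_term_def)

lemma bilateral_term_plus1:
  "bilateral_term p q r s a b c d (t + 1) * ((p + t) * (q + t) * (r + t) * (s + t)) =
   bilateral_term p q r s a b c d t * ((a + t) * (b + t) * (c + t) * (d + t))"
proof -
  have 1: "rGamma (x + t) = (x + t) * rGamma (x + (t + 1))" for x
    using rGamma_plus1[of "x + t"] by (simp add: add.assoc)
  have 2: "rGamma (1 - x - (t + 1)) = - ((x + t) * rGamma (1 - x - t))" for x
  proof -
    have e: "1 - x - (t + 1) = - x - t" "- x - t + 1 = 1 - x - t" "- (x + t) = - x - t" by simp_all
    show ?thesis using rGamma_plus1[of "- x - t"] unfolding e(1,2) by (simp add: e(3) [symmetric] del: minus_add_distrib minus_diff_eq)
  qed
  show ?thesis unfolding bilateral_term_def 2 1 by (simp add: mult_ac)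
qed

lemma holomorphic_bilateral_term [holomorphic_intros]:
  fixes A :: "complex set"
  assumes "p holomorphic_on A" "q holomorphic_on A" "r holomorphic_on A" "s holomorphic_on A"
    "a holomorphic_on A" "b holomorphic_on A" "c holomorphic_on A" "d holomorphic_on A" "t holomorphic_on A"
  shows "(\<lambda>z. bilateral_term (p z) (q z) (r z) (s z) (a z) (b z) (c z) (d z) (t z)) holomorphic_on A"
  unfolding bilateral_term_def by (intro holomorphic_intros assms)

lemma
  assumes sum: "p + q + r + s - a - b - c - d = 2"
  shows bilateral_term_series_holomorphic: "(\<lambda>z. \<Sum>k. bilateral_term p q r s a b c d (z + of_nat k)) holomorphic_on UNIV"
    and bilateral_term_series_summable: "summable (\<lambda>k. bilateral_term p q r s a b c d (z + of_nat k))"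
proof -
  have hol: "(\<lambda>z. bilateral_term p q r s a b c d (z + of_nat k)) holomorphic_on UNIV" for k
    by (intro holomorphic_intros)
  have rec: "bilateral_term p q r s a b c d (z + of_nat (Suc k)) *
       ((p + z + of_nat k) * (q + z + of_nat k) * (r + z + of_nat k) * (s + z + of_nat k)) =
     bilateral_term p q r s a b c d (z + of_nat k) *
       ((a + z + of_nat k) * (b + z + of_nat k) * (c + z + of_nat k) * (d + z + of_nat k))" for k z
    using bilateral_term_plus1[of p q r s a b c d "z + of_nat k"] by (simp add: add_ac)
  note * = hol _ _ _ _ _ _ _ _ _ rec
  show "(\<lambda>z. \<Sum>k. bilateral_term p q r s a b c d (z + of_nat k)) holomorphic_on UNIV"
    by (rule holomorphic_hypergeometric_series[OF *]) (use sum in \<open>auto intro!: continuous_intros simp: algebra_simps\<close>)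
  show "summable (\<lambda>k. bilateral_term p q r s a b c d (z + of_nat k))"
    by (rule summable_hypergeometric_series[OF *]) (use sum in \<open>auto intro!: continuous_intros simp: algebra_simps\<close>)
qed

section \<open>Growth of the bilateral terms away from the real axis\<close>

lemma norm_sin_le_exp: "norm (sin (z :: complex)) \<le> exp \<bar>Im z\<bar>"
proof -
  have "sin z = (exp (\<i> * z) - exp (- (\<i> * z))) / (2 * \<i>)" by (rule sin_exp_eq)
  then have "norm (sin z) = norm (exp (\<i> * z) - exp (- (\<i> * z))) / 2" by (simp add: norm_divide norm_mult)
  also have "norm (exp (\<i> * z) - exp (- (\<i> * z))) \<le> norm (exp (\<i> * z)) + norm (exp (- (\<i> * z)))"
    by (rule norm_triangle_ineq4)
  also have "\<dots> = exp (- Im z) + exp (Im z)" by simp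
  also have "\<dots> \<le> 2 * exp \<bar>Im z\<bar>"
    by (cases "Im z \<ge> 0") auto
  finally show ?thesis by simp
qed

lemma prod_shift_two: "(\<Prod>k\<le>n. (t + of_nat k + 2) / (t + of_nat k)) = (t + of_nat n + 1) * (t + of_nat n + 2) / (t * (t + 1))"
  if "\<And>k. t + of_nat k \<noteq> 0" for t :: complex
proof (induction n)
  case 0
  have "t \<noteq> 0" "t + 1 \<noteq> 0" using that[of 0] that[of 1] by auto
  then show ?case by simp
next
  case (Suc n)
  have nz: "t + of_nat n + 1 \<noteq> 0" "t \<noteq> 0" "t + 1 \<noteq> 0" using that[of "Suc n"] that[of 0] that[of 1] by (auto simp: algebra_simps)
  have "(\<Prod>k\<le>Suc n. (t + of_nat k + 2) / (t + of_nat k)) =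
     (t + of_nat n + 1) * (t + of_nat n + 2) / (t * (t + 1)) * ((t + of_nat n + 3) / (t + of_nat n + 1))"
    unfolding prod.atMost_Suc Suc.IH by (simp add: algebra_simps)
  also have "\<dots> = (t + of_nat (Suc n) + 1) * (t + of_nat (Suc n) + 2) / (t * (t + 1))"
    using nz by (simp add: divide_simps) (simp add: algebra_simps)
  finally show ?case .
qed

text \<open>Works on the finite products that define \<open>rGamma\<close> instead of Stirling's
  formula. Each factor of the quotient is compared with \<open>(t + k + 2) / (t + k)\<close>, whose
  product telescopes and supplies \<open>norm t ^ 2\<close> in the denominator; the relative errors
  are summable uniformly in \<open>t\<close>.\<close>

lemma Gamma_quotient_bound:
  fixes a b c d p q r s :: complex
  assumes sum: "p + q + r + s - a - b - c - d = 2"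
  shows "\<exists>C Y. Y \<ge> 1 \<and> (\<forall>t. Re t \<ge> 0 \<longrightarrow> \<bar>Im t\<bar> \<ge> Y \<longrightarrow>
     norm (rGamma (p + t) * rGamma (q + t) * rGamma (r + t) * rGamma (s + t)) \<le>
       C * norm (rGamma (a + t) * rGamma (b + t) * rGamma (c + t) * rGamma (d + t)) / norm t ^ 2)"
proof -
  define B where "B = 1 + norm a + norm b + norm c + norm d + norm p + norm q + norm r + norm s"
  have B: "norm a \<le> B" "norm b \<le> B" "norm c \<le> B" "norm d \<le> B"
    "norm p \<le> B" "norm q \<le> B" "norm r \<le> B" "norm s \<le> B" "B \<ge> 1"
    unfolding B_def by (simp_all add: add_nonneg_nonneg)
  \<comment> \<open>With \<open>Re t \<ge> 0\<close> and \<open>\<bar>Im t\<bar> \<ge> Y\<close>,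
    every \<open>t + k\<close> exceeds the threshold \<open>2 * B + 4\<close> of
    \<open>quartic_quotient_bound\<close>.\<close>
  define Y where "Y = 2 * B + 4"
  define D where "D = 3200 * B ^ 4"
  define Z where "Z = (\<Sum>k. 1 / (1 + real k ^ 2))"
  have D: "D \<ge> 0" using B(9) by (simp add: D_def)
  have smZ: "summable (\<lambda>k. 1 / (1 + real k ^ 2))"
  proof (rule summable_comparison_test_ev)
    show "summable (\<lambda>k. inverse (real k ^ 2))" by (intro inverse_power_summable) simp
    show "\<forall>\<^sub>F k in sequentially. norm (1 / (1 + real k ^ 2)) \<le> inverse (real k ^ 2)"
      by (rule eventually_sequentiallyI[of 1]) (auto simp: inverse_eq_divide intro!: frac_le)
  qed
  let ?R = "\<lambda>p q r s t n. rGamma_series (p + t) n * rGamma_series (q + t) n * rGamma_series (r + t) n * rGamma_series (s + t) n"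
  have bound: "norm (?R p q r s t n) \<le> norm (?R a b c d t n) * (norm ((t + of_nat n + 1) * (t + of_nat n + 2)) / real n ^ 2) / (norm t * norm (t + 1)) * exp (D * Z)"
    if t: "Re t \<ge> 0" "\<bar>Im t\<bar> \<ge> Y" and n: "n \<ge> 1" for t n
  proof -
    have big: "norm (t + of_nat k) \<ge> Y" for k
      using abs_Im_le_cmod[of "t + of_nat k"] t by simp
    have Y1: "Y > 0" using B(9) by (simp add: Y_def)
    have nz: "t + of_nat k \<noteq> 0" for k using big[of k] Y1 by auto
    have anz: "x + (t + of_nat k) \<noteq> 0" if "norm x \<le> B" for x k
    proof -
      have "norm (x + (t + of_nat k)) \<ge> norm (t + of_nat k) / 2"
        by (rule norm_add_ge_half[OF that]) (use big[of k] in \<open>simp add: Y_def\<close>)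
      then show ?thesis using big[of k] Y1 by auto
    qed
    let ?A = "\<lambda>k. (a + (t + of_nat k)) * (b + (t + of_nat k)) * (c + (t + of_nat k)) * (d + (t + of_nat k))"
    let ?P = "\<lambda>k. (p + (t + of_nat k)) * (q + (t + of_nat k)) * (r + (t + of_nat k)) * (s + (t + of_nat k))"
    have poch: "pochhammer (x + t) (n + 1) = (\<Prod>k\<le>n. x + (t + of_nat k))" for x
      by (simp add: pochhammer_prod atLeast0AtMost atLeastLessThanSuc_atLeastAtMost add_ac)
    have Anz: "?A k \<noteq> 0" for k using anz B by simp
    have Pn: "(\<Prod>k\<le>n. ?P k) = (\<Prod>k\<le>n. ?A k) * (\<Prod>k\<le>n. ?P k / ?A k)"
      unfolding prod.distrib[symmetric] using Anz by (intro prod.cong) auto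
    have series: "?R x1 x2 x3 x4 t n = (\<Prod>k\<le>n. (x1 + (t + of_nat k)) * (x2 + (t + of_nat k)) * (x3 + (t + of_nat k)) * (x4 + (t + of_nat k)))
        / (fact n ^ 4 * exp ((x1 + x2 + x3 + x4 + 4 * t) * of_real (ln (of_nat n))))" for x1 x2 x3 x4
      unfolding rGamma_series_def poch prod.distrib
      by (simp add: power4_eq_xxxx exp_add [symmetric] algebra_simps)
    have ps: "p + q + r + s + 4 * t = (a + b + c + d + 4 * t) + 2" using sum by (simp add: algebra_simps)
    \<comment> \<open>The excess 2 of the parameter sum yields \<open>n ^ 2\<close>, which offsets
      the growth of the telescoped numerator as \<open>n\<close> tends to infinity.\<close>
    have e2: "exp (((a + b + c + d + 4 * t) + 2) * of_real (ln (of_nat n))) =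
       exp ((a + b + c + d + 4 * t) * of_real (ln (of_nat n))) * of_nat n ^ 2"
    proof -
      have "exp (2 * complex_of_real (ln (real n))) = (exp (complex_of_real (ln (real n)))) ^ 2" by (simp add: exp_double)
      also have "exp (complex_of_real (ln (real n))) = of_nat n" using n by (simp add: exp_of_real)
      finally show ?thesis by (simp only: distrib_right exp_add)
    qed
    have eq: "?R p q r s t n = ?R a b c d t n * (\<Prod>k\<le>n. ?P k / ?A k) / of_nat n ^ 2"
      unfolding series ps e2 Pn by simp
    have "norm (\<Prod>k\<le>n. ?P k / ?A k) \<le> norm ((t + of_nat n + 1) * (t + of_nat n + 2) / (t * (t + 1))) * exp (D * Z)"
    proof -
      have 1: "norm (?P k / ?A k) \<le> norm ((t + of_nat k + 2) / (t + of_nat k)) * exp (D * (1 / (1 + real k ^ 2)))" for k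
      proof -
        have "norm (?P k / ?A k) \<le> norm ((t + of_nat k + 2) / (t + of_nat k)) * (1 + 3200 * B ^ 4 / norm (t + of_nat k) ^ 2)"
          by (rule quartic_quotient_bound(2)[OF B sum]) (use big[of k] in \<open>simp add: Y_def\<close>)
        also have "1 + 3200 * B ^ 4 / norm (t + of_nat k) ^ 2 \<le> exp (D * (1 / (1 + real k ^ 2)))"
        proof -
          have "1 + real k ^ 2 \<le> norm (t + of_nat k) ^ 2"
          proof -
            have "norm (t + of_nat k) ^ 2 = (Re t + real k) ^ 2 + Im t ^ 2" by (simp add: cmod_power2)
            moreover have "real k ^ 2 \<le> (Re t + real k) ^ 2" using t by (intro power_mono) auto
            moreover have "1 \<le> Im t ^ 2"
              using one_le_power[of "\<bar>Im t\<bar>" 2] t(2) B(9) by (simp add: Y_def)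
            ultimately show ?thesis by linarith
          qed
          then have "D / norm (t + of_nat k) ^ 2 \<le> D / (1 + real k ^ 2)"
            using D by (intro frac_le) (auto intro: add_pos_nonneg)
          then have "1 + D / norm (t + of_nat k) ^ 2 \<le> 1 + D * (1 / (1 + real k ^ 2))" by simp
          also have "\<dots> \<le> exp (D * (1 / (1 + real k ^ 2)))" by (rule exp_ge_add_one_self)
          finally show ?thesis by (simp add: D_def)
        qed
        finally show ?thesis by (simp add: mult_left_mono)
      qed
      have "norm (\<Prod>k\<le>n. ?P k / ?A k) \<le> (\<Prod>k\<le>n. norm ((t + of_nat k + 2) / (t + of_nat k)) * exp (D * (1 / (1 + real k ^ 2))))"
        unfolding prod_norm [symmetric] by (intro prod_mono conjI 1 norm_ge_zero)
      also have "\<dots> = norm (\<Prod>k\<le>n. (t + of_nat k + 2) / (t + of_nat k)) * exp (D * (\<Sum>k\<le>n. 1 / (1 + real k ^ 2)))"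
        by (simp add: prod.distrib prod_norm exp_sum sum_distrib_left)
      also have "(\<Prod>k\<le>n. (t + of_nat k + 2) / (t + of_nat k)) = (t + of_nat n + 1) * (t + of_nat n + 2) / (t * (t + 1))"
        by (rule prod_shift_two) (rule nz)
      also have "exp (D * (\<Sum>k\<le>n. 1 / (1 + real k ^ 2))) \<le> exp (D * Z)"
        unfolding Z_def using D by (auto intro!: mult_left_mono sum_le_suminf smZ)
      finally show ?thesis by (simp add: mult_left_mono)
    qed
    then have "norm (?R p q r s t n) \<le> norm (?R a b c d t n) * (norm ((t + of_nat n + 1) * (t + of_nat n + 2) / (t * (t + 1))) * exp (D * Z)) / real n ^ 2"
      unfolding eq norm_divide norm_mult [of _ "prod _ _"] norm_power norm_of_nat by (intro divide_right_mono mult_left_mono) auto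
    then show ?thesis by (simp add: norm_divide norm_mult mult_ac)
  qed
  have fin: "norm (rGamma (p + t) * rGamma (q + t) * rGamma (r + t) * rGamma (s + t)) \<le>
       exp (D * Z) * norm (rGamma (a + t) * rGamma (b + t) * rGamma (c + t) * rGamma (d + t)) / norm t ^ 2"
    if t: "Re t \<ge> 0" "\<bar>Im t\<bar> \<ge> Y" for t
  proof -
    let ?G = "\<lambda>p q r s. rGamma (p + t) * rGamma (q + t) * rGamma (r + t) * rGamma (s + t)"
    have l: "(\<lambda>n. norm (?R x y z w t n)) \<longlonglongrightarrow> norm (?G x y z w)" for x y z w
      by (intro tendsto_intros)
    have quot: "(\<lambda>n. norm ((t + of_nat n + 1) * (t + of_nat n + 2)) / real n ^ 2) \<longlonglongrightarrow> 1"
    proof -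
      have z: "(\<lambda>n. x / of_nat n :: complex) \<longlonglongrightarrow> 0" for x by (rule lim_const_over_n)
      have "(\<lambda>n. norm ((1 + (t + 1) / of_nat n) * (1 + (t + 2) / of_nat n))) \<longlonglongrightarrow> norm ((1 + 0) * (1 + 0) :: complex)"
        by (intro tendsto_intros z)
      then have "(\<lambda>n. norm ((1 + (t + 1) / of_nat n) * (1 + (t + 2) / of_nat n))) \<longlonglongrightarrow> 1" by simp
      then show ?thesis
      proof (rule Lim_transform_eventually, intro eventually_sequentiallyI[of 1])
        fix n :: nat assume n: "n \<ge> 1"
        have "(1 + (t + 1) / of_nat n) * (1 + (t + 2) / of_nat n) = (t + of_nat n + 1) * (t + of_nat n + 2) / of_nat n ^ 2"
          using n by (simp add: field_simps power2_eq_square)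
        then show "norm ((1 + (t + 1) / of_nat n) * (1 + (t + 2) / of_nat n)) = norm ((t + of_nat n + 1) * (t + of_nat n + 2)) / real n ^ 2"
          by (simp add: norm_divide norm_power)
      qed
    qed
    have "norm (?G p q r s) \<le> norm (?G a b c d) * 1 / (norm t * norm (t + 1)) * exp (D * Z)"
    proof (rule tendsto_le[OF sequentially_bot _ l])
      show "(\<lambda>n. norm (?R a b c d t n) * (norm ((t + of_nat n + 1) * (t + of_nat n + 2)) / real n ^ 2) / (norm t * norm (t + 1)) * exp (D * Z))
        \<longlonglongrightarrow> norm (?G a b c d) * 1 / (norm t * norm (t + 1)) * exp (D * Z)"
      proof (intro tendsto_mult tendsto_divide l quot tendsto_const)
        have "t \<noteq> 0" "t + 1 \<noteq> 0" using t B(9) by (auto simp: Y_def complex_eq_iff)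
        then show "norm t * norm (t + 1) \<noteq> 0" by simp
      qed
      show "\<forall>\<^sub>F n in sequentially. norm (?R p q r s t n) \<le> norm (?R a b c d t n) * (norm ((t + of_nat n + 1) * (t + of_nat n + 2)) / real n ^ 2) / (norm t * norm (t + 1)) * exp (D * Z)"
        by (rule eventually_sequentiallyI[of 1]) (rule bound[OF t])
    qed
    also have "\<dots> \<le> norm (?G a b c d) * 1 / (norm t * norm t) * exp (D * Z)"
    proof -
      have "norm t \<le> norm (t + 1)" using t(1) unfolding cmod_def
        by (intro real_sqrt_le_mono add_mono) (auto intro: power_mono)
      moreover have "norm t > 0" using t B(9) by (auto simp: Y_def)
      ultimately show ?thesis
        by (intro mult_right_mono divide_left_mono mult_left_mono mult_pos_pos) auto
    qed
    finally show ?thesis by (simp add: power2_eq_square mult_ac)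
  qed
  have "Y \<ge> 1" using B(9) by (simp add: Y_def)
  with fin show ?thesis by blast
qed

text \<open>\<open>Gamma_quotient_bound\<close> replaces \<open>p, q, r, s\<close> by
  \<open>a, b, c, d\<close> and gains \<open>norm t ^ 2\<close>. The eight factors then form four
  pairs \<open>rGamma (x + t) * rGamma (1 - x - t)\<close>, each a sine of size at most a constant
  times \<open>exp (pi * \<bar>Im t\<bar>)\<close>.\<close>

lemma bilateral_term_bound_right:
  assumes sum: "p + q + r + s - a - b - c - d = 2"
  shows "\<exists>C Y. C \<ge> 0 \<and> Y \<ge> 1 \<and> (\<forall>t. Re t \<ge> 0 \<longrightarrow> \<bar>Im t\<bar> \<ge> Y \<longrightarrow>
     norm (bilateral_term p q r s a b c d t) \<le> C * exp (4 * pi * \<bar>Im t\<bar>) / norm t ^ 2)"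
proof -
  obtain C Y where CY: "Y \<ge> 1" "\<And>t. Re t \<ge> 0 \<Longrightarrow> \<bar>Im t\<bar> \<ge> Y \<Longrightarrow>
     norm (rGamma (p + t) * rGamma (q + t) * rGamma (r + t) * rGamma (s + t)) \<le>
       C * norm (rGamma (a + t) * rGamma (b + t) * rGamma (c + t) * rGamma (d + t)) / norm t ^ 2"
    using Gamma_quotient_bound[OF sum] by blast
  define M where "M = exp (pi * norm a) * exp (pi * norm b) * exp (pi * norm c) * exp (pi * norm d) / pi ^ 4"
  have refl: "norm (rGamma (x + t) * rGamma (1 - x - t)) \<le> exp (pi * norm x) * exp (pi * \<bar>Im t\<bar>) / pi" for x t :: complex
  proof -
    have "rGamma (x + t) * rGamma (1 - x - t) = sin (of_real pi * (x + t)) / of_real pi"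
      using rGamma_reflection_complex[of "x + t"] by (simp add: diff_diff_add)
    then have "norm (rGamma (x + t) * rGamma (1 - x - t)) = norm (sin (of_real pi * (x + t))) / pi" by (simp add: norm_divide)
    also have "\<dots> \<le> exp \<bar>Im (of_real pi * (x + t))\<bar> / pi" by (intro divide_right_mono norm_sin_le_exp) auto
    also have "\<bar>Im (of_real pi * (x + t))\<bar> \<le> pi * norm x + pi * \<bar>Im t\<bar>"
    proof -
      have "\<bar>Im (of_real pi * (x + t))\<bar> = pi * \<bar>Im x + Im t\<bar>" by (simp add: abs_mult)
      also have "\<dots> \<le> pi * (norm x + \<bar>Im t\<bar>)"
        using abs_Im_le_cmod[of x] by (intro mult_left_mono) auto
      finally show ?thesis by (simp add: distrib_left)
    qed
    finally show ?thesis by (simp add: exp_add divide_right_mono)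
  qed
  have "norm (bilateral_term p q r s a b c d t) \<le> \<bar>C\<bar> * M * exp (4 * pi * \<bar>Im t\<bar>) / norm t ^ 2"
    if t: "Re t \<ge> 0" "\<bar>Im t\<bar> \<ge> Y" for t
  proof -
    let ?n = "\<lambda>x. norm (rGamma (x + t) * rGamma (1 - x - t))"
    have "norm (bilateral_term p q r s a b c d t) = norm (rGamma (p + t) * rGamma (q + t) * rGamma (r + t) * rGamma (s + t)) *
      norm (rGamma (1 - a - t) * rGamma (1 - b - t) * rGamma (1 - c - t) * rGamma (1 - d - t))"
      by (simp add: bilateral_term_def norm_mult mult_ac)
    also have "\<dots> \<le> (C * norm (rGamma (a + t) * rGamma (b + t) * rGamma (c + t) * rGamma (d + t)) / norm t ^ 2) *
      norm (rGamma (1 - a - t) * rGamma (1 - b - t) * rGamma (1 - c - t) * rGamma (1 - d - t))"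
      by (intro mult_right_mono CY(2) t) auto
    also have "\<dots> = C * (?n a * ?n b * ?n c * ?n d) / norm t ^ 2" by (simp add: norm_mult mult_ac)
    also have "\<dots> \<le> \<bar>C\<bar> * ((exp (pi * norm a) * exp (pi * \<bar>Im t\<bar>) / pi) * (exp (pi * norm b) * exp (pi * \<bar>Im t\<bar>) / pi) *
        (exp (pi * norm c) * exp (pi * \<bar>Im t\<bar>) / pi) * (exp (pi * norm d) * exp (pi * \<bar>Im t\<bar>) / pi)) / norm t ^ 2"
      by (intro divide_right_mono mult_mono refl) auto
    also have "\<dots> = \<bar>C\<bar> * M * exp (4 * pi * \<bar>Im t\<bar>) / norm t ^ 2"
    proof -
      have "exp (4 * pi * \<bar>Im t\<bar>) = exp (pi * \<bar>Im t\<bar>) * exp (pi * \<bar>Im t\<bar>) * exp (pi * \<bar>Im t\<bar>) * exp (pi * \<bar>Im t\<bar>)"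
        by (simp add: exp_add [symmetric])
      then show ?thesis by (simp add: M_def power4_eq_xxxx mult_ac)
    qed
    finally show ?thesis .
  qed
  moreover have "\<bar>C\<bar> * M \<ge> 0" by (simp add: M_def)
  ultimately show ?thesis using CY(1) by blast
qed

text \<open>The sum over all integers in two halves; the \<open>- 1\<close> keeps the central term
  from being counted twice.\<close>

definition bilateral_series :: "complex \<Rightarrow> complex \<Rightarrow> complex \<Rightarrow> complex \<Rightarrow> complex \<Rightarrow> complex \<Rightarrow> complex \<Rightarrow> complex \<Rightarrow> complex \<Rightarrow> complex" where
  "bilateral_series p q r s a b c d z = (\<Sum>k. bilateral_term p q r s a b c d (z + of_nat k)) + (\<Sum>k. bilateral_term p q r s a b c d (z - 1 - of_nat k))"

context
  fixes p q r s a b c d :: complex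
  assumes sum: "p + q + r + s - a - b - c - d = 2"
begin

private abbreviation "U \<equiv> bilateral_term p q r s a b c d"
private abbreviation "E \<equiv> bilateral_series p q r s a b c d"

text \<open>Makes the negative half a one-sided series of the same kind in \<open>1 - z\<close>, to
  which the results for the right half-plane apply.\<close>

lemma bilateral_term_left: "U (z - 1 - of_nat k) =
    bilateral_term (1 - a) (1 - b) (1 - c) (1 - d) (1 - p) (1 - q) (1 - r) (1 - s) ((1 - z) + of_nat k)"
  by (subst bilateral_term_reflect) (simp add: algebra_simps)

lemma sum_params_left: "(1 - a) + (1 - b) + (1 - c) + (1 - d) - (1 - p) - (1 - q) - (1 - r) - (1 - s) = 2"
  using sum by (simp add: algebra_simps)

lemma summable_bilateral_term: "summable (\<lambda>k. U (z + of_nat k))" "summable (\<lambda>k. U (z - 1 - of_nat k))"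
  unfolding bilateral_term_left by (intro bilateral_term_series_summable sum sum_params_left)+

lemma holomorphic_bilateral_series: "E holomorphic_on UNIV"
proof -
  let ?L = "\<lambda>z. \<Sum>k. bilateral_term (1 - a) (1 - b) (1 - c) (1 - d) (1 - p) (1 - q) (1 - r) (1 - s) (z + of_nat k)"
  have "(?L \<circ> (\<lambda>z. 1 - z)) holomorphic_on UNIV"
    by (rule holomorphic_on_compose_gen[OF _ bilateral_term_series_holomorphic[OF sum_params_left]]) (auto intro!: holomorphic_intros)
  then have "(\<lambda>z. \<Sum>k. U (z - 1 - of_nat k)) holomorphic_on UNIV" unfolding bilateral_term_left o_def .
  then show ?thesis
    unfolding bilateral_series_def by (intro holomorphic_on_add bilateral_term_series_holomorphic[OF sum])
qed

lemma bilateral_series_plus1: "E (z + 1) = E z"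
proof -
  have 1: "(\<Sum>k. U (z + of_nat k)) = (\<Sum>k. U (z + 1 + of_nat k)) + U z"
    using suminf_split_initial_segment[OF summable_bilateral_term(1), of z 1] by (simp add: add_ac)
  have 2: "(\<Sum>k. U (z + 1 - 1 - of_nat k)) = (\<Sum>k. U (z - 1 - of_nat k)) + U z"
    using suminf_split_initial_segment[OF summable_bilateral_term(2), of "z + 1" 1] by (simp add: algebra_simps)
  show ?thesis unfolding bilateral_series_def 1 2 by simp
qed

lemma bilateral_series_plus_of_nat: "E (z + of_nat n) = E z"
proof (induction n)
  case (Suc n)
  have "E (z + of_nat (Suc n)) = E ((z + of_nat n) + 1)" by (simp add: add_ac)
  then show ?case unfolding bilateral_series_plus1 Suc .
qed simp

lemma bilateral_series_plus_of_int: "E (z + of_int n) = E z"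
proof (cases "n \<ge> 0")
  case True
  then show ?thesis using bilateral_series_plus_of_nat[of z "nat n"] by simp
next
  case False
  then show ?thesis using bilateral_series_plus_of_nat[of "z + of_int n" "nat (- n)"] by simp
qed

text \<open>In the strip \<open>0 \<le> Re z \<le> 1\<close> both \<open>z + k\<close> and
  \<open>1 - z + k\<close> have nonnegative real part, so the one-sided bound applies to each half;
  periodicity carries the estimate to all \<open>z\<close>.\<close>

lemma bilateral_series_growth: "\<exists>C Y h. C \<ge> 0 \<and> (h \<longlongrightarrow> 0) at_top \<and>
    (\<forall>z. \<bar>Im z\<bar> \<ge> Y \<longrightarrow> norm (E z) \<le> C * exp (4 * pi * \<bar>Im z\<bar>) * h \<bar>Im z\<bar>)"
proof -
  obtain C1 Y1 where 1: "C1 \<ge> 0" "Y1 \<ge> 1" "\<And>t. Re t \<ge> 0 \<Longrightarrow> \<bar>Im t\<bar> \<ge> Y1 \<Longrightarrow>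
     norm (U t) \<le> C1 * exp (4 * pi * \<bar>Im t\<bar>) / norm t ^ 2"
    using bilateral_term_bound_right[OF sum] by blast
  obtain C2 Y2 where 2: "C2 \<ge> 0" "Y2 \<ge> 1" "\<And>t. Re t \<ge> 0 \<Longrightarrow> \<bar>Im t\<bar> \<ge> Y2 \<Longrightarrow>
     norm (bilateral_term (1 - a) (1 - b) (1 - c) (1 - d) (1 - p) (1 - q) (1 - r) (1 - s) t) \<le> C2 * exp (4 * pi * \<bar>Im t\<bar>) / norm t ^ 2"
    using bilateral_term_bound_right[OF sum_params_left] by blast
  \<comment> \<open>Majorises the sum of \<open>1 / norm (z + k) ^ 2\<close> independently of
    \<open>Re z\<close>. Its decay is the little o that later excludes the modes of order 2.\<close>
  define h where "h = (\<lambda>y::real. \<Sum>k. 1 / (y ^ 2 + real k ^ 2))"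
  define Y where "Y = max Y1 Y2"
  have sm1: "summable (\<lambda>k. 1 / (1 + real k ^ 2))"
  proof (rule summable_comparison_test_ev)
    show "summable (\<lambda>k. inverse (real k ^ 2))" by (intro inverse_power_summable) simp
    show "\<forall>\<^sub>F k in sequentially. norm (1 / (1 + real k ^ 2)) \<le> inverse (real k ^ 2)"
      by (rule eventually_sequentiallyI[of 1]) (auto simp: inverse_eq_divide intro!: frac_le)
  qed
  have le1: "1 / (y ^ 2 + real k ^ 2) \<le> 1 / (1 + real k ^ 2)" if "y \<ge> 1" for y k
    using one_le_power[OF that, of 2] by (intro frac_le) (auto intro: add_pos_nonneg)
  have smy: "summable (\<lambda>k. 1 / (y ^ 2 + real k ^ 2))" if "y \<ge> 1" for y
    by (rule summable_comparison_test'[OF sm1]) (use le1[OF that] in auto)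
  have lim: "(h \<longlongrightarrow> 0) at_top"
  proof -
    have "((\<lambda>y. \<Sum>k. 1 / (y ^ 2 + real k ^ 2)) \<longlongrightarrow> (\<Sum>k. 0::real)) at_top"
    proof (rule tannerys_theorem[THEN conjunct2, THEN conjunct2])
      show "((\<lambda>y. 1 / (y ^ 2 + real k ^ 2)) \<longlongrightarrow> 0) at_top" for k
        by real_asymp
      show "\<forall>\<^sub>F (k, y) in at_top \<times>\<^sub>F at_top. norm (1 / (y ^ 2 + real k ^ 2)) \<le> 1 / (1 + real k ^ 2)"
        unfolding eventually_prod_filter
        by (intro exI[of _ "\<lambda>_. True"] exI[of _ "\<lambda>y. y \<ge> 1"]) (auto intro: le1 eventually_ge_at_top)
      show "summable (\<lambda>k. 1 / (1 + real k ^ 2))" by (rule sm1)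
    qed simp
    then show ?thesis by (simp add: h_def)
  qed
  have bound0: "norm (E z) \<le> (C1 + C2) * exp (4 * pi * \<bar>Im z\<bar>) * h \<bar>Im z\<bar>"
    if z: "0 \<le> Re z" "Re z \<le> 1" "\<bar>Im z\<bar> \<ge> Y" for z
  proof -
    let ?e = "exp (4 * pi * \<bar>Im z\<bar>)"
    have y1: "\<bar>Im z\<bar> \<ge> 1" using z(3) 1(2) by (simp add: Y_def)
    have pos: "\<bar>Im z\<bar> ^ 2 + real k ^ 2 > 0" for k using y1 by (intro add_pos_nonneg) auto
    have sum_bound: "norm (\<Sum>k. u k) \<le> C * ?e * h \<bar>Im z\<bar>"
      if u: "\<And>k. norm (u k) \<le> C * ?e * (1 / (\<bar>Im z\<bar> ^ 2 + real k ^ 2))" for u :: "nat \<Rightarrow> complex" and C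
    proof -
      have "norm (\<Sum>k. u k) \<le> (\<Sum>k. C * ?e * (1 / (\<bar>Im z\<bar> ^ 2 + real k ^ 2)))"
        by (rule norm_suminf_le[OF u]) (intro summable_mult smy y1)
      also have "\<dots> = C * ?e * h \<bar>Im z\<bar>" unfolding h_def by (rule suminf_mult) (rule smy[OF y1])
      finally show ?thesis .
    qed
    have nt: "\<bar>Im z\<bar> ^ 2 + real k ^ 2 \<le> norm (w + of_nat k) ^ 2" if "Re w \<ge> 0" "Im w ^ 2 = Im z ^ 2" for w k
    proof -
      have "norm (w + of_nat k) ^ 2 = (Re w + real k) ^ 2 + Im w ^ 2" by (simp add: cmod_power2)
      moreover have "real k ^ 2 \<le> (Re w + real k) ^ 2" using that by (intro power_mono) auto
      ultimately show ?thesis using that by simp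
    qed
    have "norm (\<Sum>k. U (z + of_nat k)) \<le> C1 * ?e * h \<bar>Im z\<bar>"
    proof (rule sum_bound)
      fix k
      have "norm (U (z + of_nat k)) \<le> C1 * ?e / norm (z + of_nat k) ^ 2"
        using 1(3)[of "z + of_nat k"] z by (simp add: Y_def)
      also have "\<dots> \<le> C1 * ?e / (\<bar>Im z\<bar> ^ 2 + real k ^ 2)"
        using nt[of z k] z(1) pos[of k] 1(1) by (intro divide_left_mono mult_pos_pos) auto
      finally show "norm (U (z + of_nat k)) \<le> C1 * ?e * (1 / (\<bar>Im z\<bar> ^ 2 + real k ^ 2))" by simp
    qed
    moreover have "norm (\<Sum>k. U (z - 1 - of_nat k)) \<le> C2 * ?e * h \<bar>Im z\<bar>"
    proof (rule sum_bound)
      fix k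
      have "norm (U (z - 1 - of_nat k)) \<le> C2 * ?e / norm ((1 - z) + of_nat k) ^ 2"
        using 2(3)[of "(1 - z) + of_nat k"] z unfolding bilateral_term_left by (simp add: Y_def)
      also have "\<dots> \<le> C2 * ?e / (\<bar>Im z\<bar> ^ 2 + real k ^ 2)"
        using nt[of "1 - z" k] z(2) pos[of k] 2(1) by (intro divide_left_mono mult_pos_pos) auto
      finally show "norm (U (z - 1 - of_nat k)) \<le> C2 * ?e * (1 / (\<bar>Im z\<bar> ^ 2 + real k ^ 2))" by simp
    qed
    ultimately have "norm (E z) \<le> C1 * ?e * h \<bar>Im z\<bar> + C2 * ?e * h \<bar>Im z\<bar>"
      unfolding bilateral_series_def by (intro norm_triangle_le add_mono)
    then show ?thesis by (simp add: algebra_simps)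
  qed
  have "norm (E z) \<le> (C1 + C2) * exp (4 * pi * \<bar>Im z\<bar>) * h \<bar>Im z\<bar>" if z: "\<bar>Im z\<bar> \<ge> Y" for z
  proof -
    \<comment> \<open>Subtracting the integer part of \<open>Re z\<close> moves the point into the
      strip without changing \<open>Im z\<close>.\<close>
    let ?w = "z + of_int (- \<lfloor>Re z\<rfloor>)"
    have "norm (E ?w) \<le> (C1 + C2) * exp (4 * pi * \<bar>Im ?w\<bar>) * h \<bar>Im ?w\<bar>"
      by (rule bound0) (use z in \<open>auto simp: algebra_simps, linarith+\<close>)
    then show ?thesis unfolding bilateral_series_plus_of_int by simp
  qed
  moreover have "C1 + C2 \<ge> 0" using 1(1) 2(1) by simp
  ultimately show ?thesis using lim by blast
qed

text \<open>Periodicity and growth of type less than \<open>4 * pi\<close> leave only the three central Fourier modes.\<close>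

lemma bilateral_series_trigonometric: "\<exists>\<alpha> \<beta> \<gamma>. \<forall>z. E z = \<alpha> * exp (- (2 * of_real pi * \<i> * z)) + \<beta> + \<gamma> * exp (2 * of_real pi * \<i> * z)"
proof -
  define m where "m = 2 * of_real pi * \<i>"
  have m0: "m \<noteq> 0" by (simp add: m_def)
  \<comment> \<open>The series as a function of \<open>w = exp (2 * pi * \<i> * z)\<close>; by
    periodicity it does not depend on the branch of the logarithm.\<close>
  define G where "G = (\<lambda>w. E (Ln w / m))"
  have E_exp_cong: "E x = E y" if xy: "exp (m * x) = exp (m * y)" for x y
  proof -
    obtain n :: int where "m * x = m * y + (of_int (2 * n) * pi) * \<i>" using xy unfolding exp_eq by blast
    then have "m * x = m * (y + of_int n)" by (simp add: m_def algebra_simps)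
    then have "x = y + of_int n" using m0 by simp
    then show ?thesis by (simp add: bilateral_series_plus_of_int)
  qed
  have G_exp: "G (exp (m * z)) = E z" for z
    unfolding G_def by (rule E_exp_cong) (use m0 in simp)
  have holG: "G holomorphic_on (- {0})"
  proof -
    have 1: "G holomorphic_on (- \<real>\<^sub>\<le>\<^sub>0)"
      unfolding G_def using m0
      by (intro holomorphic_on_compose_gen[OF _ holomorphic_bilateral_series, unfolded o_def] holomorphic_intros) auto
    \<comment> \<open>Near the cut of \<open>Ln\<close> the function is represented by the branch
      \<open>Ln (- w) + pi * \<i>\<close>, whose cut is the nonnegative axis.\<close>
    have 2: "G holomorphic_on (- \<real>\<^sub>\<ge>\<^sub>0)"
    proof -
      have "(\<lambda>w. E ((Ln (- w) + of_real pi * \<i>) / m)) holomorphic_on (- \<real>\<^sub>\<ge>\<^sub>0)"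
        using m0 by (intro holomorphic_on_compose_gen[OF _ holomorphic_bilateral_series, unfolded o_def] holomorphic_intros)
          (auto simp: complex_nonpos_Reals_iff complex_nonneg_Reals_iff)
      moreover have "E ((Ln (- w) + of_real pi * \<i>) / m) = G w" if "w \<in> - \<real>\<^sub>\<ge>\<^sub>0" for w
      proof -
        have "w \<noteq> 0" using that by auto
        then show ?thesis unfolding G_def using m0 by (intro E_exp_cong) (simp add: exp_add)
      qed
      ultimately show ?thesis by (rule holomorphic_transform)
    qed
    have "(- \<real>\<^sub>\<le>\<^sub>0) \<union> (- \<real>\<^sub>\<ge>\<^sub>0) = - {0 :: complex}"
      by (auto simp: complex_nonpos_Reals_iff complex_nonneg_Reals_iff complex_eq_iff)
    moreover have "open (- \<real>\<^sub>\<le>\<^sub>0 :: complex set)" "open (- \<real>\<^sub>\<ge>\<^sub>0 :: complex set)"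
      by (simp_all add: open_Compl)
    ultimately show ?thesis using holomorphic_on_Un[OF 1 2] by simp
  qed
  obtain C Y h where CY: "C \<ge> 0" "(h \<longlongrightarrow> 0) at_top"
    "\<And>z. \<bar>Im z\<bar> \<ge> Y \<Longrightarrow> norm (E z) \<le> C * exp (4 * pi * \<bar>Im z\<bar>) * h \<bar>Im z\<bar>"
    using bilateral_series_growth by blast
  \<comment> \<open>Since \<open>exp (4 * pi * \<bar>Im z\<bar>) = exp (2 * \<bar>ln (norm
    w)\<bar>)\<close>, the function \<open>G\<close> is \<open>o(norm w powr (- 2))\<close> at 0 and
    \<open>o(norm w ^ 2)\<close> at infinity. Hence \<open>w ^ 2 * G w\<close> extends by 0 to an
    entire function, which is a polynomial of degree at most 4.\<close>
  define P where "P = (\<lambda>w. if w = 0 then 0 else w ^ 2 * G w)"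
  have ImLn: "Im (Ln w / m) = - (ln (norm w) / (2 * pi))" if "w \<noteq> 0" for w
  proof -
    have "Ln w / m = - \<i> * Ln w / (2 * of_real pi)" by (simp add: m_def field_simps)
    then have "Im (Ln w / m) = Im (- \<i> * Ln w / of_real (2 * pi))" by simp
    also have "\<dots> = - Re (Ln w) / (2 * pi)" by (simp only: Im_divide_of_real) simp
    finally show ?thesis using that by simp
  qed
  have G_bound: "norm (G w) \<le> C * exp (2 * \<bar>ln (norm w)\<bar>) * h (\<bar>ln (norm w)\<bar> / (2 * pi))"
    if "w \<noteq> 0" "\<bar>ln (norm w)\<bar> / (2 * pi) \<ge> Y" for w
    using CY(3)[of "Ln w / m"] that unfolding ImLn[OF that(1)] G_def by (simp add: abs_divide)
  have lnlim0: "filterlim (\<lambda>w::complex. \<bar>ln (norm w)\<bar> / (2 * pi)) at_top (at 0)"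
  proof -
    have "filterlim (\<lambda>x::real. \<bar>ln x\<bar> / (2 * pi)) at_top (at_right 0)" by real_asymp
    moreover have "filterlim (\<lambda>w::complex. norm w) (at_right 0) (at 0)"
      unfolding filterlim_at by (auto intro!: tendsto_eq_intros simp: eventually_at_filter)
    ultimately show ?thesis by (rule filterlim_compose)
  qed
  have lnliminf: "filterlim (\<lambda>w::complex. \<bar>ln (norm w)\<bar> / (2 * pi)) at_top at_infinity"
  proof -
    have "filterlim (\<lambda>x::real. \<bar>ln x\<bar> / (2 * pi)) at_top at_top" by real_asymp
    then show ?thesis by (rule filterlim_compose[OF _ filterlim_norm_at_top])
  qed
  have P0: "(P \<longlongrightarrow> 0) (at 0)"
  proof (rule Lim_null_comparison)
    show "((\<lambda>w. C * h (\<bar>ln (norm w)\<bar> / (2 * pi))) \<longlongrightarrow> 0) (at (0::complex))"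
      using tendsto_mult[OF tendsto_const[of C] filterlim_compose[OF CY(2) lnlim0]] by simp
    have e1: "\<forall>\<^sub>F w in at (0::complex). norm w < 1"
      using eventually_at_ball[of 1 "0::complex" UNIV] by (auto simp: eventually_at dist_norm intro: exI[of _ 1])
    have e2: "\<forall>\<^sub>F w in at (0::complex). w \<noteq> 0" by (simp add: eventually_at_filter)
    have e3: "\<forall>\<^sub>F w in at (0::complex). \<bar>ln (norm w)\<bar> / (2 * pi) \<ge> Y"
      using lnlim0 by (simp add: filterlim_at_top)
    show "\<forall>\<^sub>F w in at 0. norm (P w) \<le> C * h (\<bar>ln (norm w)\<bar> / (2 * pi))"
      using e1 e2 e3
    proof eventually_elim
      case (elim w)
      have "exp (2 * \<bar>ln (norm w)\<bar>) = 1 / norm w ^ 2"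
      proof -
        have "2 * \<bar>ln (norm w)\<bar> = - (2 * ln (norm w))" using elim by (simp add: ln_less_zero abs_of_neg)
        then have "exp (2 * \<bar>ln (norm w)\<bar>) = 1 / exp (2 * ln (norm w))" by (simp add: exp_minus divide_inverse)
        also have "exp (2 * ln (norm w)) = norm w ^ 2" using elim by (simp add: exp_double)
        finally show ?thesis .
      qed
      then have "norm (G w) \<le> C * (1 / norm w ^ 2) * h (\<bar>ln (norm w)\<bar> / (2 * pi))"
        using G_bound[of w] elim by simp
      then have "norm w ^ 2 * norm (G w) \<le> norm w ^ 2 * (C * (1 / norm w ^ 2) * h (\<bar>ln (norm w)\<bar> / (2 * pi)))"
        by (intro mult_left_mono) auto
      then show ?case using elim by (simp add: P_def norm_mult norm_power)
    qed
  qed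
  have holP: "P holomorphic_on UNIV"
  proof (rule no_isolated_singularity[of UNIV P "{0}"])
    have "(\<lambda>w. w ^ 2 * G w) holomorphic_on (- {0})" by (intro holomorphic_intros holG)
    then show hol: "P holomorphic_on (UNIV - {0})"
      by (rule holomorphic_transform[THEN holomorphic_on_subset]) (auto simp: P_def)
    have "isCont P w" for w
    proof (cases "w = 0")
      case True
      then show ?thesis using P0 by (simp add: isCont_def P_def)
    next
      case False
      then show ?thesis using holomorphic_on_imp_continuous_on[OF hol]
        by (simp add: continuous_on_eq_continuous_at open_Diff)
    qed
    then show "continuous_on UNIV P" by (simp add: continuous_at_imp_continuous_on)
  qed auto
  have Pinf: "((\<lambda>w. P w / w ^ 4) \<longlongrightarrow> 0) at_infinity"
  proof (rule Lim_null_comparison)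
    show "((\<lambda>w. C * h (\<bar>ln (norm w)\<bar> / (2 * pi))) \<longlongrightarrow> 0) (at_infinity :: complex filter)"
      using tendsto_mult[OF tendsto_const[of C] filterlim_compose[OF CY(2) lnliminf]] by simp
    have e1: "\<forall>\<^sub>F w in (at_infinity :: complex filter). norm w \<ge> 1"
      by (auto simp: eventually_at_infinity)
    have e3: "\<forall>\<^sub>F w in (at_infinity :: complex filter). \<bar>ln (norm w)\<bar> / (2 * pi) \<ge> Y"
      using lnliminf by (simp add: filterlim_at_top)
    show "\<forall>\<^sub>F w in at_infinity. norm (P w / w ^ 4) \<le> C * h (\<bar>ln (norm w)\<bar> / (2 * pi))"
      using e1 e3
    proof eventually_elim
      case (elim w)
      have w0: "w \<noteq> 0" using elim by auto
      have "exp (2 * \<bar>ln (norm w)\<bar>) = norm w ^ 2" using elim w0 by (simp add: exp_double)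
      then have "norm (G w) \<le> C * norm w ^ 2 * h (\<bar>ln (norm w)\<bar> / (2 * pi))"
        using G_bound[of w] elim w0 by simp
      then have "norm (G w) / norm w ^ 2 \<le> C * h (\<bar>ln (norm w)\<bar> / (2 * pi))"
        using w0 by (simp add: divide_simps) (simp add: mult_ac)
      moreover have "norm (P w / w ^ 4) = norm (G w) / norm w ^ 2"
        using w0 by (simp add: P_def norm_mult norm_divide norm_power power_numeral_reduce)
      ultimately show ?case by simp
    qed
  qed
  obtain A where A: "\<And>w. norm w \<ge> A \<Longrightarrow> norm (P w / w ^ 4) < 1"
    using tendstoD[OF Pinf, of 1] by (auto simp: eventually_at_infinity)
  have Pb: "norm (P w) \<le> 1 * norm w ^ 4" if "norm w \<ge> max A 1" for w
    using A[of w] that by (cases "w = 0") (auto simp: norm_divide norm_power divide_simps)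
  define k where "k = (\<lambda>j. (deriv ^^ j) P 0 / fact j)"
  have Pk: "P w = k 0 + k 1 * w + k 2 * w ^ 2 + k 3 * w ^ 3 + k 4 * w ^ 4" for w
  proof -
    have "P w = (\<Sum>j\<le>4. k j * w ^ j)"
      unfolding k_def by (rule Liouville_polynomial[OF holP, where A = "max A 1" and B = 1]) (rule Pb)
    then show ?thesis by (simp add: eval_nat_numeral)
  qed
  \<comment> \<open>The coefficients 0 and 4 are the modes of order -2 and 2. They vanish by the
    little o at 0 and at infinity, respectively.\<close>
  have k0: "k 0 = 0" using Pk[of 0] by (simp add: P_def)
  have k4: "k 4 = 0"
  proof -
    have z: "((\<lambda>w. x / w ^ n) \<longlongrightarrow> 0) (at_infinity :: complex filter)" if "n > 0" for x n
    proof -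
      have "((\<lambda>w. x * inverse w ^ n) \<longlongrightarrow> x * 0 ^ n) (at_infinity :: complex filter)"
        by (intro tendsto_intros tendsto_inverse_0)
      then show ?thesis using that by (simp add: divide_inverse power_inverse zero_power)
    qed
    have "((\<lambda>w. k 1 / w ^ 3 + k 2 / w ^ 2 + k 3 / w ^ 1 + k 4) \<longlongrightarrow> 0 + 0 + 0 + k 4) (at_infinity :: complex filter)"
      by (intro tendsto_intros z) auto
    moreover have "\<forall>\<^sub>F w in at_infinity. k 1 / w ^ 3 + k 2 / w ^ 2 + k 3 / w ^ 1 + k 4 = P w / w ^ 4"
    proof -
      have "\<forall>\<^sub>F w in (at_infinity :: complex filter). norm w \<ge> 1" by (auto simp: eventually_at_infinity)
      then show ?thesis
      proof eventually_elim
        case (elim w)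
        then have "w \<noteq> 0" by auto
        then show ?case unfolding Pk k0 by (simp add: field_simps power_numeral_reduce)
      qed
    qed
    ultimately have "((\<lambda>w. P w / w ^ 4) \<longlongrightarrow> 0 + 0 + 0 + k 4) at_infinity"
      by (rule Lim_transform_eventually)
    then have "0 + 0 + 0 + k 4 = 0" by (rule tendsto_unique[OF trivial_limit_at_infinity _ Pinf])
    then show ?thesis by simp
  qed
  have "E z = k 1 * exp (- (2 * of_real pi * \<i> * z)) + k 2 + k 3 * exp (2 * of_real pi * \<i> * z)" for z
  proof -
    let ?w = "exp (m * z)"
    have "?w ^ 2 * E z = P ?w" by (simp add: P_def G_exp)
    also have "\<dots> = ?w ^ 2 * (k 1 * (1 / ?w) + k 2 + k 3 * ?w)"
      unfolding Pk k0 k4 by (simp add: field_simps power_numeral_reduce)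
    finally have "E z = k 1 * (1 / ?w) + k 2 + k 3 * ?w" by simp
    then show ?thesis by (simp add: m_def exp_minus divide_inverse)
  qed
  then show ?thesis by blast
qed

end

text \<open>With \<open>y = exp (2 * pi * \<i> * x)\<close>, \<open>E x\<close> is a quadratic
  polynomial in \<open>y\<close> divided by \<open>y\<close>. The coefficients are the 3 by 3
  Vandermonde minors of the four nodes, with differences of the \<open>y\<close> turned into
  sines.\<close>

lemma trigonometric_four_points:
  fixes E :: "complex \<Rightarrow> complex"
  assumes E: "\<And>z. E z = \<alpha> * exp (- (2 * of_real pi * \<i> * z)) + \<beta> + \<gamma> * exp (2 * of_real pi * \<i> * z)"
  defines "sn \<equiv> \<lambda>x y. sin (of_real pi * (x - y))"
  shows "E x1 * sn x2 x3 * sn x2 x4 * sn x3 x4 - E x2 * sn x1 x3 * sn x1 x4 * sn x3 x4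
       + E x3 * sn x1 x2 * sn x1 x4 * sn x2 x4 - E x4 * sn x1 x2 * sn x1 x3 * sn x2 x3 = 0"
proof -
  define v where "v = (\<lambda>x. exp (of_real pi * \<i> * x))"
  have v0: "v x \<noteq> 0" for x by (simp add: v_def)
  have Ev: "E x = \<alpha> / v x ^ 2 + \<beta> + \<gamma> * v x ^ 2" for x
  proof -
    have "exp (2 * of_real pi * \<i> * x) = v x ^ 2" by (simp add: v_def exp_double [symmetric] mult_ac)
    then show ?thesis unfolding E by (simp add: exp_minus divide_inverse)
  qed
  have Sv: "sn x y = (v x ^ 2 - v y ^ 2) / (2 * \<i> * v x * v y)" for x y
  proof -
    have "sn x y = (v x / v y - v y / v x) / (2 * \<i>)"
      unfolding sn_def sin_exp_eq v_def by (simp add: exp_diff [symmetric] algebra_simps)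
    then show ?thesis using v0[of x] v0[of y] by (simp add: field_simps power2_eq_square)
  qed
  have key: "(\<alpha> + \<beta> * y1 + \<gamma> * y1 ^ 2) * (y2 - y3) * (y2 - y4) * (y3 - y4) - (\<alpha> + \<beta> * y2 + \<gamma> * y2 ^ 2) * (y1 - y3) * (y1 - y4) * (y3 - y4)
     + (\<alpha> + \<beta> * y3 + \<gamma> * y3 ^ 2) * (y1 - y2) * (y1 - y4) * (y2 - y4) - (\<alpha> + \<beta> * y4 + \<gamma> * y4 ^ 2) * (y1 - y2) * (y1 - y3) * (y2 - y3) = 0"
    for y1 y2 y3 y4 :: complex
    by (simp add: algebra_simps power2_eq_square)
  \<comment> \<open>The common denominator: each summand contains three sines and one division by
    \<open>v x ^ 2\<close>, and every point contributes its \<open>v\<close> squared.\<close>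
  define W where "W = (2 * \<i>) ^ 3 * (v x1 * v x2 * v x3 * v x4) ^ 2"
  have W0: "W \<noteq> 0" using v0 by (simp add: W_def)
  have quotient_term: "E x * sn y z * sn y w * sn z w * W' =
      (\<alpha> + \<beta> * v x ^ 2 + \<gamma> * (v x ^ 2) ^ 2) * (v y ^ 2 - v z ^ 2) * (v y ^ 2 - v w ^ 2) * (v z ^ 2 - v w ^ 2)"
    if "W' = (2 * \<i>) ^ 3 * (v x * v y * v z * v w) ^ 2" for x y z w W'
    unfolding Ev Sv that using v0[of x] v0[of y] v0[of z] v0[of w]
    by (simp add: divide_simps) (simp add: algebra_simps power_numeral_reduce)
  have "(E x1 * sn x2 x3 * sn x2 x4 * sn x3 x4 - E x2 * sn x1 x3 * sn x1 x4 * sn x3 x4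
       + E x3 * sn x1 x2 * sn x1 x4 * sn x2 x4 - E x4 * sn x1 x2 * sn x1 x3 * sn x2 x3) * W = 0"
    unfolding left_diff_distrib distrib_right
    by (subst (1 2 3 4) quotient_term) (simp_all only: key, simp_all add: W_def mult_ac)
  then show ?thesis using W0 by simp
qed

section \<open>Values of the bilateral series where it becomes unilateral\<close>

lemma rGamma_minus_of_nat_zero: "rGamma (1 - of_nat (Suc k) :: complex) = 0"
  by (simp add: rGamma_eq_zero_iff)

lemma rGamma_minus_nat: "rGamma (1 - x - of_nat k) = (-1) ^ k * pochhammer x k * rGamma (1 - x :: complex)"
proof (induction k)
  case (Suc k)
  have "rGamma (1 - x - of_nat (Suc k)) = (- x - of_nat k) * rGamma (1 - x - of_nat k)"
    using rGamma_plus1[of "- x - of_nat k"] by (simp add: algebra_simps)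
  then show ?case unfolding Suc.IH by (simp add: pochhammer_Suc algebra_simps)
qed simp

text \<open>The factor \<open>rGamma (1 + t)\<close> vanishes at negative integers and so removes
  the negative half. In the other half the four signs \<open>(-1) ^ k\<close> cancel.\<close>

lemma bilateral_series_0:
  assumes S: "e + f + g - a - b - c - d = 1"
  shows "bilateral_series 1 e f g a b c d 0 = A (1 - a) (1 - b) (1 - c) (1 - d) * F43_reg a b c d e f g"
proof -
  have z: "bilateral_term 1 e f g a b c d (0 - 1 - of_nat k) = 0" for k
  proof -
    have "rGamma (1 + (0 - 1 - of_nat k) :: complex) = 0" using rGamma_minus_of_nat_zero[of k] by (simp add: rGamma_eq_zero_iff)
    then show ?thesis unfolding bilateral_term_def by simp
  qed
  have "bilateral_term 1 e f g a b c d (0 + of_nat k) = A (1 - a) (1 - b) (1 - c) (1 - d) *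
     (pochhammer a k * pochhammer b k * pochhammer c k * pochhammer d k / fact k *
      (rGamma (e + of_nat k) * rGamma (f + of_nat k) * rGamma (g + of_nat k)))" for k
  proof -
    have f: "rGamma (1 + of_nat k) = 1 / (fact k :: complex)"
      using Gamma_fact[of k, where 'a = complex] by (simp add: rGamma_inverse_Gamma inverse_eq_divide add.commute)
    have s: "(-1) ^ k * ((-1) ^ k * ((-1) ^ k * (-1) ^ k)) = (1 :: complex)"
      by (simp add: power_mult_distrib [symmetric] mult.assoc [symmetric])
    have "bilateral_term 1 e f g a b c d (0 + of_nat k) = ((-1) ^ k * ((-1) ^ k * ((-1) ^ k * (-1) ^ k))) * (A (1 - a) (1 - b) (1 - c) (1 - d) *
     (pochhammer a k * pochhammer b k * pochhammer c k * pochhammer d k / fact k *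
      (rGamma (e + of_nat k) * rGamma (f + of_nat k) * rGamma (g + of_nat k))))"
      unfolding bilateral_term_def A_def add_0 rGamma_minus_nat f by (simp add: mult_ac)
    then show ?thesis unfolding s by simp
  qed
  note terms = this
  have sm: "summable (\<lambda>k. pochhammer a k * pochhammer b k * pochhammer c k * pochhammer d k / fact k *
      (rGamma (e + of_nat k) * rGamma (f + of_nat k) * rGamma (g + of_nat k)))"
    by (rule F43_reg_holomorphic(2)[where a = "\<lambda>_. a" and b = "\<lambda>_. b" and c = "\<lambda>_. c" and d = "\<lambda>_. d" and e = "\<lambda>_. e" and f = "\<lambda>_. f" and g = "\<lambda>_. g"])
       (use S in auto)
  show ?thesis unfolding bilateral_series_def z terms F43_reg_def suminf_mult[OF sm] by simp
qed

text \<open>Reflection exchanges the halves, except that the central term has to pass from one to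
  the other.\<close>

lemma bilateral_series_reflect:
  assumes sum: "p + q + r + s - a - b - c - d = 2"
  shows "bilateral_series p q r s a b c d z = bilateral_series (1 - a) (1 - b) (1 - c) (1 - d) (1 - p) (1 - q) (1 - r) (1 - s) (- z)"
proof -
  let ?U = "bilateral_term p q r s a b c d"
  have 1: "bilateral_term (1 - a) (1 - b) (1 - c) (1 - d) (1 - p) (1 - q) (1 - r) (1 - s) w = ?U (- w)" for w
    by (subst bilateral_term_reflect) simp
  have 2: "(\<Sum>k. ?U (z + of_nat k)) = (\<Sum>k. ?U (z + 1 + of_nat k)) + ?U z"
    using suminf_split_initial_segment[OF summable_bilateral_term(1)[OF sum], of z 1] by (simp add: add_ac)
  have 3: "(\<Sum>k. ?U (z + 1 - 1 - of_nat k)) = (\<Sum>k. ?U (z - 1 - of_nat k)) + ?U z"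
    using suminf_split_initial_segment[OF summable_bilateral_term(2)[OF sum], of "z + 1" 1] by (simp add: algebra_simps)
  have 4: "- (- z - 1 - of_nat k) = z + 1 + of_nat k" "- (- z + of_nat k) = z + 1 - 1 - of_nat k" for k by simp_all
  show ?thesis unfolding bilateral_series_def 1 4 2 3 by simp
qed

lemma bilateral_series_shift:
  "bilateral_series p q r s a b c d (z + w) = bilateral_series (p + w) (q + w) (r + w) (s + w) (a + w) (b + w) (c + w) (d + w) z"
  unfolding bilateral_series_def by (simp add: bilateral_term_def algebra_simps)

text \<open>Shifting by \<open>- a\<close> makes the parameter \<open>a\<close> zero, and reflection
  makes this zero a lower parameter 1, which is the case of
  \<open>bilateral_series_0\<close>.\<close>

lemma bilateral_series_left:
  assumes S: "e + f + g - a - b - c - d = 1"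
  shows "bilateral_series 1 e f g a b c d (- a) = A (1 - a) (e - a) (f - a) (g - a) *
    F43_reg a (1 + a - e) (1 + a - f) (1 + a - g) (1 + a - b) (1 + a - c) (1 + a - d)"
proof -
  have "bilateral_series 1 e f g a b c d (0 + - a) = bilateral_series (1 - a) (e - a) (f - a) (g - a) 0 (b - a) (c - a) (d - a) 0"
    by (subst bilateral_series_shift) simp
  also have "\<dots> = bilateral_series 1 (1 + a - b) (1 + a - c) (1 + a - d) a (1 + a - e) (1 + a - f) (1 + a - g) 0"
    by (subst bilateral_series_reflect) (use S in \<open>simp_all add: algebra_simps\<close>)
  also have "\<dots> = A (1 - a) (1 - (1 + a - e)) (1 - (1 + a - f)) (1 - (1 + a - g)) *
     F43_reg a (1 + a - e) (1 + a - f) (1 + a - g) (1 + a - b) (1 + a - c) (1 + a - d)"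
    by (rule bilateral_series_0) (use S in \<open>simp add: algebra_simps\<close>)
  finally show ?thesis by (simp add: algebra_simps)
qed

lemma hypergeometric_four_term:
  assumes S: "e + f + g - a - b - c - d = 1"
  defines "s \<equiv> \<lambda>x. sin (of_real pi * x)"
  shows "A (1 - a) (1 - b) (1 - c) (1 - d) * F43_reg a b c d e f g * s (b - a) * s (c - a) * s (c - b)
     - A (1 - a) (e - a) (f - a) (g - a) * F43_reg a (1 + a - e) (1 + a - f) (1 + a - g) (1 + a - b) (1 + a - c) (1 + a - d) * s b * s c * s (c - b)
     + A (1 - b) (e - b) (f - b) (g - b) * F43_reg b (1 + b - e) (1 + b - f) (1 + b - g) (1 + b - a) (1 + b - c) (1 + b - d) * s a * s c * s (c - a)
     - A (1 - c) (e - c) (f - c) (g - c) * F43_reg c (1 + c - e) (1 + c - f) (1 + c - g) (1 + c - a) (1 + c - b) (1 + c - d) * s a * s b * s (b - a) = 0"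
proof -
  have sum: "1 + e + f + g - a - b - c - d = 2" using S by (simp add: algebra_simps)
  obtain \<alpha> \<beta> \<gamma> where E: "\<And>z. bilateral_series 1 e f g a b c d z = \<alpha> * exp (- (2 * of_real pi * \<i> * z)) + \<beta> + \<gamma> * exp (2 * of_real pi * \<i> * z)"
    using bilateral_series_trigonometric[OF sum] by blast
  \<comment> \<open>The bilateral series is symmetric in \<open>a, b, c, d\<close>, so the
    evaluation at \<open>- a\<close> serves for \<open>- b\<close> and \<open>- c\<close> as
    well.\<close>
  have perm: "bilateral_series 1 e f g a b c d = bilateral_series 1 e f g b a c d" "bilateral_series 1 e f g a b c d = bilateral_series 1 e f g c a b d"
    by (simp_all add: fun_eq_iff bilateral_series_def bilateral_term_def mult_ac)
  have Eb: "bilateral_series 1 e f g a b c d (- b) = A (1 - b) (e - b) (f - b) (g - b) *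
    F43_reg b (1 + b - e) (1 + b - f) (1 + b - g) (1 + b - a) (1 + b - c) (1 + b - d)"
    unfolding perm(1) by (rule bilateral_series_left) (use S in \<open>simp add: algebra_simps\<close>)
  have Ec: "bilateral_series 1 e f g a b c d (- c) = A (1 - c) (e - c) (f - c) (g - c) *
    F43_reg c (1 + c - e) (1 + c - f) (1 + c - g) (1 + c - a) (1 + c - b) (1 + c - d)"
    unfolding perm(2) by (rule bilateral_series_left) (use S in \<open>simp add: algebra_simps\<close>)
  have m: "- a - - b = b - a" "- a - - c = c - a" "- b - - c = c - b" "0 - - a = a" "0 - - b = b" "0 - - c = c" by simp_all
  show ?thesis
    using trigonometric_four_points[of "bilateral_series 1 e f g a b c d" \<alpha> \<beta> \<gamma> 0 "- a" "- b" "- c", OF E]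
    unfolding m bilateral_series_0[OF S] bilateral_series_left[OF S] Eb Ec s_def .
qed

section \<open>The three-term relation\<close>

text \<open>The origin of the bracket in \<open>B1\<close>: elimination produces the right side as a
  coefficient, and this factorisation extracts \<open>sin (pi * (c - b))\<close> from it. In the
  squares of the exponentials it is the polynomial identity \<open>poly\<close>.\<close>

lemma sin_product_identity:
  fixes u v x y z :: complex
  shows "sin (v - u) * (sin x * sin y * sin z - sin u * sin v * sin (x + y + z - u - v)) =
     sin v * (sin (x - u) * sin (y - u) * sin (z - u)) - sin u * (sin (x - v) * sin (y - v) * sin (z - v))"
proof -
  define E where "E = (\<lambda>t. exp (\<i> * t))"
  have E0: "E t \<noteq> 0" for t by (simp add: E_def)
  have s1: "sin t = (E t ^ 2 - 1) / (2 * \<i> * E t)" for t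
    using E0[of t] unfolding sin_exp_eq by (simp add: E_def exp_minus field_simps power2_eq_square)
  have Ed: "E (t - t') = E t / E t'" for t t' by (simp add: E_def right_diff_distrib exp_diff)
  have Ea: "E (t + t') = E t * E t'" for t t' by (simp add: E_def distrib_left exp_add)
  have s2: "sin (t - t') = (E t ^ 2 - E t' ^ 2) / (2 * \<i> * E t * E t')" for t t'
    using E0[of t] E0[of t'] unfolding s1 Ed by (simp add: field_simps power2_eq_square)
  have s3: "sin (x + y + z - u - v) = (E x ^ 2 * E y ^ 2 * E z ^ 2 - E u ^ 2 * E v ^ 2) / (2 * \<i> * (E x * E y * E z * E u * E v))"
    using E0 unfolding s1 Ed Ea by (simp add: field_simps power2_eq_square)
  have poly: "(b - a) * (a * b * (p - 1) * (q - 1) * (r - 1) - (a - 1) * (b - 1) * (p * q * r - a * b)) =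
     b * (b - 1) * ((p - a) * (q - a) * (r - a)) - a * (a - 1) * ((p - b) * (q - b) * (r - b))" for a b p q r :: complex
    by (simp add: algebra_simps)
  define W where "W = (2 * \<i>) ^ 4 * (E u ^ 3 * E v ^ 3 * E x * E y * E z)"
  have W0: "W \<noteq> 0" using E0 by (simp add: W_def)
  \<comment> \<open>Clears the denominators of a product of four sines; \<open>m\<close> is what
    remains of \<open>W\<close> after division by these denominators.\<close>
  have quot: "n1 / d1 * (n2 / d2 * (n3 / d3) * (n4 / d4)) * V = m * (n1 * (n2 * n3 * n4))"
    if "V = d1 * d2 * d3 * d4 * m" "d1 \<noteq> 0" "d2 \<noteq> 0" "d3 \<noteq> 0" "d4 \<noteq> 0" for n1 n2 n3 n4 d1 d2 d3 d4 m V :: complex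
    using that by simp
  have L: "sin (v - u) * (sin x * sin y * sin z - sin u * sin v * sin (x + y + z - u - v)) * W =
    (E v ^ 2 - E u ^ 2) * (E u ^ 2 * E v ^ 2 * (E x ^ 2 - 1) * (E y ^ 2 - 1) * (E z ^ 2 - 1) -
      (E u ^ 2 - 1) * (E v ^ 2 - 1) * (E x ^ 2 * E y ^ 2 * E z ^ 2 - E u ^ 2 * E v ^ 2))"
  proof -
    have 1: "sin (v - u) * (sin x * sin y * sin z) * W = (E v ^ 2 - E u ^ 2) * (E u ^ 2 * E v ^ 2 * (E x ^ 2 - 1) * (E y ^ 2 - 1) * (E z ^ 2 - 1))"
      unfolding s2 s1[of x] s1[of y] s1[of z]
      by (subst quot[where m = "E u ^ 2 * E v ^ 2"]) (use E0 in \<open>simp_all add: W_def power_numeral_reduce mult_ac\<close>)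
    have 2: "sin (v - u) * (sin u * sin v * sin (x + y + z - u - v)) * W = (E v ^ 2 - E u ^ 2) * ((E u ^ 2 - 1) * (E v ^ 2 - 1) * (E x ^ 2 * E y ^ 2 * E z ^ 2 - E u ^ 2 * E v ^ 2))"
      unfolding s3 unfolding s2 s1[of u] s1[of v]
      by (subst quot[where m = "1"]) (use E0 in \<open>simp_all add: W_def power_numeral_reduce mult_ac\<close>)
    show ?thesis using 1 2 by (simp only: right_diff_distrib left_diff_distrib)
  qed
  have R: "(sin v * (sin (x - u) * sin (y - u) * sin (z - u)) - sin u * (sin (x - v) * sin (y - v) * sin (z - v))) * W =
    E v ^ 2 * (E v ^ 2 - 1) * ((E x ^ 2 - E u ^ 2) * (E y ^ 2 - E u ^ 2) * (E z ^ 2 - E u ^ 2)) -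
    E u ^ 2 * (E u ^ 2 - 1) * ((E x ^ 2 - E v ^ 2) * (E y ^ 2 - E v ^ 2) * (E z ^ 2 - E v ^ 2))"
  proof -
    have 1: "sin v * (sin (x - u) * sin (y - u) * sin (z - u)) * W = E v ^ 2 * (E v ^ 2 - 1) * ((E x ^ 2 - E u ^ 2) * (E y ^ 2 - E u ^ 2) * (E z ^ 2 - E u ^ 2))"
      unfolding s2 s1[of v]
      by (subst quot[where m = "E v ^ 2"]) (use E0 in \<open>simp_all add: W_def power_numeral_reduce mult_ac\<close>)
    have 2: "sin u * (sin (x - v) * sin (y - v) * sin (z - v)) * W = E u ^ 2 * (E u ^ 2 - 1) * ((E x ^ 2 - E v ^ 2) * (E y ^ 2 - E v ^ 2) * (E z ^ 2 - E v ^ 2))"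
      unfolding s2 s1[of u]
      by (subst quot[where m = "E u ^ 2"]) (use E0 in \<open>simp_all add: W_def power_numeral_reduce mult_ac\<close>)
    show ?thesis using 1 2 by (simp only: left_diff_distrib)
  qed
  have "sin (v - u) * (sin x * sin y * sin z - sin u * sin v * sin (x + y + z - u - v)) * W =
     (sin v * (sin (x - u) * sin (y - u) * sin (z - u)) - sin u * (sin (x - v) * sin (y - v) * sin (z - v))) * W"
    unfolding L R poly ..
  then show ?thesis using W0 by simp
qed

text \<open>The left side of the relation multiplied by the sines of \<open>a\<close>,
  \<open>b\<close> and \<open>1 + d - a\<close> (times pi), which stand in the denominators of
  \<open>Kp0\<close>, \<open>Kp1\<close> and \<open>L1bar\<close>. This makes it entire along lines
  in \<open>V\<close>.\<close>

definition three_term_defect :: "complex \<Rightarrow> complex \<Rightarrow> complex \<Rightarrow> complex \<Rightarrow> complex \<Rightarrow> complex \<Rightarrow> complex \<Rightarrow> complex" where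
  "three_term_defect a b c d e f g = (let s = (\<lambda>x. sin (of_real pi * x)) in
     s c * A (1 - a) (e - a) (f - a) (g - a) * A b (1 + b - e) (1 + b - f) (1 + b - g) *
       (F43_reg a b c d e f g * A a (1 + a - e) (1 + a - f) (1 + a - g) +
        F43_reg a (1 + a - e) (1 + a - f) (1 + a - g) (1 + a - b) (1 + a - c) (1 + a - d) * A a b c d) * (s b * s (1 + d - a))
     - s (b - a) * A a b c d * A (1 - c) (e - c) (f - c) (g - c) *
        L_reg (1 - a) (e - a) (f - a) (g - a) (1 + d - a) (1 + c - a) (1 + b - a) * (s a * s b)
     - s b * s c * (s (b - a) * s (c - a) * s d + s (e - a) * s (f - a) * s (g - a)) / of_real pi ^ 4 *
       (F43_reg a b c d e f g * A b (1 + b - e) (1 + b - f) (1 + b - g) +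
        F43_reg b (1 + b - e) (1 + b - f) (1 + b - g) (1 + b - a) (1 + b - c) (1 + b - d) * A a b c d) * (s a * s (1 + d - a)))"

lemma A_reflection:
  "A x y z w * A (1 - x) (1 - y) (1 - z) (1 - w) =
     sin (of_real pi * x) * sin (of_real pi * y) * sin (of_real pi * z) * sin (of_real pi * w) / of_real pi ^ 4"
proof -
  have "A x y z w * A (1 - x) (1 - y) (1 - z) (1 - w) = (rGamma x * rGamma (1 - x)) * (rGamma y * rGamma (1 - y)) *
     (rGamma z * rGamma (1 - z)) * (rGamma w * rGamma (1 - w))"
    by (simp add: A_def mult_ac)
  then show ?thesis unfolding rGamma_reflection_complex by (simp add: power4_eq_xxxx)
qed

lemma A_reflection':
  "A x (1 + x - e) (1 + x - f) (1 + x - g) * A (1 - x) (e - x) (f - x) (g - x) =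
     sin (of_real pi * x) * (sin (of_real pi * (e - x)) * sin (of_real pi * (f - x)) * sin (of_real pi * (g - x))) / of_real pi ^ 4"
proof -
  have s: "sin (of_real pi * (1 + x - y)) = sin (of_real pi * (y - x))" for y
  proof -
    have "of_real pi * (1 + x - y) = of_real pi - of_real pi * (y - x)" by (simp add: algebra_simps)
    then show ?thesis by (simp only:) (simp add: sin_diff flip: sin_of_real cos_of_real)
  qed
  show ?thesis using A_reflection[of x "1 + x - e" "1 + x - f" "1 + x - g"] unfolding s by (simp add: mult_ac)
qed

text \<open>Pure algebra. \<open>F0\<close>, \<open>Fa\<close>, \<open>Fb\<close>, \<open>Fc\<close>
  are the series of the four-term relation \<open>hE\<close>, \<open>N\<close> is the regularised
  \<open>L\<close>, \<open>P\<close> is \<open>A a b c d\<close> and \<open>k\<close> is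
  \<open>1 / pi ^ 4\<close>. Multiplying \<open>hE\<close> by \<open>P * Ab\<close> gives
  \<open>Fc\<close> the coefficient with which it enters through \<open>N\<close>, so that it drops
  out.\<close>

lemma three_term_elimination:
  fixes k :: complex
  assumes h1: "P * A0 = sa * sb * sc * sd * k" and h2: "Aa * Aa' = sa * ea * k"
    and h3: "Ab * Ab' = sb * eb * k" and h4: "Ac * Ac' = sc * ec * k"
    and h5: "(sba * sca * sd + ea) * scb = sca * eb - sba * ec"
    and h6: "- scb * N = sE * (Fc * Ab - Fb * Ac)"
    and hE: "A0 * F0 * sba * sca * scb - Aa' * Fa * sb * sc * scb + Ab' * Fb * sa * sc * sca - Ac' * Fc * sa * sb * sba = 0"
  shows "(sc * Aa' * Ab * (F0 * Aa + Fa * P) * (sb * sE) - sba * P * Ac' * N * (sa * sb)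
     - sb * sc * (sba * sca * sd + ea) * k * (F0 * Ab + Fb * P) * (sa * sE)) * scb = 0"
proof -
  have "(sc * Aa' * Ab * (F0 * Aa + Fa * P) * (sb * sE) - sba * P * Ac' * N * (sa * sb)
     - sb * sc * (sba * sca * sd + ea) * k * (F0 * Ab + Fb * P) * (sa * sE)) * scb =
     sE * (- P * Ab * (A0 * F0 * sba * sca * scb - Aa' * Fa * sb * sc * scb + Ab' * Fb * sa * sc * sca - Ac' * Fc * sa * sb * sba)
      + Ab * F0 * scb * (sc * sb * (Aa * Aa' - sa * ea * k) + sba * sca * (P * A0 - sa * sb * sc * sd * k))
      + P * Fb * (sa * sc * sca * (Ab * Ab' - sb * eb * k) - sba * sa * sb * (Ac * Ac' - sc * ec * k)
          - sa * sb * sc * k * ((sba * sca * sd + ea) * scb - (sca * eb - sba * ec))))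
      + sba * P * Ac' * (sa * sb) * (- scb * N - sE * (Fc * Ab - Fb * Ac))"
    by (simp add: algebra_simps)
  then show ?thesis unfolding h1 h2 h3 h4 h5 h6 hE by simp
qed

text \<open>The factor \<open>sin (pi * (c - b))\<close> comes from \<open>L_reg_antipode\<close>,
  where it belongs, up to sign, to the fifth parameter \<open>1 + c - b\<close> of the transformed
  \<open>L_reg\<close>. Expressing \<open>L\<close> by the series \<open>Fb\<close> and
  \<open>Fc\<close> would mean dividing by it.\<close>

lemma three_term_generic:
  assumes S: "e + f + g - a - b - c - d = 1"
  shows "three_term_defect a b c d e f g * sin (of_real pi * (c - b)) = 0"
proof -
  let ?s = "\<lambda>x. sin (of_real pi * x)"
  define Fb where "Fb = F43_reg b (1 + b - e) (1 + b - f) (1 + b - g) (1 + b - a) (1 + b - c) (1 + b - d)"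
  define Fc where "Fc = F43_reg c (1 + c - e) (1 + c - f) (1 + c - g) (1 + c - a) (1 + c - b) (1 + c - d)"
  define N where "N = L_reg (1 - a) (e - a) (f - a) (g - a) (1 + d - a) (1 + c - a) (1 + b - a)"
  have sc1: "?s (1 + c - b) = - ?s (c - b)"
  proof -
    have "of_real pi * (1 + c - b) = of_real pi + of_real pi * (c - b)" by (simp add: algebra_simps)
    then show ?thesis by (simp only:) (simp add: sin_add flip: sin_of_real cos_of_real)
  qed
  have h6: "- ?s (c - b) * N = ?s (1 + d - a) * (Fc * A b (1 + b - e) (1 + b - f) (1 + b - g) - Fb * A c (1 + c - e) (1 + c - f) (1 + c - g))"
  proof -
    have S': "(1 + d - a) + (1 + c - a) + (1 + b - a) - (1 - a) - (e - a) - (f - a) - (g - a) = 1"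
      using S by (simp add: algebra_simps)
    have eqs: "1 + (1 + c - a) - (1 + b - a) = 1 + c - b" "1 + c - a - (e - a) = 1 + c - e" "1 + c - a - (1 - a) = c"
       "1 + c - a - (g - a) = 1 + c - g" "1 + c - a - (f - a) = 1 + c - f" "1 + (1 + c - a) - (1 + d - a) = 1 + c - d"
      by simp_all
    have "?s (1 + c - b) * N = ?s (1 + d - a) * L_reg (1 + c - e) c (1 + c - g) (1 + c - f) (1 + c - b) (1 + c - a) (1 + c - d)"
      using L_reg_antipode[OF S'] unfolding eqs N_def .
    \<comment> \<open>In this form the two halves of \<open>L_reg\<close> are the series of the
      four-term relation at \<open>- c\<close> and \<open>- b\<close>.\<close>
    also have "L_reg (1 + c - e) c (1 + c - g) (1 + c - f) (1 + c - b) (1 + c - a) (1 + c - d) =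
      Fc * A b (1 + b - e) (1 + b - f) (1 + b - g) - Fb * A c (1 + c - e) (1 + c - f) (1 + c - g)"
    proof -
      have eqs: "1 + (1 + c - x) - (1 + c - b) = 1 + b - x" "1 + c - (1 + c - b) = b" "2 - (1 + c - b) = 1 + b - c" for x by simp_all
      show ?thesis unfolding L_reg_def eqs Fb_def Fc_def
        by (simp add: F43_reg_def A_def mult_ac)
    qed
    finally show ?thesis unfolding sc1 .
  qed
  have h5: "(?s (b - a) * ?s (c - a) * ?s d + ?s (e - a) * ?s (f - a) * ?s (g - a)) * ?s (c - b) =
     ?s (c - a) * (?s (e - b) * ?s (f - b) * ?s (g - b)) - ?s (b - a) * (?s (e - c) * ?s (f - c) * ?s (g - c))"
  proof -
    \<comment> \<open>On \<open>V\<close> the argument on the right is \<open>pi * (1 + d)\<close>,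
      which accounts for the sign.\<close>
    have d: "?s d = - sin (of_real pi * (e - a) + of_real pi * (f - a) + of_real pi * (g - a) - of_real pi * (b - a) - of_real pi * (c - a))"
    proof -
      have "of_real pi * (e - a) + of_real pi * (f - a) + of_real pi * (g - a) - of_real pi * (b - a) - of_real pi * (c - a) =
        of_real pi * (e + f + g - a - b - c - d) + of_real pi * d" by (simp add: algebra_simps)
      then show ?thesis unfolding S by (simp only:) (simp add: sin_add flip: sin_of_real cos_of_real)
    qed
    have m: "of_real pi * (x - b) = of_real pi * (x - a) - of_real pi * (b - a)"
      "of_real pi * (x - c) = of_real pi * (x - a) - of_real pi * (c - a)" for x by (simp_all add: algebra_simps)
    have r: "(p * q * - r + t) * w = w * (t - p * q * r)" for p q r t w :: complex
      by (simp add: algebra_simps)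
    show ?thesis
      unfolding d m[of e] m[of f] m[of g] m(1)[of c] r by (rule sin_product_identity)
  qed
  show ?thesis
    unfolding three_term_defect_def Let_def Fb_def [symmetric] N_def [symmetric] divide_inverse[of "_ * (_ + _)"]
    by (rule three_term_elimination[OF _ A_reflection'[of a e f g, unfolded divide_inverse] A_reflection'[of b e f g, unfolded divide_inverse]
       A_reflection'[of c e f g, unfolded divide_inverse] h5 h6 hypergeometric_four_term[OF S, folded Fb_def Fc_def]])
      (simp add: A_reflection divide_inverse)
qed

lemma three_term_defect_holomorphic:
  assumes hol: "a holomorphic_on UNIV" "b holomorphic_on UNIV" "c holomorphic_on UNIV" "d holomorphic_on UNIV"
      "e holomorphic_on UNIV" "f holomorphic_on UNIV" "g holomorphic_on UNIV"
    and sum: "\<And>z. e z + f z + g z - a z - b z - c z - d z = 1"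
  shows "(\<lambda>z. three_term_defect (a z) (b z) (c z) (d z) (e z) (f z) (g z)) holomorphic_on UNIV"
proof -
  have sum1: "(1 + a z - b z) + (1 + a z - c z) + (1 + a z - d z) - a z - (1 + a z - e z) - (1 + a z - f z) - (1 + a z - g z) = 1"
    "(1 + b z - a z) + (1 + b z - c z) + (1 + b z - d z) - b z - (1 + b z - e z) - (1 + b z - f z) - (1 + b z - g z) = 1" for z
    using sum[of z] by (simp_all add: algebra_simps)
  have sum2: "(1 + d z - a z) + (1 + c z - a z) + (1 + b z - a z) - (1 - a z) - (e z - a z) - (f z - a z) - (g z - a z) = 1" for z
    using sum[of z] by (simp add: algebra_simps)
  show ?thesis unfolding three_term_defect_def Let_def A_def
    by (intro holomorphic_intros F43_reg_holomorphic(1) L_reg_holomorphic hol sum sum1 sum2) auto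
qed

text \<open>If \<open>c - b\<close> is an integer, moving along \<open>c + z\<close>,
  \<open>d - z\<close> stays in \<open>V\<close> and makes the sine nonzero for real
  \<open>0 < z < 1\<close>; the identity theorem then gives the value at
  \<open>z = 0\<close>.\<close>

lemma three_term_defect_zero:
  assumes S: "e + f + g - a - b - c - d = 1"
  shows "three_term_defect a b c d e f g = 0"
proof (cases "sin (of_real pi * (c - b)) = 0")
  case False
  then show ?thesis using three_term_generic[OF S] by simp
next
  case True
  then obtain n :: int where "of_real pi * (c - b) = of_real (of_int n * pi)" unfolding sin_eq_0 by blast
  then have "of_real pi * (c - b) = of_real pi * (of_int n :: complex)" by (simp add: mult.commute)
  then have n: "c - b = of_int n" by simp
  let ?F = "\<lambda>z. three_term_defect a b (c + z) (d - z) e f g"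
  have hol: "?F holomorphic_on UNIV"
    by (intro three_term_defect_holomorphic holomorphic_intros) (use S in \<open>simp add: algebra_simps\<close>)
  have "?F 0 = 0"
  proof (rule holomorphic_zero_if_zero_on_reals[OF hol zero_less_one])
    fix x :: real assume x: "0 < x" "x < 1"
    have S': "e + f + g - a - b - (c + of_real x) - (d - of_real x) = 1" using S by (simp add: algebra_simps)
    have "sin (of_real pi * (c + of_real x - b)) \<noteq> 0"
    proof
      assume "sin (of_real pi * (c + of_real x - b)) = 0"
      then obtain m :: int where "of_real pi * (c + of_real x - b) = of_real (of_int m * pi)" unfolding sin_eq_0 by blast
      then have "of_real pi * (c + of_real x - b) = of_real pi * (of_int m :: complex)" by (simp add: mult.commute)
      then have "c + of_real x - b = of_int m" by simp
      then have "complex_of_real x = of_real (of_int (m - n))" using n by (simp add: algebra_simps)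
      then have "x = of_int (m - n)" by (simp only: of_real_eq_iff)
      then show False using x by simp
    qed
    then show "?F (of_real x) = 0" using three_term_generic[OF S'] by simp
  qed
  then show ?thesis by simp
qed

section \<open>Return from the regularised functions to \<open>K\<close> and
  \<open>L\<close>\<close>

lemma F43_eq_reg:
  assumes S: "e + f + g - a - b - c - d = 1" and nz: "e \<notin> \<int>\<^sub>\<le>\<^sub>0" "f \<notin> \<int>\<^sub>\<le>\<^sub>0" "g \<notin> \<int>\<^sub>\<le>\<^sub>0"
  shows "F43 a b c d e f g * (rGamma e * rGamma f * rGamma g) = F43_reg a b c d e f g"
proof -
  let ?t = "\<lambda>k. pochhammer a k * pochhammer b k * pochhammer c k * pochhammer d k / fact k *
      (rGamma (e + of_nat k) * rGamma (f + of_nat k) * rGamma (g + of_nat k))"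
  have r0: "rGamma e * rGamma f * rGamma g \<noteq> 0" using nz by (simp add: rGamma_eq_zero_iff)
  have sm: "summable ?t"
    by (rule F43_reg_holomorphic(2)[where a = "\<lambda>_. a" and b = "\<lambda>_. b" and c = "\<lambda>_. c" and d = "\<lambda>_. d" and e = "\<lambda>_. e" and f = "\<lambda>_. f" and g = "\<lambda>_. g"])
       (use S in auto)
  have p: "rGamma x = pochhammer x k * rGamma (x + of_nat k)" for x :: complex and k by (rule pochhammer_rGamma)
  have t: "(pochhammer a k * pochhammer b k * pochhammer c k * pochhammer d k) /
           (fact k * pochhammer e k * pochhammer f k * pochhammer g k) = ?t k / (rGamma e * rGamma f * rGamma g)" for k
    using r0 unfolding p[of e k] p[of f k] p[of g k] by (simp add: divide_simps)
  have "F43 a b c d e f g = F43_reg a b c d e f g / (rGamma e * rGamma f * rGamma g)"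
    unfolding F43_def F43_reg_def t by (rule suminf_divide[OF sm])
  then show ?thesis using r0 by simp
qed

lemma K_eq_reg:
  assumes S: "e + f + g - a - b - c - d = 1" and "K_defined a b c d e f g"
  shows "K a b c d e f g * sin (of_real pi * a) = F43_reg a b c d e f g * A a (1 + a - e) (1 + a - f) (1 + a - g) +
        F43_reg a (1 + a - e) (1 + a - f) (1 + a - g) (1 + a - b) (1 + a - c) (1 + a - d) * A a b c d"
proof -
  have nz: "x \<notin> \<int>\<^sub>\<le>\<^sub>0" if "x \<in> {e, f, g, 1 + a - b, 1 + a - c, 1 + a - d}" for x
    using assms(2) that by (auto simp: K_defined_def)
  have s: "sin (of_real pi * a) \<noteq> 0" using assms(2) by (simp add: K_defined_def)
  have 1: "F43 a b c d e f g * (rGamma e * rGamma f * rGamma g) = F43_reg a b c d e f g"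
    by (rule F43_eq_reg[OF S]) (auto intro!: nz)
  have 2: "F43 a (1 + a - e) (1 + a - f) (1 + a - g) (1 + a - b) (1 + a - c) (1 + a - d) *
      (rGamma (1 + a - b) * rGamma (1 + a - c) * rGamma (1 + a - d)) = F43_reg a (1 + a - e) (1 + a - f) (1 + a - g) (1 + a - b) (1 + a - c) (1 + a - d)"
    by (rule F43_eq_reg) (use S in \<open>auto intro!: nz simp: algebra_simps\<close>)
  show ?thesis unfolding 1 [symmetric] 2 [symmetric] K_def A_def using s by (simp add: field_simps)
qed

lemma L_eq_reg:
  assumes S: "e + f + g - a - b - c - d = 1" and "L_defined a b c d e f g"
  shows "L a b c d e f g * sin (of_real pi * e) = L_reg a b c d e f g"
proof -
  have nz: "x \<notin> \<int>\<^sub>\<le>\<^sub>0" if "x \<in> {e, f, g, 2 - e, 1 + f - e, 1 + g - e}" for x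
    using assms(2) that by (auto simp: L_defined_def)
  have s: "sin (of_real pi * e) \<noteq> 0" using assms(2) by (simp add: L_defined_def)
  have 1: "F43 a b c d e f g * (rGamma e * rGamma f * rGamma g) = F43_reg a b c d e f g"
    by (rule F43_eq_reg[OF S]) (auto intro!: nz)
  have 2: "F43 (1 + a - e) (1 + b - e) (1 + c - e) (1 + d - e) (2 - e) (1 + f - e) (1 + g - e) *
      (rGamma (2 - e) * rGamma (1 + f - e) * rGamma (1 + g - e)) = F43_reg (1 + a - e) (1 + b - e) (1 + c - e) (1 + d - e) (2 - e) (1 + f - e) (1 + g - e)"
    by (rule F43_eq_reg) (use S in \<open>auto intro!: nz simp: algebra_simps\<close>)
  show ?thesis unfolding L_reg_def 1 [symmetric] 2 [symmetric] L_def using s by (simp add: field_simps)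
qed

theorem proposition6p5:
  fixes x :: "complex ^ 7" and a b c d e f g :: complex
  assumes "x = vector [a, b, c, d, e, f, g]" and "x \<in> V"
    and "Kp0_defined x" and "Kp1_defined x" and "L1bar_defined x"
  shows "S [c] * A (1 - a) (e - a) (f - a) (g - a) * A b (1 + b - e) (1 + b - f) (1 + b - g) * Kp0 x
       - S [b - a] * A a b c d * A (1 - c) (e - c) (f - c) (g - c) * L1bar x
       - B1 x * Kp1 x = 0"
proof -
  let ?s = "\<lambda>x. sin (of_real pi * x)"
  note x = assms(1) and comp = vector_7[of a b c d e f g]
  have S: "e + f + g - a - b - c - d = 1"
  proof -
    obtain a' b' c' d' e' f' g' where "x = vector [a', b', c', d', e', f', g']" "e' + f' + g' - a' - b' - c' - d' = 1"
      using assms(2) by (auto simp: V_def)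
    then show ?thesis using comp vector_7[of a' b' c' d' e' f' g'] unfolding x by metis
  qed
  have K0: "K_defined a b c d e f g" using assms(3) by (simp add: Kp0_defined_def x vector_7)
  have K1: "K_defined b c d a e f g" using assms(4) by (simp add: Kp1_defined_def x vector_7)
  have L1: "L_defined (1 - a) (e - a) (f - a) (g - a) (1 + d - a) (1 + c - a) (1 + b - a)"
    using assms(5) by (simp add: L1bar_defined_def x vector_7 Let_def)
  have s: "?s a \<noteq> 0" "?s b \<noteq> 0" "?s (1 + d - a) \<noteq> 0"
    using K0 K1 L1 by (simp_all add: K_defined_def L_defined_def)
  let ?Q = "?s (b - a) * ?s (c - a) * ?s d + ?s (e - a) * ?s (f - a) * ?s (g - a)"
  have k0: "K a b c d e f g * ?s a = F43_reg a b c d e f g * A a (1 + a - e) (1 + a - f) (1 + a - g) +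
        F43_reg a (1 + a - e) (1 + a - f) (1 + a - g) (1 + a - b) (1 + a - c) (1 + a - d) * A a b c d"
    by (rule K_eq_reg[OF S K0])
  have k1: "K b c d a e f g * ?s b = F43_reg a b c d e f g * A b (1 + b - e) (1 + b - f) (1 + b - g) +
        F43_reg b (1 + b - e) (1 + b - f) (1 + b - g) (1 + b - a) (1 + b - c) (1 + b - d) * A a b c d"
  \<comment> \<open>\<open>Kp1\<close> has the upper parameters cyclically permuted;
    \<open>F43_reg\<close> is symmetric in its upper and in its lower parameters, and
    \<open>A\<close> in all of its arguments.\<close>
  proof -
    have "K b c d a e f g * ?s b = F43_reg b c d a e f g * A b (1 + b - e) (1 + b - f) (1 + b - g) +
        F43_reg b (1 + b - e) (1 + b - f) (1 + b - g) (1 + b - c) (1 + b - d) (1 + b - a) * A b c d a"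
      by (rule K_eq_reg[OF _ K1]) (use S in \<open>simp add: algebra_simps\<close>)
    then show ?thesis by (simp add: F43_reg_def A_def mult_ac)
  qed
  have l: "L (1 - a) (e - a) (f - a) (g - a) (1 + d - a) (1 + c - a) (1 + b - a) * ?s (1 + d - a) =
      L_reg (1 - a) (e - a) (f - a) (g - a) (1 + d - a) (1 + c - a) (1 + b - a)"
    by (rule L_eq_reg[OF _ L1]) (use S in \<open>simp add: algebra_simps\<close>)
  \<comment> \<open>The three sines are nonzero where the \<open>K\<close> and \<open>L\<close>
    functions are defined, so they can be cancelled once the product is known to vanish.\<close>
  have "(?s c * A (1 - a) (e - a) (f - a) (g - a) * A b (1 + b - e) (1 + b - f) (1 + b - g) * K a b c d e f g
       - ?s (b - a) * A a b c d * A (1 - c) (e - c) (f - c) (g - c) * L (1 - a) (e - a) (f - a) (g - a) (1 + d - a) (1 + c - a) (1 + b - a)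
       - ?s b * ?s c * ?Q / of_real pi ^ 4 * K b c d a e f g) * (?s a * ?s b * ?s (1 + d - a)) = three_term_defect a b c d e f g"
    unfolding three_term_defect_def Let_def k0 [symmetric] k1 [symmetric] l [symmetric]
    by (simp add: algebra_simps)
  then have "?s c * A (1 - a) (e - a) (f - a) (g - a) * A b (1 + b - e) (1 + b - f) (1 + b - g) * K a b c d e f g
       - ?s (b - a) * A a b c d * A (1 - c) (e - c) (f - c) (g - c) * L (1 - a) (e - a) (f - a) (g - a) (1 + d - a) (1 + c - a) (1 + b - a)
       - ?s b * ?s c * ?Q / of_real pi ^ 4 * K b c d a e f g = 0"
    unfolding three_term_defect_zero[OF S] using s by simp
  then show ?thesis
    by (simp add: Kp0_def Kp1_def L1bar_def B1_def x vector_7 Let_def S_def mult.assoc)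
qed

end
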